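(* Assume $\sigma=0$, and let $u_{hb},v_{hb}\in V_{hb}^0$ be two solutions of the Dynamic Diffusion problem $$B(w_{hb},z_{hb})+D_h(w_{hb};w_{hb},z_{hb})=(f,z_{hb})\qquad\forall z_{hb}\in V_{hb}^0$$ (with unknown $w_{hb}\in V_{hb}^0$). Define $L_h^0:=\max_{T\in\mathcal T_h}L_T^0$, where $$L_T^0=\chi_T\frac{\mu(h_T)}{\tau}\left(\|\boldsymbol\beta\|_{0,\infty,T}+q_T\right),$$ and let $C_P$ be the Poincaré constant. If $$\frac{C_PL_h^0\|f\|_0}{\varepsilon^2}<1,$$ then $u_{hb}=v_{hb}$. Hence the discrete solution of the Dynamic Diffusion problem is unique (any two solutions coincide).
   Context: Data. $\Omega\subset\mathbb R^d$, $d\in\{2,3\}$, is a bounded polygonal ($d=2$) or polyhedral ($d=3$) domain with Lipschitz boundary; $\varepsilon>0$, $\boldsymbol\beta\in[W^{1,\infty}(\Omega)]^d$ with $\nabla\cdot\boldsymbol\beta=0$, $\sigma\ge0$ a constant (here $\sigma=0$), $f\in L^2(\Omega)$. $(\cdot,\cdot)$ and $(\cdot,\cdot)_T$ are the $L^2$ inner products over $\Omega$ and $T$, $\|\cdot\|_0,\|\cdot\|_{0,T}$ the corresponding norms; $|v|_1=\|\nabla v\|_0$, $|v|_{1,T}=\|\nabla v\|_{0,T}$. $\|\boldsymbol\beta\|_{0,\infty,T}$ is the essential supremum over $T$ of the Euclidean norm of $\boldsymbol\beta$. The Poincaré constant $C_P$ satisfies $\|v\|_0\le C_P|v|_1$ for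 all $v\in H_0^1(\Omega)$. $$B(w,v)=\varepsilon(\nabla w,\nabla v)+(\boldsymbol\beta\cdot\nabla w,v)+\sigma(w,v).$$ Discrete spaces. $\mathcal T_h$ is a conforming, shape-regular triangulation of $\Omega$ into simplices; $h_T=\operatorname{diam}(T)$, $h=\max_Th_T$. $V_h^0=\{v\in H_0^1(\Omega): v|_T\in\mathbb P_1(T)\ \forall T\in\mathcal T_h\}$; $V_b=\bigoplus_T\operatorname{span}\{\psi_T\}$, where $\psi_T\in H_0^1(T)$ is the standard simplex bubble of degree $d+1$ (product of the barycentric coordinates of $T$, up to scaling), extended by zero; $V_{hb}^0=V_h^0\oplus V_b$. $\kappa_h:V_{hb}^0\to V_h^0$ is the projection $\kappa_h(v_h+v_b)=v_h$ for $v_h\in V_h^0$, $v_b\in V_b$. Artificial diffusion. For $v_h\in V_h^0$ and $\sigma=0$, $R_T(v_h)=\boldsymbol\beta\cdot\nabla v_h-f$ on $T$. $Pe_T=\|\boldsymbol\beta\|_{0,\infty,T}h_T/(2\varepsilon)$; $\chi_T=1$ if $Pe_T>1$, $\chi_T=0$ if $Pe_T\le1$. Fix $\tau>0$ and numbers $\mu(h_T)>0$ with $\mu(h_T)\le C_\mu h_T$, $C_\mu$ independent of $h$. For $\sigma=0$, $$\xi_T(v_h)=\chi_T\,\mu(h_T)\frac{\|R_T(v_h)\|_{0,T}}{|v_h|_{1,T}+\tau},$$ and $$D_h(z_{hb};u_{hb},v_{hb})=\sum_{T\in\mathcal T_h}\xi_T(\kappa_h(z_{hb}))(\nabla u_{hb},\nabla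 v_{hb})_T .$$ For $\sigma=0$, $q_T=\|\boldsymbol\beta\|_{0,\infty,T}+\tau^{-1}\|f\|_{0,T}$. *)

theory Defs
  imports "HOL-Analysis.Analysis" "HOL-Probability.Essential_Supremum"
begin

text \<open>
  Elements of Lebesgue and Sobolev spaces on \<open>S\<close> are represented by functions on the whole
  ambient space, of which only the values on \<open>S\<close>, up to null sets, matter. All spaces below are
  closed under modification on null sets, and equality of two elements is equality almost
  everywhere on \<open>S\<close>.
\<close>

section \<open>Lebesgue spaces\<close>

definition L2 :: "'a::euclidean_space set \<Rightarrow> ('a \<Rightarrow> 'b::euclidean_space) set" where
  "L2 S = {f \<in> borel_measurable (lebesgue_on S). integrable (lebesgue_on S) (\<lambda>x. (norm (f x))\<^sup>2)}"

definition l2_inner ::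
    "'a::euclidean_space set \<Rightarrow> ('a \<Rightarrow> 'b::euclidean_space) \<Rightarrow> ('a \<Rightarrow> 'b) \<Rightarrow> real" where
  "l2_inner S f g = (\<integral>x. f x \<bullet> g x \<partial>lebesgue_on S)"

definition l2_norm :: "'a::euclidean_space set \<Rightarrow> ('a \<Rightarrow> 'b::euclidean_space) \<Rightarrow> real" where
  "l2_norm S f = sqrt (l2_inner S f f)"

definition Linf :: "'a::euclidean_space set \<Rightarrow> ('a \<Rightarrow> 'b::euclidean_space) set" where
  "Linf S = {f \<in> borel_measurable (lebesgue_on S).
               esssup (lebesgue_on S) (\<lambda>x. ereal (norm (f x))) < \<infinity>}"

definition linf_norm :: "'a::euclidean_space set \<Rightarrow> ('a \<Rightarrow> 'b::euclidean_space) \<Rightarrow> real" where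
  "linf_norm S f = real_of_ereal (esssup (lebesgue_on S) (\<lambda>x. ereal (norm (f x))))"


section \<open>Test functions, weak derivatives and Sobolev spaces\<close>

primrec Ck :: "nat \<Rightarrow> ('a::euclidean_space \<Rightarrow> real) \<Rightarrow> bool" where
  "Ck 0 f \<longleftrightarrow> continuous_on UNIV f"
| "Ck (Suc k) f \<longleftrightarrow>
     (\<forall>x. f differentiable at x) \<and> (\<forall>i\<in>Basis. Ck k (\<lambda>x. frechet_derivative f (at x) i))"

definition test_functions :: "'a::euclidean_space set \<Rightarrow> ('a \<Rightarrow> real) set" where
  "test_functions \<Omega> =
     {\<phi>. (\<forall>k. Ck k \<phi>) \<and> compact (closure {x. \<phi> x \<noteq> 0}) \<and> closure {x. \<phi> x \<noteq> 0} \<subseteq> \<Omega>}"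

definition locally_integrable_on ::
    "('a::euclidean_space \<Rightarrow> 'b::euclidean_space) \<Rightarrow> 'a set \<Rightarrow> bool"
    (infixr "locally'_integrable'_on" 46) where
  "f locally_integrable_on \<Omega> \<longleftrightarrow> (\<forall>K. compact K \<and> K \<subseteq> \<Omega> \<longrightarrow> f absolutely_integrable_on K)"

definition has_weak_gradient ::
    "'a::euclidean_space set \<Rightarrow> ('a \<Rightarrow> real) \<Rightarrow> ('a \<Rightarrow> 'a) \<Rightarrow> bool" where
  "has_weak_gradient \<Omega> v G \<longleftrightarrow>
     v locally_integrable_on \<Omega> \<and> G locally_integrable_on \<Omega> \<and>
     (\<forall>\<phi>\<in>test_functions \<Omega>. \<forall>i\<in>Basis.
        (\<integral>x. v x * frechet_derivative \<phi> (at x) i \<partial>lebesgue_on \<Omega>) =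
        - (\<integral>x. (G x \<bullet> i) * \<phi> x \<partial>lebesgue_on \<Omega>))"

text \<open>The weak gradient is unique up to null sets, so the choice of representative is immaterial.\<close>

definition wgrad :: "'a::euclidean_space set \<Rightarrow> ('a \<Rightarrow> real) \<Rightarrow> 'a \<Rightarrow> 'a" where
  "wgrad \<Omega> v = (SOME G. has_weak_gradient \<Omega> v G)"

definition weak_div :: "'a::euclidean_space set \<Rightarrow> ('a \<Rightarrow> 'a) \<Rightarrow> 'a \<Rightarrow> real" where
  "weak_div \<Omega> b x = (\<Sum>i\<in>Basis. wgrad \<Omega> (\<lambda>y. b y \<bullet> i) x \<bullet> i)"

definition W1inf :: "'a::euclidean_space set \<Rightarrow> ('a \<Rightarrow> real) set" where
  "W1inf \<Omega> = {v \<in> Linf \<Omega>. \<exists>G\<in>Linf \<Omega>. has_weak_gradient \<Omega> v G}"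

definition H1 :: "'a::euclidean_space set \<Rightarrow> ('a \<Rightarrow> real) set" where
  "H1 \<Omega> = {v \<in> L2 \<Omega>. \<exists>G\<in>L2 \<Omega>. has_weak_gradient \<Omega> v G}"

definition h1_norm :: "'a::euclidean_space set \<Rightarrow> ('a \<Rightarrow> real) \<Rightarrow> real" where
  "h1_norm \<Omega> v = sqrt ((l2_norm \<Omega> v)\<^sup>2 + (l2_norm \<Omega> (wgrad \<Omega> v))\<^sup>2)"

text \<open>The closure of the test functions in \<^term>\<open>H1 \<Omega>\<close>.\<close>

definition H10 :: "'a::euclidean_space set \<Rightarrow> ('a \<Rightarrow> real) set" where
  "H10 \<Omega> = {v \<in> H1 \<Omega>. \<forall>e>0. \<exists>\<phi>\<in>test_functions \<Omega>. h1_norm \<Omega> (\<lambda>x. v x - \<phi> x) < e}"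

definition poincare_constant :: "'a::euclidean_space set \<Rightarrow> real \<Rightarrow> bool" where
  "poincare_constant \<Omega> C \<longleftrightarrow> (\<forall>v\<in>H10 \<Omega>. l2_norm \<Omega> v \<le> C * l2_norm \<Omega> (wgrad \<Omega> v))"


section \<open>Domains and meshes\<close>

text \<open>
  Near each boundary point, \<open>\<Omega>\<close> is the set above the graph of a Lipschitz function of the
  coordinates orthogonal to a unit vector \<open>e\<close>. Only the values of \<open>g\<close> on the hyperplane orthogonal
  to \<open>e\<close> matter.
\<close>

definition lipschitz_boundary :: "'a::euclidean_space set \<Rightarrow> bool" where
  "lipschitz_boundary \<Omega> \<longleftrightarrow>
     (\<forall>p\<in>frontier \<Omega>. \<exists>e r L (g :: 'a \<Rightarrow> real).
        norm e = 1 \<and> r > 0 \<and> L-lipschitz_on UNIV g \<and>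
        (\<forall>x\<in>ball p r. x \<in> \<Omega> \<longleftrightarrow> g (x - (x \<bullet> e) *\<^sub>R e) < x \<bullet> e))"

definition polyhedral_boundary :: "'a::euclidean_space set \<Rightarrow> bool" where
  "polyhedral_boundary \<Omega> \<longleftrightarrow>
     (\<exists>F. finite F \<and> (\<forall>P\<in>F. polytope P \<and> aff_dim P = int DIM('a) - 1) \<and> frontier \<Omega> = \<Union>F)"

definition bounded_polyhedral_lipschitz_domain :: "'a::euclidean_space set \<Rightarrow> bool" where
  "bounded_polyhedral_lipschitz_domain \<Omega> \<longleftrightarrow>
     \<Omega> \<noteq> {} \<and> open \<Omega> \<and> connected \<Omega> \<and> bounded \<Omega> \<and> polyhedral_boundary \<Omega> \<and> lipschitz_boundary \<Omega>"

text \<open>Conformity, i.e. that two elements meet in a common face, is part of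
  \<^const>\<open>triangulation\<close>.\<close>

definition conforming_mesh :: "'a::euclidean_space set \<Rightarrow> 'a set set \<Rightarrow> bool" where
  "conforming_mesh \<Omega> \<T> \<longleftrightarrow>
     triangulation \<T> \<and> (\<forall>T\<in>\<T>. int DIM('a) simplex T) \<and> \<Union>\<T> = closure \<Omega>"

definition inradius :: "'a::euclidean_space set \<Rightarrow> real" where
  "inradius T = Sup {r. 0 \<le> r \<and> (\<exists>c. cball c r \<subseteq> T)}"

text \<open>
  Shape regularity is a property of a family of meshes: the constant does not depend on the mesh.
  The family is indexed by the mesh sizes \<open>h \<in> H\<close>.
\<close>

definition shape_regular_mesh_family ::
    "'a::euclidean_space set \<Rightarrow> real set \<Rightarrow> (real \<Rightarrow> 'a set set) \<Rightarrow> bool" where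
  "shape_regular_mesh_family \<Omega> H \<T> \<longleftrightarrow>
     (\<forall>h\<in>H. conforming_mesh \<Omega> (\<T> h) \<and> h = Max (diameter ` \<T> h)) \<and>
     (\<exists>C. \<forall>h\<in>H. \<forall>T\<in>\<T> h. diameter T \<le> C * inradius T)"


section \<open>Discrete spaces\<close>

definition barycentric :: "'a::euclidean_space set \<Rightarrow> 'a \<Rightarrow> 'a \<Rightarrow> real" where
  "barycentric T x =
     (THE l. (\<forall>p. \<not> p extreme_point_of T \<longrightarrow> l p = 0) \<and>
             (\<Sum>p | p extreme_point_of T. l p) = 1 \<and>
             (\<Sum>p | p extreme_point_of T. l p *\<^sub>R p) = x)"

definition bubble :: "'a::euclidean_space set \<Rightarrow> 'a \<Rightarrow> real" where
  "bubble T x = (if x \<in> T then \<Prod>p | p extreme_point_of T. barycentric T x p else 0)"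

definition Vh0 :: "'a::euclidean_space set \<Rightarrow> 'a set set \<Rightarrow> ('a \<Rightarrow> real) set" where
  "Vh0 \<Omega> \<T> = {v \<in> H10 \<Omega>. \<forall>T\<in>\<T>. \<exists>a b. AE x in lebesgue_on T. v x = a + b \<bullet> x}"

definition Vb :: "'a::euclidean_space set \<Rightarrow> 'a set set \<Rightarrow> ('a \<Rightarrow> real) set" where
  "Vb \<Omega> \<T> = {v. \<exists>c. AE x in lebesgue_on \<Omega>. v x = (\<Sum>T\<in>\<T>. c T * bubble T x)}"

definition Vhb0 :: "'a::euclidean_space set \<Rightarrow> 'a set set \<Rightarrow> ('a \<Rightarrow> real) set" where
  "Vhb0 \<Omega> \<T> = {\<lambda>x. v x + b x | v b. v \<in> Vh0 \<Omega> \<T> \<and> b \<in> Vb \<Omega> \<T>}"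

text \<open>The decomposition is unique up to null sets, since the sum is direct.\<close>

definition kappa ::
    "'a::euclidean_space set \<Rightarrow> 'a set set \<Rightarrow> ('a \<Rightarrow> real) \<Rightarrow> 'a \<Rightarrow> real" where
  "kappa \<Omega> \<T> w = (SOME v. v \<in> Vh0 \<Omega> \<T> \<and> (\<exists>b\<in>Vb \<Omega> \<T>. w = (\<lambda>x. v x + b x)))"


section \<open>The Dynamic Diffusion problem\<close>

definition B_form ::
    "'a::euclidean_space set \<Rightarrow> real \<Rightarrow> ('a \<Rightarrow> 'a) \<Rightarrow> real \<Rightarrow> ('a \<Rightarrow> real) \<Rightarrow> ('a \<Rightarrow> real) \<Rightarrow> real" where
  "B_form \<Omega> \<epsilon> \<beta> \<sigma> w v =
     \<epsilon> * l2_inner \<Omega> (wgrad \<Omega> w) (wgrad \<Omega> v)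
     + l2_inner \<Omega> (\<lambda>x. \<beta> x \<bullet> wgrad \<Omega> w x) v + \<sigma> * l2_inner \<Omega> w v"

definition peclet :: "real \<Rightarrow> ('a::euclidean_space \<Rightarrow> 'a) \<Rightarrow> 'a set \<Rightarrow> real" where
  "peclet \<epsilon> \<beta> T = linf_norm T \<beta> * diameter T / (2 * \<epsilon>)"

definition chi :: "real \<Rightarrow> ('a::euclidean_space \<Rightarrow> 'a) \<Rightarrow> 'a set \<Rightarrow> real" where
  "chi \<epsilon> \<beta> T = (if peclet \<epsilon> \<beta> T > 1 then 1 else 0)"

text \<open>The residual and the artificial diffusion are those for vanishing reaction coefficient.\<close>

definition residual ::
    "'a::euclidean_space set \<Rightarrow> ('a \<Rightarrow> 'a) \<Rightarrow> ('a \<Rightarrow> real) \<Rightarrow> ('a \<Rightarrow> real) \<Rightarrow> 'a \<Rightarrow> real" where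
  "residual \<Omega> \<beta> f v x = \<beta> x \<bullet> wgrad \<Omega> v x - f x"

definition xi ::
    "'a::euclidean_space set \<Rightarrow> real \<Rightarrow> ('a \<Rightarrow> 'a) \<Rightarrow> ('a \<Rightarrow> real) \<Rightarrow> (real \<Rightarrow> real) \<Rightarrow> real
     \<Rightarrow> 'a set \<Rightarrow> ('a \<Rightarrow> real) \<Rightarrow> real" where
  "xi \<Omega> \<epsilon> \<beta> f \<mu> \<tau> T v =
     chi \<epsilon> \<beta> T * \<mu> (diameter T) * (l2_norm T (residual \<Omega> \<beta> f v) / (l2_norm T (wgrad \<Omega> v) + \<tau>))"

definition D_form ::
    "'a::euclidean_space set \<Rightarrow> 'a set set \<Rightarrow> real \<Rightarrow> ('a \<Rightarrow> 'a) \<Rightarrow> ('a \<Rightarrow> real) \<Rightarrow> (real \<Rightarrow> real) \<Rightarrow> real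
     \<Rightarrow> ('a \<Rightarrow> real) \<Rightarrow> ('a \<Rightarrow> real) \<Rightarrow> ('a \<Rightarrow> real) \<Rightarrow> real" where
  "D_form \<Omega> \<T> \<epsilon> \<beta> f \<mu> \<tau> z u v =
     (\<Sum>T\<in>\<T>. xi \<Omega> \<epsilon> \<beta> f \<mu> \<tau> T (kappa \<Omega> \<T> z) * l2_inner T (wgrad \<Omega> u) (wgrad \<Omega> v))"

definition DD_solution ::
    "'a::euclidean_space set \<Rightarrow> 'a set set \<Rightarrow> real \<Rightarrow> ('a \<Rightarrow> 'a) \<Rightarrow> real \<Rightarrow> ('a \<Rightarrow> real)
     \<Rightarrow> (real \<Rightarrow> real) \<Rightarrow> real \<Rightarrow> ('a \<Rightarrow> real) \<Rightarrow> bool" where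
  "DD_solution \<Omega> \<T> \<epsilon> \<beta> \<sigma> f \<mu> \<tau> w \<longleftrightarrow>
     w \<in> Vhb0 \<Omega> \<T> \<and>
     (\<forall>z\<in>Vhb0 \<Omega> \<T>. B_form \<Omega> \<epsilon> \<beta> \<sigma> w z + D_form \<Omega> \<T> \<epsilon> \<beta> f \<mu> \<tau> w w z = l2_inner \<Omega> f z)"

definition q_T :: "('a::euclidean_space \<Rightarrow> 'a) \<Rightarrow> ('a \<Rightarrow> real) \<Rightarrow> real \<Rightarrow> 'a set \<Rightarrow> real" where
  "q_T \<beta> f \<tau> T = linf_norm T \<beta> + inverse \<tau> * l2_norm T f"

definition L_T0 ::
    "real \<Rightarrow> ('a::euclidean_space \<Rightarrow> 'a) \<Rightarrow> ('a \<Rightarrow> real) \<Rightarrow> (real \<Rightarrow> real) \<Rightarrow> real \<Rightarrow> 'a set \<Rightarrow> real" where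
  "L_T0 \<epsilon> \<beta> f \<mu> \<tau> T =
     chi \<epsilon> \<beta> T * (\<mu> (diameter T) / \<tau>) * (linf_norm T \<beta> + q_T \<beta> f \<tau> T)"

definition L_h0 ::
    "'a::euclidean_space set set \<Rightarrow> real \<Rightarrow> ('a \<Rightarrow> 'a) \<Rightarrow> ('a \<Rightarrow> real) \<Rightarrow> (real \<Rightarrow> real) \<Rightarrow> real \<Rightarrow> real" where
  "L_h0 \<T> \<epsilon> \<beta> f \<mu> \<tau> = Max (L_T0 \<epsilon> \<beta> f \<mu> \<tau> ` \<T>)"

end

theory Submission
  imports Defs "HOL-Real_Asymp.Real_Asymp"
begin

text \<open>
  Uniqueness is an energy argument. Let \<open>e = u - v\<close> be the difference of two solutions. Subtracting
  the two equations and testing with \<open>e\<close>, the bilinear form contributes exactly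
  \<open>\<epsilon> |e|\<^sub>1\<^sup>2\<close>, because the convective term \<open>(\<beta> \<bullet> grad e, e)\<close> vanishes for a
  divergence-free \<open>\<beta>\<close> and \<open>e\<close> in \<^const>\<open>H10\<close> (\<open>convection_eq_0\<close>). Writing
  \<open>\<xi>\<^sub>u grad u - \<xi>\<^sub>v grad v = \<xi>\<^sub>u grad e + (\<xi>\<^sub>u - \<xi>\<^sub>v) grad v\<close>, the first part of the
  artificial diffusion has a favourable sign. The second is small because \<open>\<xi>\<^sub>T\<close> is Lipschitz continuous
  with constant \<^const>\<open>L_T0\<close> in the gradient of the piecewise affine part (\<open>xi_Lipschitz\<close>), and on
  each element the gradient of that part is dominated by the full gradient
  (\<open>l2_norm_wgrad_Vh0_le\<close>). Summation over the elements gives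
  \<open>\<epsilon> |e|\<^sub>1\<^sup>2 \<le> L |v|\<^sub>1 |e|\<^sub>1\<^sup>2\<close> (\<open>error_estimate\<close>), testing the equation for \<open>v\<close> with
  \<open>v\<close> itself gives \<open>\<epsilon> |v|\<^sub>1 \<le> C\<^sub>P \<parallel>f\<parallel>\<close> (\<open>stability\<close>), and the smallness assumption
  forces \<open>|e|\<^sub>1 = 0\<close>.

  The functional analysis behind this is developed from integration by parts for compactly supported
  smooth functions (\<open>integral_grad_eq_0\<close>). The fundamental lemma of the calculus of variations
  (\<open>fundamental_lemma\<close>) makes weak gradients unique, hence linear and local; elements of
  \<^const>\<open>H10\<close> are handled through their approximating test functions
  (\<open>H10_approx\<close>, \<open>H10I\<close>).

  Two geometric facts connect the discrete spaces to this theory. Bubbles lie in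
  \<^const>\<open>H10\<close> (\<open>bubble_H10\<close>): they are products of positive parts of affine functions, and
  smooth substitutes for the positive part give test functions that converge boundedly together with
  their gradients. The interior of every element lies in the domain
  (\<open>mesh_element_interior\<close>), because a Lipschitz domain is the interior of its closure.
  The gradient of a bubble therefore has mean value zero on its element, which makes it orthogonal
  to the constant gradient of the affine part.
\<close>

section \<open>Smooth functions\<close>

lemma frechet_derivative_eq:
  "(f has_derivative f') (at x) \<Longrightarrow> frechet_derivative f (at x) = f'"
  using frechet_derivative_at by metis

lemma Ck_lower: "Ck (Suc k) f \<Longrightarrow> Ck k f"
proof (induction k arbitrary: f)
  case 0
  then show ?case
    by (auto intro!: continuous_at_imp_continuous_on differentiable_imp_continuous_within)
next
  case (Suc k)
  then show ?case by (metis Ck.simps(2))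
qed

lemma Ck_SucI:
  assumes "\<And>x. (f has_derivative f' x) (at x)" "\<And>i. i \<in> Basis \<Longrightarrow> Ck k (\<lambda>x. f' x i)"
  shows "Ck (Suc k) f"
proof -
  have "frechet_derivative f (at x) = f' x" for x
    using assms(1) frechet_derivative_eq by blast
  with assms show ?thesis by (auto simp: differentiable_def)
qed

lemma Ck_SucD:
  assumes "Ck (Suc k) f"
  shows "(f has_derivative frechet_derivative f (at x)) (at x)"
    and "i \<in> Basis \<Longrightarrow> Ck k (\<lambda>x. frechet_derivative f (at x) i)"
  using assms by (auto simp: frechet_derivative_works[symmetric])

lemma Ck_const: "Ck k (\<lambda>x. c)"
proof (induction k arbitrary: c)
  case (Suc k)
  then show ?case by (intro Ck_SucI[where f' = "\<lambda>x h. 0"]) auto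
qed auto

lemma Ck_add: "Ck k f \<Longrightarrow> Ck k g \<Longrightarrow> Ck k (\<lambda>x. f x + g x)"
proof (induction k arbitrary: f g)
  case 0
  then show ?case by (auto intro!: continuous_intros)
next
  case (Suc k)
  show ?case
    by (rule Ck_SucI[OF has_derivative_add[OF Ck_SucD(1)[OF Suc.prems(1)] Ck_SucD(1)[OF Suc.prems(2)]]])
      (intro Suc.IH Ck_SucD Suc.prems)
qed

lemma Ck_mult: "Ck k f \<Longrightarrow> Ck k g \<Longrightarrow> Ck k (\<lambda>x. f x * g x)"
proof (induction k arbitrary: f g)
  case 0
  then show ?case by (auto intro!: continuous_intros)
next
  case (Suc k)
  show ?case
    by (rule Ck_SucI[OF has_derivative_mult[OF Ck_SucD(1)[OF Suc.prems(1)] Ck_SucD(1)[OF Suc.prems(2)]]])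
      (intro Ck_add Suc.IH Ck_SucD Suc.prems Ck_lower[OF Suc.prems(1)] Ck_lower[OF Suc.prems(2)])
qed

lemma Ck_affine: "Ck k (\<lambda>x. a + b \<bullet> x)"
proof (cases k)
  case 0
  then show ?thesis by (auto intro!: continuous_intros)
next
  case (Suc k)
  show ?thesis unfolding Suc
    by (rule Ck_SucI[where f' = "\<lambda>x h. b \<bullet> h"]) (auto intro!: derivative_eq_intros Ck_const)
qed

lemma Ck_prod: "finite I \<Longrightarrow> (\<And>i. i \<in> I \<Longrightarrow> Ck k (f i)) \<Longrightarrow> Ck k (\<lambda>x. \<Prod>i\<in>I. f i x)"
  by (induction I rule: finite_induct) (auto intro: Ck_const Ck_mult)

text \<open>
  The functions vanishing on the left half-line and equal to \<open>exp (- 1 / t) / t ^ m\<close> on the right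
  one: differentiation stays within their linear span, so all of them are smooth.
\<close>

definition flat :: "nat \<Rightarrow> real \<Rightarrow> real" where
  "flat m t = (if t > 0 then exp (- inverse t) * inverse t ^ m else 0)"

lemma flat_nonpos [simp]: "t \<le> 0 \<Longrightarrow> flat m t = 0"
  by (simp add: flat_def)

lemma flat_nonneg: "flat m t \<ge> 0"
  by (simp add: flat_def)

lemma flat_0_le_1: "flat 0 t \<le> 1"
  by (simp add: flat_def)

lemma flat_tendsto_0: "(flat m \<longlongrightarrow> 0) (at 0)"
proof -
  have "((\<lambda>t. inverse t ^ m / exp (inverse t)) \<longlongrightarrow> 0) (at_right (0::real))"
    by (rule filterlim_compose[OF tendsto_power_div_exp_0 filterlim_inverse_at_top_right])
  moreover have "\<forall>\<^sub>F t in at_right 0. inverse t ^ m / exp (inverse t) = flat m t"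
    by (auto simp: eventually_at_right_less flat_def exp_minus field_simps
        intro: eventually_mono[OF eventually_at_right_less])
  ultimately have "(flat m \<longlongrightarrow> 0) (at_right 0)"
    by (rule Lim_transform_eventually)
  moreover have "(flat m \<longlongrightarrow> 0) (at_left 0)"
    by (rule tendsto_eventually) (auto intro: eventually_mono[OF eventually_at_left_real[of "-1" 0]])
  ultimately show ?thesis by (simp add: filterlim_at_split)
qed

lemma flat_deriv:
  "(flat m has_field_derivative (flat (m + 2) t - real m * flat (m + 1) t)) (at t)"
proof -
  consider "t > 0" | "t < 0" | "t = 0" by linarith
  then show ?thesis
  proof cases
    case 1
    have "((\<lambda>t. exp (- inverse t) * inverse t ^ m) has_field_derivative
             (flat (m + 2) t - real m * flat (m + 1) t)) (at t)"
    proof (rule DERIV_cong)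
      show "((\<lambda>t. exp (- inverse t) * inverse t ^ m) has_field_derivative
          exp (- inverse t) * (real m * (- (inverse t ^ 2) * inverse t ^ (m - Suc 0))) +
          exp (- inverse t) * inverse t ^ 2 * inverse t ^ m) (at t)"
        using 1
        by (intro DERIV_mult' DERIV_power DERIV_chain2[where f = exp] DERIV_exp)
          (auto intro!: derivative_eq_intros simp: power2_eq_square)
    qed (use 1 in \<open>cases m; auto simp: flat_def algebra_simps power_add power2_eq_square\<close>)
    moreover have "\<forall>\<^sub>F s in nhds t. flat m s = exp (- inverse s) * inverse s ^ m"
      using eventually_nhds_in_open[of "{0<..}" t] 1
      by (auto simp: flat_def elim: eventually_mono)
    ultimately show ?thesis by (subst DERIV_cong_ev) auto
  next
    case 2
    have "((\<lambda>t. 0) has_field_derivative (flat (m + 2) t - real m * flat (m + 1) t)) (at t)"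
      using 2 by simp
    moreover have "\<forall>\<^sub>F s in nhds t. flat m s = 0"
      using eventually_nhds_in_open[of "{..<0}" t] 2 by (auto elim: eventually_mono)
    ultimately show ?thesis by (subst DERIV_cong_ev) auto
  next
    case 3
    have "flat m h / h = flat (m + 1) h" for h
      by (simp add: flat_def divide_inverse)
    then show ?thesis
      using flat_tendsto_0[of "m + 1"] 3 by (simp add: DERIV_def)
  qed
qed

lemma Ck_flat_affine: "Ck k (\<lambda>x. flat m (a + b \<bullet> x))"
proof (induction k arbitrary: m)
  case 0
  have "continuous_on UNIV (flat m)"
    by (intro continuous_at_imp_continuous_on ballI DERIV_isCont[OF flat_deriv])
  then show ?case
    by (auto intro!: continuous_on_compose2[of UNIV "flat m"] continuous_intros)
next
  case (Suc k)
  have "((\<lambda>x. flat m (a + b \<bullet> x)) has_derivative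
      (\<lambda>h. (flat (m + 2) (a + b \<bullet> x) + (- real m) * flat (m + 1) (a + b \<bullet> x)) * (b \<bullet> h))) (at x)" for x
    by (rule has_derivative_compose[OF _ flat_deriv[unfolded has_field_derivative_def],
          THEN has_derivative_eq_rhs])
      (auto intro!: derivative_eq_intros)
  then show ?case
    by (rule Ck_SucI) (intro Ck_mult Ck_add Ck_const Suc.IH)
qed

section \<open>Test functions\<close>

lemma test_functions_iff:
  "\<phi> \<in> test_functions \<Omega> \<longleftrightarrow>
     (\<forall>k. Ck k \<phi>) \<and> (\<exists>K. compact K \<and> K \<subseteq> \<Omega> \<and> (\<forall>x. x \<notin> K \<longrightarrow> \<phi> x = 0))"
proof safe
  assume "\<phi> \<in> test_functions \<Omega>"
  then show "Ck k \<phi>" "\<exists>K. compact K \<and> K \<subseteq> \<Omega> \<and> (\<forall>x. x \<notin> K \<longrightarrow> \<phi> x = 0)" for k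
    using closure_subset[of "{x. \<phi> x \<noteq> 0}"]
    by (auto simp: test_functions_def simp del: compact_closure
        intro!: exI[of _ "closure {x. \<phi> x \<noteq> 0}"])
next
  fix K assume *: "\<forall>k. Ck k \<phi>" "compact K" "K \<subseteq> \<Omega>" "\<forall>x. x \<notin> K \<longrightarrow> \<phi> x = 0"
  have "closure {x. \<phi> x \<noteq> 0} \<subseteq> K"
    using * by (intro closure_minimal) (auto simp: compact_imp_closed)
  then show "\<phi> \<in> test_functions \<Omega>"
    using * compact_Int_closed[of K "closure {x. \<phi> x \<noteq> 0}"]
    by (auto simp: test_functions_def Int_absorb1)
qed

lemma test_function_lincomb:
  assumes "\<phi> \<in> test_functions \<Omega>" "\<psi> \<in> test_functions \<Omega>"
  shows "(\<lambda>x. \<phi> x + c * \<psi> x) \<in> test_functions \<Omega>"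
proof -
  obtain K L where "compact K" "K \<subseteq> \<Omega>" "\<forall>x. x \<notin> K \<longrightarrow> \<phi> x = 0"
      "compact L" "L \<subseteq> \<Omega>" "\<forall>x. x \<notin> L \<longrightarrow> \<psi> x = 0"
    using assms unfolding test_functions_iff by metis
  then show ?thesis
    using assms unfolding test_functions_iff
    by (auto intro!: Ck_add Ck_mult Ck_const exI[of _ "K \<union> L"])
qed

lemma test_function_mult:
  assumes "\<phi> \<in> test_functions \<Omega>" "\<forall>k. Ck k g"
  shows "(\<lambda>x. g x * \<phi> x) \<in> test_functions \<Omega>"
proof -
  obtain K where K: "compact K" "K \<subseteq> \<Omega>" "\<forall>x. x \<notin> K \<longrightarrow> \<phi> x = 0"
    using assms unfolding test_functions_iff by metis
  with assms show ?thesis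
    unfolding test_functions_iff by (intro conjI allI Ck_mult exI[of _ K]) auto
qed

lemma test_functions_mono: "\<phi> \<in> test_functions U \<Longrightarrow> U \<subseteq> \<Omega> \<Longrightarrow> \<phi> \<in> test_functions \<Omega>"
  by (auto simp: test_functions_def)

definition grad :: "('a::euclidean_space \<Rightarrow> real) \<Rightarrow> 'a \<Rightarrow> 'a" where
  "grad \<phi> x = (\<Sum>i\<in>Basis. frechet_derivative \<phi> (at x) i *\<^sub>R i)"

lemma grad_inner_Basis: "i \<in> Basis \<Longrightarrow> grad \<phi> x \<bullet> i = frechet_derivative \<phi> (at x) i"
  by (simp add: grad_def)

lemma grad_eqI:
  assumes "(\<phi> has_derivative (\<lambda>h. g \<bullet> h)) (at x)"
  shows "grad \<phi> x = g"
  by (simp add: grad_def frechet_derivative_eq[OF assms] euclidean_representation)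

lemma has_derivative_grad:
  assumes "\<forall>k. Ck k \<phi>"
  shows "(\<phi> has_derivative (\<lambda>h. grad \<phi> x \<bullet> h)) (at x)"
proof -
  have d: "(\<phi> has_derivative frechet_derivative \<phi> (at x)) (at x)"
    using Ck_SucD(1) assms by blast
  then interpret bounded_linear "frechet_derivative \<phi> (at x)"
    by (rule has_derivative_bounded_linear)
  have "frechet_derivative \<phi> (at x) h = grad \<phi> x \<bullet> h" for h
  proof -
    have "frechet_derivative \<phi> (at x) h = frechet_derivative \<phi> (at x) (\<Sum>i\<in>Basis. (h \<bullet> i) *\<^sub>R i)"
      by (simp add: euclidean_representation)
    also have "\<dots> = grad \<phi> x \<bullet> h"
      by (simp add: sum scaleR grad_def inner_sum_left inner_commute[of h] mult.commute)
    finally show ?thesis .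
  qed
  then have "frechet_derivative \<phi> (at x) = (\<lambda>h. grad \<phi> x \<bullet> h)" by auto
  then show ?thesis using d by simp
qed

lemma continuous_grad:
  assumes "\<forall>k. Ck k \<phi>"
  shows "continuous_on UNIV (grad \<phi>)"
  unfolding grad_def
proof (intro continuous_on_sum continuous_on_scaleR continuous_on_const)
  fix i :: 'a assume "i \<in> Basis"
  then show "continuous_on UNIV (\<lambda>x. frechet_derivative \<phi> (at x) i)"
    using Ck_SucD(2)[of 0 \<phi> i] assms by auto
qed

lemma continuous_test_function: "\<forall>k. Ck k \<phi> \<Longrightarrow> continuous_on UNIV \<phi>"
  by (metis Ck.simps(1))

lemma grad_zero_outside:
  assumes "closed K" "\<And>x. x \<notin> K \<Longrightarrow> \<phi> x = 0" "x \<notin> K"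
  shows "grad \<phi> x = 0"
proof (rule grad_eqI)
  have "((\<lambda>x. 0) has_derivative (\<lambda>h. 0 \<bullet> h)) (at x)" by simp
  then show "(\<phi> has_derivative (\<lambda>h. 0 \<bullet> h)) (at x)"
    using assms by (elim has_derivative_transform_within_open[of _ _ _ _ "- K"]) auto
qed

lemma grad_lincomb:
  assumes "\<forall>k. Ck k \<phi>" "\<forall>k. Ck k \<psi>"
  shows "grad (\<lambda>x. \<phi> x + c * \<psi> x) x = grad \<phi> x + c *\<^sub>R grad \<psi> x"
  by (rule grad_eqI)
    (auto intro!: derivative_eq_intros has_derivative_grad assms simp: inner_add_left)

lemma grad_mult:
  assumes "\<forall>k. Ck k \<phi>" "\<forall>k. Ck k \<psi>"
  shows "grad (\<lambda>x. \<phi> x * \<psi> x) x = \<phi> x *\<^sub>R grad \<psi> x + \<psi> x *\<^sub>R grad \<phi> x"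
  by (rule grad_eqI)
    (auto intro!: derivative_eq_intros has_derivative_grad assms simp: inner_add_left algebra_simps)

text \<open>
  The difference quotients of a function have integral zero because the Lebesgue measure is
  translation invariant; for compactly supported functions they converge dominatedly.
\<close>

lemma integral_grad_eq_0:
  fixes g :: "'a::euclidean_space \<Rightarrow> real"
  assumes g: "\<forall>k. Ck k g" and K: "compact K" "\<And>x. x \<notin> K \<Longrightarrow> g x = 0" and i: "i \<in> Basis"
  shows "(\<integral>x. grad g x \<bullet> i \<partial>lborel) = 0"
proof -
  define D where "D x = grad g x \<bullet> i" for x
  have contD: "continuous_on UNIV D"
    unfolding D_def by (intro continuous_intros continuous_on_compose2[OF continuous_grad[OF g]]) auto
  have D0: "D x = 0" if "x \<notin> K" for x
    using grad_zero_outside[of K g x] K that by (auto simp: D_def compact_imp_closed)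
  obtain M where M: "\<And>x. \<bar>D x\<bar> \<le> M" "M \<ge> 0"
  proof -
    have "compact (D ` K)"
      using K contD by (intro compact_continuous_image) (auto intro: continuous_on_subset)
    then obtain M where "\<And>y. y \<in> D ` K \<Longrightarrow> norm y \<le> M" "M > 0"
      using compact_imp_bounded bounded_pos by metis
    then have "\<bar>D x\<bar> \<le> M" for x
      using D0 by (cases "x \<in> K") auto
    then show thesis using that \<open>M > 0\<close> by force
  qed
  obtain R where R: "\<And>x. x \<in> K \<Longrightarrow> norm x \<le> R"
    using K compact_imp_bounded bounded_iff by metis
  define t :: "nat \<Rightarrow> real" where "t n = inverse (real (Suc n))" for n
  have t: "t n > 0" "t n \<le> 1" for n
    by (auto simp: t_def inverse_le_1_iff)
  define s where "s n x = (g (x + t n *\<^sub>R i) - g x) / t n" for n x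
  have dg: "((\<lambda>r. g (x + r *\<^sub>R i)) has_real_derivative D (x + r *\<^sub>R i)) (at r)" for x r
  proof -
    have "((\<lambda>r. g (x + r *\<^sub>R i)) has_derivative (\<lambda>h. grad g (x + r *\<^sub>R i) \<bullet> (h *\<^sub>R i))) (at r)"
      by (rule has_derivative_compose[OF _ has_derivative_grad[OF g]])
         (auto intro!: derivative_eq_intros)
    then show ?thesis
      by (simp add: has_field_derivative_def D_def mult_commute_abs)
  qed
  have contg: "continuous_on UNIV g" using continuous_test_function[OF g] .
  have mg: "g \<in> borel_measurable borel"
    using contg by (rule borel_measurable_continuous_onI)
  have ig: "integrable lborel g"
  proof -
    have "integrable lborel (\<lambda>x. indicator K x *\<^sub>R g x)"
      using K contg by (intro borel_integrable_compact) (auto intro: continuous_on_subset)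
    moreover have "(\<lambda>x. indicator K x *\<^sub>R g x) = g" using K by (fastforce simp: indicator_def)
    ultimately show ?thesis by simp
  qed
  have s0: "(\<integral>x. s n x \<partial>lborel) = 0" for n
  proof -
    have ig': "integrable lborel (\<lambda>x. g (t n *\<^sub>R i + x))"
      using ig mg
      by (subst (asm) lborel_distr_plus[of "t n *\<^sub>R i", symmetric], subst (asm) integrable_distr_eq) auto
    have "(\<integral>x. g (t n *\<^sub>R i + x) \<partial>lborel) = (\<integral>x. g x \<partial>lborel)"
      using mg by (subst (2) lborel_distr_plus[of "t n *\<^sub>R i", symmetric], subst integral_distr) auto
    then show ?thesis using ig ig' by (simp add: s_def add.commute[of _ "t n *\<^sub>R i"])
  qed
  have "(\<lambda>n. \<integral>x. s n x \<partial>lborel) \<longlonglongrightarrow> (\<integral>x. D x \<partial>lborel)"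
  proof (rule integral_dominated_convergence[where w = "\<lambda>x. M * indicator (cball 0 (R + 1)) x"])
    show "AE x in lborel. (\<lambda>n. s n x) \<longlonglongrightarrow> D x"
    proof (rule AE_I2)
      fix x
      have "((\<lambda>r. (g (x + r *\<^sub>R i) - g x) / r) \<longlongrightarrow> D x) (at 0)"
        using dg[of x 0] by (simp add: DERIV_def)
      moreover have "filterlim t (at 0) sequentially"
        using LIMSEQ_inverse_real_of_nat unfolding t_def[abs_def] by (simp add: filterlim_at)
      ultimately show "(\<lambda>n. s n x) \<longlonglongrightarrow> D x"
        unfolding s_def by (rule filterlim_compose)
    qed
    show "AE x in lborel. norm (s n x) \<le> M * indicator (cball 0 (R + 1)) x" for n
    proof (rule AE_I2)
      fix x
      obtain z where z: "z > 0" "z < t n" "g (x + t n *\<^sub>R i) - g (x + 0 *\<^sub>R i) = (t n - 0) * D (x + z *\<^sub>R i)"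
        using MVT2[of 0 "t n" "\<lambda>r. g (x + r *\<^sub>R i)" "\<lambda>r. D (x + r *\<^sub>R i)"] dg t(1)[of n] by blast
      then have s: "s n x = D (x + z *\<^sub>R i)" using t(1)[of n] by (simp add: s_def)
      show "norm (s n x) \<le> M * indicator (cball 0 (R + 1)) x"
      proof (cases "x + z *\<^sub>R i \<in> K")
        case True
        have "norm (z *\<^sub>R i) \<le> 1" using z t(2)[of n] i by simp
        then have "norm x \<le> R + 1"
          using R[OF True] norm_triangle_ineq4[of "x + z *\<^sub>R i" "z *\<^sub>R i"] by simp
        then show ?thesis using M s by simp
      next
        case False
        then show ?thesis using s D0 M by simp
      qed
    qed
    show "D \<in> borel_measurable lborel"
      using borel_measurable_continuous_onI[OF contD] by simp
    show "s n \<in> borel_measurable lborel" for n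
      unfolding s_def using mg by measurable
    show "integrable lborel (\<lambda>x. M * indicator (cball 0 (R + 1)) x)"
      by (intro integrable_mult_right integrable_real_indicator) (auto intro!: emeasure_bounded_finite[unfolded infinity_ennreal_def])
  qed
  then have "(\<lambda>n. 0) \<longlonglongrightarrow> (\<integral>x. D x \<partial>lborel)" by (simp only: s0)
  then show ?thesis using LIMSEQ_unique[OF _ tendsto_const] by (simp add: D_def)
qed

section \<open>The fundamental lemma of the calculus of variations\<close>

lemma borel_measurable_lebesgueI: "f \<in> borel_measurable borel \<Longrightarrow> f \<in> borel_measurable lebesgue"
  by (rule measurable_completion) simp

lemma integral_lebesgue_on:
  fixes f :: "'a::euclidean_space \<Rightarrow> 'b::euclidean_space"
  assumes "S \<in> sets lebesgue"
  shows "integral\<^sup>L (lebesgue_on S) f = (\<integral>x. indicator S x *\<^sub>R f x \<partial>lebesgue)"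
  using assms by (intro integral_restrict_space) simp

lemma integrable_lebesgue_on:
  fixes f :: "'a::euclidean_space \<Rightarrow> 'b::euclidean_space"
  assumes "S \<in> sets lebesgue"
  shows "integrable (lebesgue_on S) f \<longleftrightarrow> integrable lebesgue (\<lambda>x. indicator S x *\<^sub>R f x)"
  using assms by (intro integrable_restrict_space) simp

lemma integral_lebesgue_on_eq_lborel:
  fixes g :: "'a::euclidean_space \<Rightarrow> real"
  assumes "g \<in> borel_measurable borel" "\<Omega> \<in> sets lebesgue" "\<And>x. x \<notin> \<Omega> \<Longrightarrow> g x = 0"
  shows "(\<integral>x. g x \<partial>lebesgue_on \<Omega>) = (\<integral>x. g x \<partial>lborel)"
proof -
  have "indicator \<Omega> x *\<^sub>R g x = g x" for x
    using assms(3)[of x] by (cases "x \<in> \<Omega>") auto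
  then have "(\<integral>x. g x \<partial>lebesgue_on \<Omega>) = (\<integral>x. g x \<partial>lebesgue)"
    using assms(2) by (simp only: integral_lebesgue_on)
  then show ?thesis
    using assms(1) by (simp add: integral_completion)
qed

lemma integral_grad_test_function:
  assumes "\<phi> \<in> test_functions \<Omega>" "\<Omega> \<in> sets lebesgue" "i \<in> Basis"
  shows "(\<integral>x. grad \<phi> x \<bullet> i \<partial>lebesgue_on \<Omega>) = 0"
proof -
  obtain K where K: "compact K" "K \<subseteq> \<Omega>" "\<And>x. x \<notin> K \<Longrightarrow> \<phi> x = 0" and s: "\<forall>k. Ck k \<phi>"
    using assms(1) by (auto simp: test_functions_iff)
  have "(\<integral>x. grad \<phi> x \<bullet> i \<partial>lebesgue_on \<Omega>) = (\<integral>x. grad \<phi> x \<bullet> i \<partial>lborel)"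
  proof (rule integral_lebesgue_on_eq_lborel[OF _ assms(2)])
    show "(\<lambda>x. grad \<phi> x \<bullet> i) \<in> borel_measurable borel"
      using borel_measurable_continuous_onI[OF continuous_grad[OF s]] by measurable
    show "grad \<phi> x \<bullet> i = 0" if "x \<notin> \<Omega>" for x
      using grad_zero_outside[of K \<phi> x, OF compact_imp_closed[OF K(1)] K(3)] K(2) that
      by (metis inner_zero_left subsetD)
  qed
  then show ?thesis using integral_grad_eq_0[OF s K(1,3) assms(3)] by simp
qed

lemma integrable_locally_times_compact:
  fixes f :: "'a::euclidean_space \<Rightarrow> 'b::euclidean_space"
  assumes f: "f locally_integrable_on \<Omega>" and \<Omega>: "\<Omega> \<in> sets lebesgue"
    and \<phi>: "continuous_on UNIV \<phi>" and K: "compact K" "K \<subseteq> \<Omega>" "\<And>x. x \<notin> K \<Longrightarrow> \<phi> x = 0"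
  shows "integrable (lebesgue_on \<Omega>) (\<lambda>x. (\<phi> x :: real) *\<^sub>R f x)"
proof -
  have fK: "integrable lebesgue (\<lambda>x. indicator K x *\<^sub>R f x)"
    using f K by (auto simp: locally_integrable_on_def set_integrable_def)
  have "compact (\<phi> ` K)"
    using K \<phi> by (intro compact_continuous_image) (auto intro: continuous_on_subset)
  then obtain M where M: "\<And>y. y \<in> \<phi> ` K \<Longrightarrow> norm y \<le> M"
    using compact_imp_bounded bounded_iff by metis
  have [measurable]: "\<phi> \<in> borel_measurable borel"
    using \<phi> by (rule borel_measurable_continuous_onI)
  have [measurable]: "\<phi> \<in> borel_measurable lebesgue"
    by (rule borel_measurable_lebesgueI) fact
  have "integrable lebesgue (\<lambda>x. \<phi> x *\<^sub>R (indicator K x *\<^sub>R f x))"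
  proof (rule Bochner_Integration.integrable_bound)
    show "integrable lebesgue (\<lambda>x. M *\<^sub>R (indicator K x *\<^sub>R f x))"
      using fK by (rule integrable_scaleR_right)
    show "(\<lambda>x. \<phi> x *\<^sub>R indicator K x *\<^sub>R f x) \<in> borel_measurable lebesgue"
      using borel_measurable_integrable[OF fK] by measurable
    show "AE x in lebesgue. norm (\<phi> x *\<^sub>R indicator K x *\<^sub>R f x) \<le> norm (M *\<^sub>R indicator K x *\<^sub>R f x)"
      using M by (intro AE_I2) (force simp: indicator_def intro!: mult_right_mono)
  qed
  moreover have "\<phi> x *\<^sub>R (indicator K x *\<^sub>R f x) = indicator \<Omega> x *\<^sub>R (\<phi> x *\<^sub>R f x)" for x
    using K(2,3) by (cases "x \<in> K") auto
  ultimately show ?thesis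
    using \<Omega> by (simp only: integrable_lebesgue_on)
qed

text \<open>
  Products of the functions \<open>flat 0\<close> in the distances to the faces of a box, sharpened by a
  factor \<open>n\<close>, are test functions with values in the unit interval that converge to the indicator
  function of the open box.
\<close>

lemma integral_box_eq_0:
  fixes g :: "'a::euclidean_space \<Rightarrow> real"
  assumes g: "g locally_integrable_on \<Omega>" and \<Omega>: "\<Omega> \<in> sets lebesgue"
    and orth: "\<And>\<phi>. \<phi> \<in> test_functions \<Omega> \<Longrightarrow> (\<integral>x. \<phi> x * g x \<partial>lebesgue_on \<Omega>) = 0"
    and ab: "cbox a b \<subseteq> \<Omega>"
  shows "(\<integral>x. indicator (box a b) x * g x \<partial>lebesgue) = 0"
proof -
  define \<phi> :: "nat \<Rightarrow> 'a \<Rightarrow> real" where "\<phi> n x = (\<Prod>i\<in>Basis.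
      flat 0 ((- real n * (a \<bullet> i) - 1) + (real n *\<^sub>R i) \<bullet> x) *
      flat 0 ((real n * (b \<bullet> i) - 1) + (- (real n *\<^sub>R i)) \<bullet> x))" for n x
  have \<phi>': "\<phi> n x = (\<Prod>i\<in>Basis.
      flat 0 (real n * (x \<bullet> i - a \<bullet> i) - 1) * flat 0 (real n * (b \<bullet> i - x \<bullet> i) - 1))" for n x
    unfolding \<phi>_def by (intro prod.cong refl arg_cong2[where f = "(*)"] arg_cong[where f = "flat 0"])
      (simp_all add: algebra_simps inner_commute)
  have smooth: "Ck k (\<phi> n)" for k n
    unfolding \<phi>_def by (intro Ck_prod Ck_mult Ck_flat_affine finite_Basis)
  have \<phi>0: "\<phi> n x = 0" if "x \<notin> box a b" for n x
  proof -
    have "\<exists>i\<in>Basis. x \<bullet> i \<le> a \<bullet> i \<or> b \<bullet> i \<le> x \<bullet> i"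
      using that by (auto simp: mem_box not_less)
    then obtain i where i: "i \<in> Basis" "x \<bullet> i \<le> a \<bullet> i \<or> b \<bullet> i \<le> x \<bullet> i" by blast
    have "real n * (x \<bullet> i - a \<bullet> i) - 1 \<le> 0 \<or> real n * (b \<bullet> i - x \<bullet> i) - 1 \<le> 0"
      using i(2) mult_nonneg_nonpos[of "real n"] by (auto simp: mult_nonneg_nonpos add_increasing2
          intro: order_trans[of _ 0])
    then show ?thesis unfolding \<phi>' using i(1) by (intro prod_zero bexI[of _ i]) auto
  qed
  have test: "\<phi> n \<in> test_functions \<Omega>" for n
    unfolding test_functions_iff using smooth ab subsetD[OF box_subset_cbox[of a b]]
    by (intro conjI allI exI[of _ "cbox a b"]) (auto intro: \<phi>0)
  have lim: "(\<lambda>n. \<phi> n x) \<longlonglongrightarrow> indicator (box a b) x" for x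
  proof (cases "x \<in> box a b")
    case True
    have 1: "(\<lambda>n. flat 0 (real n * c - 1)) \<longlonglongrightarrow> 1" if "c > 0" for c
    proof -
      have "filterlim (\<lambda>n. real n * c - 1) at_top sequentially"
        using that by real_asymp
      moreover have "(flat 0 \<longlongrightarrow> 1) at_top"
      proof (rule Lim_transform_eventually)
        show "((\<lambda>t::real. exp (- inverse t)) \<longlongrightarrow> 1) at_top" by real_asymp
        show "\<forall>\<^sub>F t in at_top. exp (- inverse t) = flat 0 t"
          using eventually_gt_at_top[of 0] by eventually_elim (simp add: flat_def)
      qed
      ultimately show ?thesis by (rule filterlim_compose[rotated])
    qed
    have "(\<lambda>n. \<phi> n x) \<longlonglongrightarrow> (\<Prod>i\<in>(Basis :: 'a set). 1 * 1)"
      unfolding \<phi>' by (intro tendsto_prod tendsto_mult 1) (use True in \<open>auto simp: mem_box\<close>)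
    then show ?thesis using True by simp
  qed (use \<phi>0 in simp)
  have bd: "\<bar>\<phi> n x\<bar> \<le> 1" for n x
    unfolding \<phi>' abs_prod
    by (intro prod_le_1 conjI) (auto simp: abs_mult flat_nonneg flat_0_le_1 intro!: mult_le_one)
  have gK: "integrable lebesgue (\<lambda>x. indicator (cbox a b) x *\<^sub>R g x)"
    using g ab compact_cbox by (auto simp: locally_integrable_on_def set_integrable_def)
  note [measurable] = borel_measurable_integrable[OF gK]
  have [measurable]: "\<phi> n \<in> borel_measurable borel" for n
    using smooth by (intro borel_measurable_continuous_onI continuous_test_function) auto
  have [measurable]: "\<phi> n \<in> borel_measurable lebesgue" for n
    by (rule borel_measurable_lebesgueI) fact
  let ?g = "\<lambda>x. indicator (cbox a b) x *\<^sub>R g x"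
  have "(\<lambda>n. \<integral>x. \<phi> n x * ?g x \<partial>lebesgue) \<longlonglongrightarrow> (\<integral>x. indicator (box a b) x * ?g x \<partial>lebesgue)"
  proof (rule integral_dominated_convergence)
    show "integrable lebesgue (\<lambda>x. norm (?g x))" using gK by (rule integrable_norm)
    show "AE x in lebesgue. (\<lambda>n. \<phi> n x * ?g x) \<longlonglongrightarrow> indicator (box a b) x * ?g x"
      by (intro AE_I2 tendsto_mult lim tendsto_const)
    show "AE x in lebesgue. norm (\<phi> n x * ?g x) \<le> norm (?g x)" for n
      using bd by (intro AE_I2) (simp add: abs_mult mult_left_le_one_le)
    show "(\<lambda>x. indicator (box a b) x * ?g x) \<in> borel_measurable lebesgue"
      by (intro borel_measurable_times borel_measurable_indicator borel_measurable_integrable[OF gK]) simp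
    show "(\<lambda>x. \<phi> n x * ?g x) \<in> borel_measurable lebesgue" for n
      by (intro borel_measurable_times borel_measurable_integrable[OF gK]) fact
  qed
  moreover have "(\<integral>x. \<phi> n x * ?g x \<partial>lebesgue) = 0" for n
  proof -
    have "\<phi> n x * ?g x = indicator \<Omega> x *\<^sub>R (\<phi> n x * g x)" for x
      using \<phi>0[of x n] ab box_subset_cbox[of a b] by (cases "x \<in> cbox a b") auto
    then have "(\<integral>x. \<phi> n x * ?g x \<partial>lebesgue) = (\<integral>x. \<phi> n x * g x \<partial>lebesgue_on \<Omega>)"
      using \<Omega> by (simp only: integral_lebesgue_on)
    then show ?thesis using orth[OF test] by simp
  qed
  ultimately have "(\<integral>x. indicator (box a b) x * ?g x \<partial>lebesgue) = 0"
    using LIMSEQ_unique[OF _ tendsto_const] by simp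
  moreover have "indicator (box a b) x * ?g x = indicator (box a b) x * g x" for x
    using box_subset_cbox[of a b] by (cases "x \<in> box a b") auto
  ultimately show ?thesis by (simp only:)
qed

text \<open>The positive and the negative part define the same measure on the boxes, hence everywhere.\<close>

lemma AE_zero_if_box_integrals_zero:
  fixes f :: "'a::euclidean_space \<Rightarrow> real"
  assumes f: "integrable lborel f" and 0: "\<And>a b. (\<integral>x. indicator (box a b) x * f x \<partial>lborel) = 0"
  shows "AE x in lborel. f x = 0"
proof -
  note [measurable] = borel_measurable_integrable[OF f]
  have fin: "(\<integral>\<^sup>+x. ennreal (f x) \<partial>lborel) \<noteq> \<infinity>" "(\<integral>\<^sup>+x. ennreal (- f x) \<partial>lborel) \<noteq> \<infinity>"
    using f by (auto simp: real_integrable_def)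
  have "density lborel (\<lambda>x. ennreal (f x)) = density lborel (\<lambda>x. ennreal (- f x))" (is "?M = ?N")
  proof (rule measure_eqI_generator_eq)
    let ?E = "range (\<lambda>(a, b). box a b::'a set)"
    show "Int_stable ?E"
      by (auto simp: Int_stable_def box_Int_box)
    show "?E \<subseteq> Pow UNIV" "sets ?M = sigma_sets UNIV ?E" "sets ?N = sigma_sets UNIV ?E"
      by (simp_all add: borel_eq_box)
    let ?A = "\<lambda>n::nat. box (- (real n *\<^sub>R One)) (real n *\<^sub>R One) :: 'a set"
    show "range ?A \<subseteq> ?E" "(\<Union>i. ?A i) = UNIV"
      unfolding UN_box_eq_UNIV by auto
    have le: "emeasure (density lborel (\<lambda>x. ennreal (h x))) X \<le> (\<integral>\<^sup>+x. ennreal (h x) \<partial>lborel)"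
      if "h \<in> borel_measurable borel" "X \<in> sets borel" for h :: "'a \<Rightarrow> real" and X
      using that by (auto simp: emeasure_density indicator_def intro!: nn_integral_mono)
    show "emeasure ?M (?A i) \<noteq> \<infinity>" for i
      using le[of f "?A i"] fin by (auto simp: top_unique)
    show "emeasure ?M X = emeasure ?N X" if XE: "X \<in> ?E" for X
    proof -
      obtain a b where X: "X = box a b" using XE by auto
      have i: "integrable lborel (\<lambda>x. indicator X x * f x)"
        using integrable_mult_indicator[OF _ f, of X] X by simp
      have *: "(\<integral>\<^sup>+x. ennreal (indicator X x * f x) \<partial>lborel) \<noteq> \<infinity>"
          "(\<integral>\<^sup>+x. ennreal (- (indicator X x * f x)) \<partial>lborel) \<noteq> \<infinity>"
        using i by (auto simp: real_integrable_def)
      have "enn2real (\<integral>\<^sup>+x. ennreal (indicator X x * f x) \<partial>lborel) =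
            enn2real (\<integral>\<^sup>+x. ennreal (- (indicator X x * f x)) \<partial>lborel)"
        using real_lebesgue_integral_def[OF i] 0[of a b] X by simp
      then have "(\<integral>\<^sup>+x. ennreal (indicator X x * f x) \<partial>lborel) =
            (\<integral>\<^sup>+x. ennreal (- (indicator X x * f x)) \<partial>lborel)"
        using * by (cases rule: ennreal2_cases[of "\<integral>\<^sup>+x. ennreal (indicator X x * f x) \<partial>lborel"
            "\<integral>\<^sup>+x. ennreal (- (indicator X x * f x)) \<partial>lborel"]) auto
      moreover have "ennreal (indicator X x * f x) = ennreal (f x) * indicator X x"
          "ennreal (- (indicator X x * f x)) = ennreal (- f x) * indicator X x" for x
        by (auto simp: indicator_def)
      ultimately show ?thesis using X by (simp add: emeasure_density)
    qed
  qed
  then have "AE x in lborel. ennreal (f x) = ennreal (- f x)"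
    by (intro sigma_finite_measure.density_unique[OF sigma_finite_lborel]) auto
  then show ?thesis
    by eventually_elim (metis ennreal_eq_0_iff ennreal_inj linorder_le_cases neg_0_le_iff_le neg_le_0_iff_le neg_equal_zero)
qed

text \<open>
  An open set is a countable union of closed boxes. On each of them the restriction of \<open>g\<close>
  has zero integral over all open boxes.
\<close>

lemma fundamental_lemma:
  fixes g :: "'a::euclidean_space \<Rightarrow> real"
  assumes \<Omega>: "open \<Omega>" and g: "g locally_integrable_on \<Omega>"
    and orth: "\<And>\<phi>. \<phi> \<in> test_functions \<Omega> \<Longrightarrow> (\<integral>x. \<phi> x * g x \<partial>lebesgue_on \<Omega>) = 0"
  shows "AE x in lebesgue_on \<Omega>. g x = 0"
proof -
  have \<Omega>': "\<Omega> \<in> sets lebesgue" using \<Omega> by simp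
  have box: "AE x in lebesgue. x \<in> cbox a b \<longrightarrow> g x = 0" if ab: "cbox a b \<subseteq> \<Omega>" for a b
  proof -
    let ?g = "\<lambda>x. indicator (cbox a b) x *\<^sub>R g x"
    have gK: "integrable lebesgue ?g"
      using g ab compact_cbox by (auto simp: locally_integrable_on_def set_integrable_def)
    \<comment> \<open>a Borel representative, since the comparison of measures on boxes takes place on Borel sets\<close>
    then obtain f where f: "f \<in> borel_measurable lborel" "AE x in lborel. ?g x = f x"
      using completion_ex_borel_measurable_real[of ?g lborel] by auto
    have f': "AE x in lebesgue. ?g x = f x" using f(2) by (rule AE_completion)
    have "integrable lebesgue f"
      by (rule integrable_cong_AE_imp[OF gK measurable_completion[OF f(1)]])
        (use f' in eventually_elim, auto)
    then have il: "integrable lborel f"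
      using integrable_completion[OF f(1)] by simp
    have "(\<integral>x. indicator (box c d) x * f x \<partial>lborel) = 0" for c d
    proof -
      obtain c' d' where cd: "box c d \<inter> box a b = box c' d'" unfolding box_Int_box by blast
      have zero: "(\<integral>x. indicator (box c' d') x * g x \<partial>lebesgue) = 0"
      proof (cases "box c' d' = {}")
        case False
        then have "cbox c' d' = closure (box c' d')" by (simp add: closure_box)
        also have "\<dots> \<subseteq> cbox a b"
          using cd box_subset_cbox[of a b] by (intro closure_minimal) auto
        finally have "cbox c' d' \<subseteq> cbox a b" .
        then show ?thesis using ab by (intro integral_box_eq_0[OF g \<Omega>' orth]) auto
      qed simp
      have "AE x in lebesgue. x \<notin> cbox a b - box a b"
        using negligible_frontier_interval[of a b] AE_not_in negligible_iff_null_sets by blast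
      then have "AE x in lebesgue. indicator (box c d) x * f x = indicator (box c' d') x * g x"
        using f'
      proof eventually_elim
        case (elim x)
        have "indicator (box c' d') x = (indicator (box c d) x * indicator (box a b) x :: real)"
          by (simp add: cd[symmetric] indicator_inter_arith)
        then show ?case
          using elim box_subset_cbox[of a b] by (cases "x \<in> box a b"; cases "x \<in> cbox a b") auto
      qed
      then have "(\<integral>x. indicator (box c d) x * f x \<partial>lebesgue) = (\<integral>x. indicator (box c' d') x * g x \<partial>lebesgue)"
      proof (rule integral_cong_AE[rotated 2])
        show m: "(\<lambda>x. indicator (box c d) x * f x) \<in> borel_measurable lebesgue"
          using f(1) by (intro measurable_completion) auto
        have "x \<in> cbox a b" if "x \<in> box c' d'" for x
          using that box_subset_cbox[of a b] unfolding cd[symmetric] by blast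
        then have "(\<lambda>x. indicator (box c' d') x * g x) = (\<lambda>x. indicator (box c' d') x * ?g x)"
          by (intro ext) (simp add: indicator_def)
        then show "(\<lambda>x. indicator (box c' d') x * g x) \<in> borel_measurable lebesgue"
          using borel_measurable_times[OF borel_measurable_indicator borel_measurable_integrable[OF gK]]
          by simp
      qed
      then show ?thesis
        using zero f(1) by (subst (asm) integral_completion) auto
    qed
    then have "AE x in lborel. f x = 0"
      by (rule AE_zero_if_box_integrals_zero[OF il])
    then have "AE x in lebesgue. f x = 0" by (rule AE_completion)
    with f' show ?thesis by eventually_elim auto
  qed
  obtain \<D> where D: "countable \<D>" "\<And>X. X \<in> \<D> \<Longrightarrow> \<exists>a b. X = cbox a b" "\<Union>\<D> = \<Omega>"
    using open_countable_Union_open_cbox[OF \<Omega>] by metis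
  have "AE x in lebesgue. \<forall>X\<in>\<D>. x \<in> X \<longrightarrow> g x = 0"
    unfolding AE_ball_countable[OF D(1)] using box D by (metis Union_upper)
  then have "AE x in lebesgue. x \<in> \<Omega> \<longrightarrow> g x = 0"
    by eventually_elim (use D in auto)
  then show ?thesis using \<Omega>' by (subst AE_restrict_space_iff) auto
qed

section \<open>Weak gradients\<close>

lemma locally_integrable_on_subset: "f locally_integrable_on \<Omega> \<Longrightarrow> U \<subseteq> \<Omega> \<Longrightarrow> f locally_integrable_on U"
  by (auto simp: locally_integrable_on_def)

lemma locally_integrable_on_lincomb:
  assumes "f locally_integrable_on \<Omega>" "g locally_integrable_on \<Omega>"
  shows "(\<lambda>x. f x + c *\<^sub>R g x) locally_integrable_on \<Omega>"
  using assms unfolding locally_integrable_on_def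
  by (auto intro!: set_integral_add(1) absolutely_integrable_scaleR_left)

lemma locally_integrable_on_AE_cong:
  fixes f :: "'a::euclidean_space \<Rightarrow> 'b::euclidean_space"
  assumes f: "f locally_integrable_on \<Omega>" and \<Omega>: "\<Omega> \<in> sets lebesgue"
    and fg: "AE x in lebesgue_on \<Omega>. f x = g x"
  shows "g locally_integrable_on \<Omega>"
  unfolding locally_integrable_on_def
proof safe
  fix K assume K: "compact K" "K \<subseteq> \<Omega>"
  then have fK: "f absolutely_integrable_on K" using f by (auto simp: locally_integrable_on_def)
  have "AE x in lebesgue. x \<in> \<Omega> \<longrightarrow> f x = g x"
    using fg \<Omega> by (subst (asm) AE_restrict_space_iff) auto
  then have ae: "AE x in lebesgue. indicator K x *\<^sub>R f x = indicator K x *\<^sub>R g x"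
    by eventually_elim (use K in \<open>auto simp: indicator_def\<close>)
  have "(\<lambda>x. indicator K x *\<^sub>R f x) \<in> borel_measurable lebesgue"
    using fK unfolding set_integrable_def by (rule borel_measurable_integrable)
  then have "(\<lambda>x. indicator K x *\<^sub>R g x) \<in> borel_measurable lebesgue"
    using ae by (rule borel_measurable_AE)
  then show "g absolutely_integrable_on K"
    using fK ae unfolding set_integrable_def
    by (intro integrable_cong_AE_imp[of _ "\<lambda>x. indicator K x *\<^sub>R f x" "\<lambda>x. indicator K x *\<^sub>R g x"])
qed

lemma locally_integrable_on_inner:
  fixes f :: "'a::euclidean_space \<Rightarrow> 'b::euclidean_space"
  assumes "f locally_integrable_on \<Omega>"
  shows "(\<lambda>x. f x \<bullet> i) locally_integrable_on \<Omega>"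
  unfolding locally_integrable_on_def set_integrable_def
proof safe
  fix K assume "compact K" "K \<subseteq> \<Omega>"
  then have "integrable lebesgue (\<lambda>x. (indicator K x *\<^sub>R f x) \<bullet> i)"
    using assms by (intro integrable_inner_left) (auto simp: locally_integrable_on_def set_integrable_def)
  then show "integrable lebesgue (\<lambda>x. indicator K x *\<^sub>R (f x \<bullet> i))" by simp
qed

lemma borel_measurable_lebesgue_on_AE:
  fixes f :: "'a::euclidean_space \<Rightarrow> 'b::euclidean_space"
  assumes "f \<in> borel_measurable (lebesgue_on S)" "AE x in lebesgue_on S. f x = g x" "S \<in> sets lebesgue"
  shows "g \<in> borel_measurable (lebesgue_on S)"
proof -
  have "AE x in lebesgue. x \<in> S \<longrightarrow> f x = g x"
    using assms(2,3) by (subst (asm) AE_restrict_space_iff) auto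
  then have "AE x in lebesgue. (if x \<in> S then f x else 0) = (if x \<in> S then g x else 0)"
    by eventually_elim auto
  then show ?thesis
    using borel_measurable_AE[of "\<lambda>x. if x \<in> S then f x else 0" "\<lambda>x. if x \<in> S then g x else 0"]
      assms(1,3) by (simp add: borel_measurable_if)
qed

lemma locally_integrable_continuous:
  fixes f :: "'a::euclidean_space \<Rightarrow> 'b::euclidean_space"
  assumes "continuous_on UNIV f"
  shows "f locally_integrable_on \<Omega>"
  unfolding locally_integrable_on_def set_integrable_def
proof safe
  fix K :: "'a set" assume K: "compact K"
  have f: "f \<in> borel_measurable borel"
    using assms by (rule borel_measurable_continuous_onI)
  have "integrable lborel (\<lambda>x. indicator K x *\<^sub>R f x)"
    using K assms by (intro borel_integrable_compact) (auto intro: continuous_on_subset)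
  then show "integrable lebesgue (\<lambda>x. indicator K x *\<^sub>R f x)"
    using f K by (subst integrable_completion) (auto intro: borel_compact)
qed

lemma integrable_test_function_times:
  fixes f :: "'a::euclidean_space \<Rightarrow> 'b::euclidean_space"
  assumes "f locally_integrable_on \<Omega>" "\<Omega> \<in> sets lebesgue" "\<phi> \<in> test_functions \<Omega>"
  shows "integrable (lebesgue_on \<Omega>) (\<lambda>x. \<phi> x *\<^sub>R f x)"
    and "integrable (lebesgue_on \<Omega>) (\<lambda>x. (grad \<phi> x \<bullet> i) *\<^sub>R f x)"
proof -
  obtain K where K: "compact K" "K \<subseteq> \<Omega>" "\<And>x. x \<notin> K \<Longrightarrow> \<phi> x = 0" and s: "\<forall>k. Ck k \<phi>"
    using assms(3) by (auto simp: test_functions_iff)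
  show "integrable (lebesgue_on \<Omega>) (\<lambda>x. \<phi> x *\<^sub>R f x)"
    by (rule integrable_locally_times_compact[OF assms(1,2) continuous_test_function[OF s] K])
  show "integrable (lebesgue_on \<Omega>) (\<lambda>x. (grad \<phi> x \<bullet> i) *\<^sub>R f x)"
  proof (rule integrable_locally_times_compact[OF assms(1,2) _ K(1,2)])
    show "continuous_on UNIV (\<lambda>x. grad \<phi> x \<bullet> i)"
      by (intro continuous_intros continuous_grad s)
    show "grad \<phi> x \<bullet> i = 0" if "x \<notin> K" for x
      using grad_zero_outside[of K \<phi> x, OF compact_imp_closed[OF K(1)] K(3)] that by simp
  qed
qed

lemma has_weak_gradient_iff:
  "has_weak_gradient \<Omega> v G \<longleftrightarrow>
     v locally_integrable_on \<Omega> \<and> G locally_integrable_on \<Omega> \<and>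
     (\<forall>\<phi>\<in>test_functions \<Omega>. \<forall>i\<in>Basis.
        (\<integral>x. (grad \<phi> x \<bullet> i) * v x \<partial>lebesgue_on \<Omega>) = - (\<integral>x. \<phi> x * (G x \<bullet> i) \<partial>lebesgue_on \<Omega>))"
  unfolding has_weak_gradient_def by (simp add: mult.commute grad_inner_Basis cong: ball_cong)

lemma has_weak_gradient_unique:
  assumes \<Omega>: "open \<Omega>" and v: "has_weak_gradient \<Omega> v G" and w: "has_weak_gradient \<Omega> w G'"
    and vw: "AE x in lebesgue_on \<Omega>. v x = w x"
  shows "AE x in lebesgue_on \<Omega>. G x = G' x"
proof -
  have \<Omega>': "\<Omega> \<in> sets lebesgue" using \<Omega> by simp
  have li: "v locally_integrable_on \<Omega>" "w locally_integrable_on \<Omega>"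
      "G locally_integrable_on \<Omega>" "G' locally_integrable_on \<Omega>"
    using v w by (auto simp: has_weak_gradient_def)
  note lii = li(3,4)[THEN locally_integrable_on_inner]
  have "AE x in lebesgue_on \<Omega>. \<forall>i\<in>Basis. G x \<bullet> i + (-1) *\<^sub>R (G' x \<bullet> i) = 0"
    unfolding AE_ball_countable[OF countable_finite[OF finite_Basis]]
  proof (intro ballI fundamental_lemma[OF \<Omega>] locally_integrable_on_lincomb lii)
    fix i :: 'a and \<phi> assume i: "i \<in> Basis" and \<phi>: "\<phi> \<in> test_functions \<Omega>"
    have "(\<integral>x. (grad \<phi> x \<bullet> i) * v x \<partial>lebesgue_on \<Omega>) = (\<integral>x. (grad \<phi> x \<bullet> i) * w x \<partial>lebesgue_on \<Omega>)"
      using integrable_test_function_times(2)[OF li(1) \<Omega>' \<phi>, of i]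
        integrable_test_function_times(2)[OF li(2) \<Omega>' \<phi>, of i] vw
      by (intro integral_cong_AE) (auto elim: eventually_mono)
    then have "(\<integral>x. \<phi> x * (G x \<bullet> i) \<partial>lebesgue_on \<Omega>) = (\<integral>x. \<phi> x * (G' x \<bullet> i) \<partial>lebesgue_on \<Omega>)"
      using v w i \<phi> unfolding has_weak_gradient_iff by simp
    moreover have "(\<integral>x. \<phi> x * (G x \<bullet> i) - \<phi> x * (G' x \<bullet> i) \<partial>lebesgue_on \<Omega>)
        = (\<integral>x. \<phi> x * (G x \<bullet> i) \<partial>lebesgue_on \<Omega>) - (\<integral>x. \<phi> x * (G' x \<bullet> i) \<partial>lebesgue_on \<Omega>)"
      using integrable_test_function_times(1)[OF lii(1) \<Omega>' \<phi>, of i]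
        integrable_test_function_times(1)[OF lii(2) \<Omega>' \<phi>, of i]
      by (intro Bochner_Integration.integral_diff) auto
    ultimately show "(\<integral>x. \<phi> x * (G x \<bullet> i + (-1) *\<^sub>R (G' x \<bullet> i)) \<partial>lebesgue_on \<Omega>) = 0"
      by (simp add: algebra_simps)
  qed
  then show ?thesis
    by eventually_elim (simp add: euclidean_eq_iff[where 'a = 'a])
qed

lemma has_weak_gradient_lincomb:
  assumes \<Omega>: "\<Omega> \<in> sets lebesgue" and v: "has_weak_gradient \<Omega> v G" and w: "has_weak_gradient \<Omega> w G'"
  shows "has_weak_gradient \<Omega> (\<lambda>x. v x + c * w x) (\<lambda>x. G x + c *\<^sub>R G' x)"
  unfolding has_weak_gradient_iff
proof (intro conjI ballI)
  have li: "v locally_integrable_on \<Omega>" "w locally_integrable_on \<Omega>"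
      "G locally_integrable_on \<Omega>" "G' locally_integrable_on \<Omega>"
    using v w by (auto simp: has_weak_gradient_def)
  show "(\<lambda>x. v x + c * w x) locally_integrable_on \<Omega>" "(\<lambda>x. G x + c *\<^sub>R G' x) locally_integrable_on \<Omega>"
    using li locally_integrable_on_lincomb[of v \<Omega> w c] locally_integrable_on_lincomb[of G \<Omega> G' c] by auto
  fix \<phi> and i :: 'a assume \<phi>: "\<phi> \<in> test_functions \<Omega>" and i: "i \<in> Basis"
  note lii = li(3,4)[THEN locally_integrable_on_inner]
  have int: "integrable (lebesgue_on \<Omega>) (\<lambda>x. \<phi> x * (G x \<bullet> i))" "integrable (lebesgue_on \<Omega>) (\<lambda>x. \<phi> x * (G' x \<bullet> i))"
      "integrable (lebesgue_on \<Omega>) (\<lambda>x. (grad \<phi> x \<bullet> i) * v x)" "integrable (lebesgue_on \<Omega>) (\<lambda>x. (grad \<phi> x \<bullet> i) * w x)"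
    using integrable_test_function_times(1)[OF lii(1) \<Omega> \<phi>, of i]
      integrable_test_function_times(1)[OF lii(2) \<Omega> \<phi>, of i]
      integrable_test_function_times(2)[OF li(1) \<Omega> \<phi>, of i]
      integrable_test_function_times(2)[OF li(2) \<Omega> \<phi>, of i] by auto
  have "(\<integral>x. (grad \<phi> x \<bullet> i) * (v x + c * w x) \<partial>lebesgue_on \<Omega>) =
      (\<integral>x. (grad \<phi> x \<bullet> i) * v x + c * ((grad \<phi> x \<bullet> i) * w x) \<partial>lebesgue_on \<Omega>)"
    by (simp add: algebra_simps)
  also have "\<dots> = (\<integral>x. (grad \<phi> x \<bullet> i) * v x \<partial>lebesgue_on \<Omega>) + c * (\<integral>x. (grad \<phi> x \<bullet> i) * w x \<partial>lebesgue_on \<Omega>)"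
    using int by simp
  also have "\<dots> = - ((\<integral>x. \<phi> x * (G x \<bullet> i) \<partial>lebesgue_on \<Omega>) + c * (\<integral>x. \<phi> x * (G' x \<bullet> i) \<partial>lebesgue_on \<Omega>))"
    using v w \<phi> i by (simp add: has_weak_gradient_iff)
  also have "(\<integral>x. \<phi> x * (G x \<bullet> i) \<partial>lebesgue_on \<Omega>) + c * (\<integral>x. \<phi> x * (G' x \<bullet> i) \<partial>lebesgue_on \<Omega>)
      = (\<integral>x. \<phi> x * (G x \<bullet> i) + c * (\<phi> x * (G' x \<bullet> i)) \<partial>lebesgue_on \<Omega>)"
    using int by simp
  also have "\<dots> = (\<integral>x. \<phi> x * ((G x + c *\<^sub>R G' x) \<bullet> i) \<partial>lebesgue_on \<Omega>)"
    by (simp add: algebra_simps)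
  finally show "(\<integral>x. (grad \<phi> x \<bullet> i) * (v x + c * w x) \<partial>lebesgue_on \<Omega>) =
      - (\<integral>x. \<phi> x * ((G x + c *\<^sub>R G' x) \<bullet> i) \<partial>lebesgue_on \<Omega>)" .
qed

lemma has_weak_gradient_AE_cong:
  assumes \<Omega>: "\<Omega> \<in> sets lebesgue" and v: "has_weak_gradient \<Omega> v G"
    and vw: "AE x in lebesgue_on \<Omega>. v x = w x"
  shows "has_weak_gradient \<Omega> w G"
proof -
  have v': "v locally_integrable_on \<Omega>" using v by (simp add: has_weak_gradient_def)
  have w': "w locally_integrable_on \<Omega>"
    by (rule locally_integrable_on_AE_cong[OF v' \<Omega> vw])
  have "(\<integral>x. (grad \<phi> x \<bullet> i) * w x \<partial>lebesgue_on \<Omega>) = (\<integral>x. (grad \<phi> x \<bullet> i) * v x \<partial>lebesgue_on \<Omega>)"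
    if \<phi>: "\<phi> \<in> test_functions \<Omega>" for \<phi> i
    using integrable_test_function_times(2)[OF v' \<Omega> \<phi>, of i]
        integrable_test_function_times(2)[OF w' \<Omega> \<phi>, of i] vw
    by (intro integral_cong_AE) (auto elim: eventually_mono)
  then show ?thesis using v w' by (simp add: has_weak_gradient_iff)
qed

text \<open>
  Locality of the weak gradient: a test function on the smaller set is one on the larger set.
\<close>

lemma has_weak_gradient_subset:
  assumes v: "has_weak_gradient \<Omega> v G" and U: "U \<subseteq> \<Omega>" "U \<in> sets lebesgue" "\<Omega> \<in> sets lebesgue"
  shows "has_weak_gradient U v G"
  unfolding has_weak_gradient_iff
proof (intro conjI ballI)
  show "v locally_integrable_on U" "G locally_integrable_on U"
    using v U(1) by (auto simp: has_weak_gradient_def intro: locally_integrable_on_subset)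
  fix \<phi> and i :: 'a assume \<phi>: "\<phi> \<in> test_functions U" and i: "i \<in> Basis"
  obtain K where K: "compact K" "K \<subseteq> U" "\<And>x. x \<notin> K \<Longrightarrow> \<phi> x = 0"
    using \<phi> by (auto simp: test_functions_iff)
  have g0: "grad \<phi> x = 0" if "x \<notin> K" for x
    using grad_zero_outside[of K \<phi> x, OF compact_imp_closed[OF K(1)] K(3)] that by simp
  have eq: "(\<integral>x. f x \<partial>lebesgue_on U) = (\<integral>x. f x \<partial>lebesgue_on \<Omega>)" if "\<And>x. x \<notin> K \<Longrightarrow> f x = 0" for f :: "'a \<Rightarrow> real"
  proof -
    have "indicator U x *\<^sub>R f x = indicator \<Omega> x *\<^sub>R f x" for x
      using that[of x] subsetD[OF K(2), of x] subsetD[OF U(1), of x] by (cases "x \<in> K") auto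
    then show ?thesis using U by (simp only: integral_lebesgue_on)
  qed
  have "\<phi> \<in> test_functions \<Omega>" using \<phi> U(1) by (rule test_functions_mono)
  then have "(\<integral>x. (grad \<phi> x \<bullet> i) * v x \<partial>lebesgue_on \<Omega>) = - (\<integral>x. \<phi> x * (G x \<bullet> i) \<partial>lebesgue_on \<Omega>)"
    using v i by (simp add: has_weak_gradient_iff)
  then show "(\<integral>x. (grad \<phi> x \<bullet> i) * v x \<partial>lebesgue_on U) = - (\<integral>x. \<phi> x * (G x \<bullet> i) \<partial>lebesgue_on U)"
    using K(3) g0 by (simp add: eq)
qed

lemma has_weak_gradient_smooth:
  assumes \<Omega>: "\<Omega> \<in> sets lebesgue" and g: "\<forall>k. Ck k g"
  shows "has_weak_gradient \<Omega> g (grad g)"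
  unfolding has_weak_gradient_iff
proof (intro conjI ballI)
  show li: "g locally_integrable_on \<Omega>" "grad g locally_integrable_on \<Omega>"
    using g by (auto intro: locally_integrable_continuous continuous_test_function continuous_grad)
  fix \<phi> and i :: 'a assume \<phi>: "\<phi> \<in> test_functions \<Omega>" and i: "i \<in> Basis"
  have s: "\<forall>k. Ck k \<phi>" using \<phi> by (auto simp: test_functions_iff)
  have "0 = (\<integral>x. grad (\<lambda>x. g x * \<phi> x) x \<bullet> i \<partial>lebesgue_on \<Omega>)"
    using integral_grad_test_function[OF test_function_mult[OF \<phi> g] \<Omega> i] by simp
  also have "\<dots> = (\<integral>x. (grad \<phi> x \<bullet> i) * g x + \<phi> x * (grad g x \<bullet> i) \<partial>lebesgue_on \<Omega>)"
    by (simp add: grad_mult[OF g s] inner_add_left) (simp add: mult.commute)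
  also have "\<dots> = (\<integral>x. (grad \<phi> x \<bullet> i) * g x \<partial>lebesgue_on \<Omega>) + (\<integral>x. \<phi> x * (grad g x \<bullet> i) \<partial>lebesgue_on \<Omega>)"
    using integrable_test_function_times(2)[OF li(1) \<Omega> \<phi>, of i]
      integrable_test_function_times(1)[OF locally_integrable_on_inner[OF li(2), of i] \<Omega> \<phi>]
    by (intro Bochner_Integration.integral_add) auto
  finally show "(\<integral>x. (grad \<phi> x \<bullet> i) * g x \<partial>lebesgue_on \<Omega>) = - (\<integral>x. \<phi> x * (grad g x \<bullet> i) \<partial>lebesgue_on \<Omega>)"
    by simp
qed

lemma has_weak_gradient_affine:
  assumes "\<Omega> \<in> sets lebesgue"
  shows "has_weak_gradient \<Omega> (\<lambda>x. a + b \<bullet> x) (\<lambda>x. b)"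
proof -
  have "grad (\<lambda>x. a + b \<bullet> x) x = b" for x
    by (rule grad_eqI) (auto intro!: derivative_eq_intros)
  then have "grad (\<lambda>x. a + b \<bullet> x) = (\<lambda>x. b)" by auto
  then show ?thesis
    using has_weak_gradient_smooth[OF assms, of "\<lambda>x. a + b \<bullet> x"] Ck_affine[of _ a b] by simp
qed

section \<open>Square integrable functions\<close>

lemma L2_measurable: "f \<in> L2 S \<Longrightarrow> f \<in> borel_measurable (lebesgue_on S)"
  by (simp add: L2_def)

lemma L2_bound:
  assumes "f \<in> borel_measurable (lebesgue_on S)" "integrable (lebesgue_on S) B"
    and "AE x in lebesgue_on S. (norm (f x))\<^sup>2 \<le> B x"
  shows "f \<in> L2 S"
proof -
  have "integrable (lebesgue_on S) (\<lambda>x. (norm (f x))\<^sup>2)"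
    using assms by (intro Bochner_Integration.integrable_bound[OF assms(2)]) (auto elim!: eventually_mono)
  then show ?thesis using assms by (simp add: L2_def)
qed

lemma L2_lincomb:
  assumes "f \<in> L2 S" "g \<in> L2 S"
  shows "(\<lambda>x. f x + c *\<^sub>R g x) \<in> L2 S"
proof (rule L2_bound)
  note [measurable] = assms[THEN L2_measurable]
  show "(\<lambda>x. f x + c *\<^sub>R g x) \<in> borel_measurable (lebesgue_on S)" by measurable
  show "integrable (lebesgue_on S) (\<lambda>x. 2 * (norm (f x))\<^sup>2 + 2 * c\<^sup>2 * (norm (g x))\<^sup>2)"
    using assms by (auto simp: L2_def)
  show "AE x in lebesgue_on S. (norm (f x + c *\<^sub>R g x))\<^sup>2 \<le> 2 * (norm (f x))\<^sup>2 + 2 * c\<^sup>2 * (norm (g x))\<^sup>2"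
  proof (rule AE_I2)
    fix x
    have "(norm (f x + c *\<^sub>R g x))\<^sup>2 \<le> (norm (f x) + \<bar>c\<bar> * norm (g x))\<^sup>2"
      using norm_triangle_ineq[of "f x" "c *\<^sub>R g x"] by (intro power_mono) auto
    also have "\<dots> \<le> 2 * (norm (f x))\<^sup>2 + 2 * (\<bar>c\<bar> * norm (g x))\<^sup>2"
      using sum_squares_bound[of "norm (f x)" "\<bar>c\<bar> * norm (g x)"] by (simp add: power2_sum)
    finally show "(norm (f x + c *\<^sub>R g x))\<^sup>2 \<le> 2 * (norm (f x))\<^sup>2 + 2 * c\<^sup>2 * (norm (g x))\<^sup>2"
      by (simp add: power_mult_distrib)
  qed
qed

lemma L2_lincomb_real:
  fixes f g :: "'a::euclidean_space \<Rightarrow> real"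
  assumes "f \<in> L2 S" "g \<in> L2 S"
  shows "(\<lambda>x. f x + c * g x) \<in> L2 S"
  using L2_lincomb[OF assms, of c] by simp

lemma L2_AE_cong:
  assumes "f \<in> L2 S" "AE x in lebesgue_on S. f x = g x" "S \<in> sets lebesgue"
  shows "g \<in> L2 S"
proof (rule L2_bound)
  show "g \<in> borel_measurable (lebesgue_on S)"
    using borel_measurable_lebesgue_on_AE[OF L2_measurable[OF assms(1)] assms(2,3)] .
  show "integrable (lebesgue_on S) (\<lambda>x. (norm (f x))\<^sup>2)" using assms by (simp add: L2_def)
  show "AE x in lebesgue_on S. (norm (g x))\<^sup>2 \<le> (norm (f x))\<^sup>2"
    using assms(2) by eventually_elim simp
qed

lemma L2_integrable_inner:
  assumes "f \<in> L2 S" "g \<in> L2 S"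
  shows "integrable (lebesgue_on S) (\<lambda>x. f x \<bullet> g x)"
proof (rule Bochner_Integration.integrable_bound)
  note [measurable] = assms[THEN L2_measurable]
  show "integrable (lebesgue_on S) (\<lambda>x. (norm (f x))\<^sup>2 + (norm (g x))\<^sup>2)"
    using assms by (auto simp: L2_def)
  show "(\<lambda>x. f x \<bullet> g x) \<in> borel_measurable (lebesgue_on S)" by measurable
  show "AE x in lebesgue_on S. norm (f x \<bullet> g x) \<le> norm ((norm (f x))\<^sup>2 + (norm (g x))\<^sup>2)"
  proof (rule AE_I2)
    fix x
    have "norm (f x \<bullet> g x) \<le> norm (f x) * norm (g x)" using Cauchy_Schwarz_ineq2 by auto
    also have "\<dots> \<le> (norm (f x))\<^sup>2 + (norm (g x))\<^sup>2"
      using sum_squares_bound[of "norm (f x)" "norm (g x)"]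
        mult_nonneg_nonneg[OF norm_ge_zero[of "f x"] norm_ge_zero[of "g x"]] by linarith
    finally show "norm (f x \<bullet> g x) \<le> norm ((norm (f x))\<^sup>2 + (norm (g x))\<^sup>2)" by simp
  qed
qed

lemma l2_inner_commute: "l2_inner S f g = l2_inner S g f"
  by (simp add: l2_inner_def inner_commute)

lemma l2_inner_lincomb_left:
  assumes "f \<in> L2 S" "g \<in> L2 S" "k \<in> L2 S"
  shows "l2_inner S (\<lambda>x. f x + c *\<^sub>R g x) k = l2_inner S f k + c * l2_inner S g k"
  using L2_integrable_inner[OF assms(1,3)] L2_integrable_inner[OF assms(2,3)]
  by (simp add: l2_inner_def inner_add_left)

lemma l2_inner_lincomb_right:
  assumes "f \<in> L2 S" "g \<in> L2 S" "k \<in> L2 S"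
  shows "l2_inner S k (\<lambda>x. f x + c *\<^sub>R g x) = l2_inner S k f + c * l2_inner S k g"
  using l2_inner_lincomb_left[OF assms] by (simp only: l2_inner_commute[of S k])

lemma l2_inner_lincomb_self:
  assumes "f \<in> L2 S" "g \<in> L2 S"
  shows "l2_inner S (\<lambda>x. f x + c *\<^sub>R g x) (\<lambda>x. f x + c *\<^sub>R g x) =
    l2_inner S f f + 2 * c * l2_inner S f g + c\<^sup>2 * l2_inner S g g"
  unfolding l2_inner_lincomb_left[OF assms L2_lincomb[OF assms]]
    l2_inner_lincomb_right[OF assms assms(1)] l2_inner_lincomb_right[OF assms assms(2)]
    l2_inner_commute[of S g f]
  by (simp add: power2_eq_square algebra_simps)

lemma l2_inner_AE_cong:
  assumes "f \<in> L2 S" "g \<in> L2 S" "AE x in lebesgue_on S. f x = f' x" "AE x in lebesgue_on S. g x = g' x"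
    and S: "S \<in> sets lebesgue"
  shows "l2_inner S f g = l2_inner S f' g'"
  unfolding l2_inner_def
proof (rule integral_cong_AE)
  note [measurable] = assms(1,2)[THEN L2_measurable]
    L2_AE_cong[OF assms(1,3) S, THEN L2_measurable] L2_AE_cong[OF assms(2,4) S, THEN L2_measurable]
  show "(\<lambda>x. f x \<bullet> g x) \<in> borel_measurable (lebesgue_on S)"
    "(\<lambda>x. f' x \<bullet> g' x) \<in> borel_measurable (lebesgue_on S)" by measurable
  show "AE x in lebesgue_on S. f x \<bullet> g x = f' x \<bullet> g' x"
    using assms(3,4) by eventually_elim simp
qed

lemma l2_norm_AE_cong:
  assumes "f \<in> L2 S" "AE x in lebesgue_on S. f x = f' x" "S \<in> sets lebesgue"
  shows "l2_norm S f = l2_norm S f'"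
  using l2_inner_AE_cong[OF assms(1,1,2,2,3)] by (simp add: l2_norm_def)

lemma l2_inner_self_nonneg: "l2_inner S f f \<ge> 0"
  by (auto simp: l2_inner_def)

lemma l2_norm_nonneg [simp]: "l2_norm S f \<ge> 0"
  by (simp add: l2_norm_def l2_inner_self_nonneg)

lemma l2_norm_square: "(l2_norm S f)\<^sup>2 = l2_inner S f f"
  by (simp add: l2_norm_def l2_inner_self_nonneg)

lemma l2_norm_mono:
  assumes "f \<in> borel_measurable (lebesgue_on S)" "g \<in> L2 S" "M \<ge> 0"
    and "AE x in lebesgue_on S. norm (f x) \<le> M * norm (g x)"
  shows "f \<in> L2 S" "l2_norm S f \<le> M * l2_norm S g"
proof -
  have le: "AE x in lebesgue_on S. (norm (f x))\<^sup>2 \<le> M\<^sup>2 * (norm (g x))\<^sup>2"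
    using assms(4) by eventually_elim (metis norm_ge_zero power_mono power_mult_distrib)
  have i: "integrable (lebesgue_on S) (\<lambda>x. M\<^sup>2 * (norm (g x))\<^sup>2)"
    using assms(2) by (simp add: L2_def)
  show f: "f \<in> L2 S" by (rule L2_bound[OF assms(1) i le])
  have "l2_inner S f f \<le> M\<^sup>2 * l2_inner S g g"
    using integral_mono_AE[OF _ i le] f
    by (simp add: l2_inner_def L2_def power2_norm_eq_inner)
  then have "l2_norm S f \<le> sqrt (M\<^sup>2 * l2_inner S g g)"
    unfolding l2_norm_def by (rule real_sqrt_le_mono)
  then show "l2_norm S f \<le> M * l2_norm S g"
    using assms(3) by (simp add: l2_norm_def real_sqrt_mult)
qed

text \<open>The discriminant of the nonnegative quadratic polynomial \<open>t \<mapsto> (f + t g, f + t g)\<close> is nonpositive.\<close>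

lemma l2_Cauchy_Schwarz:
  assumes "f \<in> L2 S" "g \<in> L2 S"
  shows "\<bar>l2_inner S f g\<bar> \<le> l2_norm S f * l2_norm S g"
proof -
  let ?a = "l2_inner S g g" and ?b = "l2_inner S f g" and ?c = "l2_inner S f f"
  have q: "?c + 2 * t * ?b + t\<^sup>2 * ?a \<ge> 0" for t
  proof -
    have "0 \<le> l2_inner S (\<lambda>x. f x + t *\<^sub>R g x) (\<lambda>x. f x + t *\<^sub>R g x)"
      by (rule l2_inner_self_nonneg)
    also have "\<dots> = ?c + 2 * t * ?b + t\<^sup>2 * ?a"
      using l2_inner_lincomb_self[OF assms] .
    finally show ?thesis .
  qed
  have "?b\<^sup>2 \<le> ?c * ?a"
  proof (cases "?a = 0")
    case True
    have "?b = 0"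
    proof (rule ccontr)
      assume "?b \<noteq> 0"
      then show False using q[of "- (?c + 1) / (2 * ?b)"] True by (simp add: field_simps)
    qed
    then show ?thesis using True by simp
  next
    case False
    then have a: "?a > 0" using l2_inner_self_nonneg[of S g] by linarith
    have "?c + 2 * (- ?b / ?a) * ?b + (- ?b / ?a)\<^sup>2 * ?a = ?c - ?b\<^sup>2 / ?a"
      using a by (simp add: field_simps power2_eq_square)
    then have "?b\<^sup>2 / ?a \<le> ?c" using q[of "- ?b / ?a"] by linarith
    then show ?thesis using a by (simp add: field_simps)
  qed
  then have "sqrt (?b\<^sup>2) \<le> sqrt (?c * ?a)" by (rule real_sqrt_le_mono)
  then show ?thesis by (simp add: l2_norm_def real_sqrt_mult)
qed

lemma l2_norm_triangle:
  assumes "f \<in> L2 S" "g \<in> L2 S"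
  shows "l2_norm S (\<lambda>x. f x + c *\<^sub>R g x) \<le> l2_norm S f + \<bar>c\<bar> * l2_norm S g"
proof (rule power2_le_imp_le)
  have "(l2_norm S (\<lambda>x. f x + c *\<^sub>R g x))\<^sup>2 = l2_inner S f f + 2 * (c * l2_inner S f g) + c\<^sup>2 * l2_inner S g g"
    unfolding l2_norm_square l2_inner_lincomb_self[OF assms] by simp
  also have "\<dots> \<le> l2_inner S f f + 2 * (\<bar>c\<bar> * (l2_norm S f * l2_norm S g)) + c\<^sup>2 * l2_inner S g g"
    using mult_left_mono[OF l2_Cauchy_Schwarz[OF assms], of "\<bar>c\<bar>"] abs_le_D1[of "c * l2_inner S f g"]
    by (simp add: abs_mult)
  also have "\<dots> = (l2_norm S f + \<bar>c\<bar> * l2_norm S g)\<^sup>2"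
    by (simp add: power2_sum power_mult_distrib l2_norm_square)
  finally show "(l2_norm S (\<lambda>x. f x + c *\<^sub>R g x))\<^sup>2 \<le> (l2_norm S f + \<bar>c\<bar> * l2_norm S g)\<^sup>2" .
qed simp

lemma L2_diff: "f \<in> L2 S \<Longrightarrow> g \<in> L2 S \<Longrightarrow> (\<lambda>x. f x - g x) \<in> L2 S"
  using L2_lincomb[of f S g "-1"] by simp

lemma l2_inner_diff_left:
  "f \<in> L2 S \<Longrightarrow> g \<in> L2 S \<Longrightarrow> k \<in> L2 S \<Longrightarrow>
    l2_inner S (\<lambda>x. f x - g x) k = l2_inner S f k - l2_inner S g k"
  using l2_inner_lincomb_left[of f S g k "-1"] by simp

lemma l2_inner_diff_right:
  "f \<in> L2 S \<Longrightarrow> g \<in> L2 S \<Longrightarrow> k \<in> L2 S \<Longrightarrow>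
    l2_inner S k (\<lambda>x. f x - g x) = l2_inner S k f - l2_inner S k g"
  using l2_inner_lincomb_right[of f S g k "-1"] by simp

lemma l2_norm_diff_le:
  assumes "f \<in> L2 S" "g \<in> L2 S"
  shows "\<bar>l2_norm S f - l2_norm S g\<bar> \<le> l2_norm S (\<lambda>x. f x - g x)"
proof -
  have d: "(\<lambda>x. f x - g x) \<in> L2 S" using assms by (rule L2_diff)
  show ?thesis
    using l2_norm_triangle[OF assms(1) d, of "-1"] l2_norm_triangle[OF assms(2) d, of 1] by simp
qed

lemma L2_continuous_compact_support:
  fixes g :: "'a::euclidean_space \<Rightarrow> 'b::euclidean_space"
  assumes g: "continuous_on UNIV g" and K: "compact K" "K \<subseteq> \<Omega>" "\<And>x. x \<notin> K \<Longrightarrow> g x = 0"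
    and \<Omega>: "\<Omega> \<in> sets lebesgue"
  shows "g \<in> L2 \<Omega>"
proof -
  have "integrable (lebesgue_on \<Omega>) (\<lambda>x. (norm (g x))\<^sup>2 *\<^sub>R (1 :: real))"
    using K(3) by (intro integrable_locally_times_compact[OF _ \<Omega> _ K(1,2)]
        locally_integrable_continuous continuous_intros g) auto
  moreover have "g \<in> borel_measurable (lebesgue_on \<Omega>)"
    using borel_measurable_lebesgueI[OF borel_measurable_continuous_onI[OF g]]
    by (rule measurable_restrict_space1)
  ultimately show ?thesis by (simp add: L2_def)
qed

lemma test_function_L2:
  assumes "\<phi> \<in> test_functions \<Omega>" "\<Omega> \<in> sets lebesgue"
  shows "\<phi> \<in> L2 \<Omega>" "grad \<phi> \<in> L2 \<Omega>" "(\<lambda>x. grad \<phi> x \<bullet> i) \<in> L2 \<Omega>" "(\<lambda>x. \<phi> x *\<^sub>R b) \<in> L2 \<Omega>"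
proof -
  obtain K where K: "compact K" "K \<subseteq> \<Omega>" "\<And>x. x \<notin> K \<Longrightarrow> \<phi> x = 0" and s: "\<forall>k. Ck k \<phi>"
    using assms(1) by (auto simp: test_functions_iff)
  have g0: "grad \<phi> x = 0" if "x \<notin> K" for x
    using grad_zero_outside[of K \<phi> x, OF compact_imp_closed[OF K(1)] K(3)] that by simp
  show "\<phi> \<in> L2 \<Omega>" "grad \<phi> \<in> L2 \<Omega>" "(\<lambda>x. grad \<phi> x \<bullet> i) \<in> L2 \<Omega>" "(\<lambda>x. \<phi> x *\<^sub>R b) \<in> L2 \<Omega>"
    using K(3) g0 by (intro L2_continuous_compact_support[OF _ K(1,2) _ assms(2)]
        continuous_intros continuous_test_function continuous_grad s; simp)+
qed

lemma L2_imp_locally_integrable: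
  fixes f :: "'a::euclidean_space \<Rightarrow> 'b::euclidean_space"
  assumes f: "f \<in> L2 \<Omega>" and \<Omega>: "\<Omega> \<in> sets lebesgue"
  shows "f locally_integrable_on \<Omega>"
  unfolding locally_integrable_on_def set_integrable_def
proof safe
  fix K :: "'a set" assume K: "compact K" "K \<subseteq> \<Omega>"
  have K': "K \<in> sets lebesgue" using K by (simp add: borel_compact)
  have "integrable (lebesgue_on \<Omega>) (\<lambda>x. indicator K x *\<^sub>R f x)"
  proof (rule Bochner_Integration.integrable_bound)
    have "integrable lebesgue (indicator K :: 'a \<Rightarrow> real)"
      using K lmeasurable_compact[OF K(1)] by (intro integrable_real_indicator) (auto simp: fmeasurable_def)
    moreover have "indicator \<Omega> x *\<^sub>R (indicator K x :: real) = indicator K x" for x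
      using K(2) by (auto simp: indicator_def)
    ultimately have "integrable (lebesgue_on \<Omega>) (indicator K :: 'a \<Rightarrow> real)"
      using \<Omega> by (simp only: integrable_lebesgue_on)
    then show "integrable (lebesgue_on \<Omega>) (\<lambda>x. indicator K x + (norm (f x))\<^sup>2)"
      using f by (auto simp: L2_def)
    have "(indicator K :: 'a \<Rightarrow> real) \<in> borel_measurable (lebesgue_on \<Omega>)"
      using K' by (intro measurable_restrict_space1 borel_measurable_indicator)
    then show "(\<lambda>x. indicator K x *\<^sub>R f x) \<in> borel_measurable (lebesgue_on \<Omega>)"
      using L2_measurable[OF f] by (rule borel_measurable_scaleR)
    show "AE x in lebesgue_on \<Omega>. norm (indicator K x *\<^sub>R f x) \<le> norm (indicator K x + (norm (f x))\<^sup>2)"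
    proof (rule AE_I2)
      fix x
      have "0 \<le> (norm (f x) - 1)\<^sup>2" "0 \<le> (norm (f x))\<^sup>2" by auto
      then have "norm (f x) \<le> 1 + (norm (f x))\<^sup>2"
        using norm_ge_zero[of "f x"] unfolding power2_diff one_power2 mult_1_right by linarith
      then show "norm (indicator K x *\<^sub>R f x) \<le> norm (indicator K x + (norm (f x))\<^sup>2)"
        by (simp add: indicator_def)
    qed
  qed
  moreover have "indicator \<Omega> x *\<^sub>R (indicator K x *\<^sub>R f x) = indicator K x *\<^sub>R f x" for x
    using K(2) by (auto simp: indicator_def)
  ultimately show "integrable lebesgue (\<lambda>x. indicator K x *\<^sub>R f x)"
    using \<Omega> by (simp only: integrable_lebesgue_on)
qed

section \<open>The space \<open>H10\<close>\<close>

lemma has_weak_gradient_wgrad: "has_weak_gradient \<Omega> v G \<Longrightarrow> has_weak_gradient \<Omega> v (wgrad \<Omega> v)"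
  unfolding wgrad_def by (rule someI[where P = "has_weak_gradient \<Omega> v"])

lemma wgrad_AE_eq:
  assumes "open \<Omega>" "has_weak_gradient \<Omega> v G"
  shows "AE x in lebesgue_on \<Omega>. wgrad \<Omega> v x = G x"
  using has_weak_gradient_unique[OF assms(1) has_weak_gradient_wgrad[OF assms(2)] assms(2)] by simp

lemma H1_wgrad:
  assumes "open \<Omega>" "v \<in> H1 \<Omega>"
  shows "v \<in> L2 \<Omega>" "has_weak_gradient \<Omega> v (wgrad \<Omega> v)" "wgrad \<Omega> v \<in> L2 \<Omega>"
proof -
  obtain G where G: "G \<in> L2 \<Omega>" "has_weak_gradient \<Omega> v G"
    using assms(2) by (auto simp: H1_def)
  then show "has_weak_gradient \<Omega> v (wgrad \<Omega> v)" by (intro has_weak_gradient_wgrad)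
  have "AE x in lebesgue_on \<Omega>. G x = wgrad \<Omega> v x"
    using wgrad_AE_eq[OF assms(1) G(2)] by eventually_elim simp
  then show "wgrad \<Omega> v \<in> L2 \<Omega>" using assms(1) by (intro L2_AE_cong[OF G(1)]) auto
  show "v \<in> L2 \<Omega>" using assms(2) by (simp add: H1_def)
qed

lemma H10_imp_H1: "v \<in> H10 \<Omega> \<Longrightarrow> v \<in> H1 \<Omega>"
  by (simp add: H10_def)

lemma wgrad_lincomb:
  assumes "open \<Omega>" "v \<in> H1 \<Omega>" "w \<in> H1 \<Omega>"
  shows "AE x in lebesgue_on \<Omega>. wgrad \<Omega> (\<lambda>x. v x + c * w x) x = wgrad \<Omega> v x + c *\<^sub>R wgrad \<Omega> w x"
  using assms by (intro wgrad_AE_eq has_weak_gradient_lincomb H1_wgrad) auto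

text \<open>
  This replaces limits of sequences when an identity is extended from test functions to
  \<^const>\<open>H10\<close>: the error of an approximation of quality \<open>e\<close> is a multiple of \<open>e\<close>.
\<close>

lemma eq_0_if_le_all_multiples:
  fixes X C :: real
  assumes "\<And>e. 0 < e \<Longrightarrow> e \<le> 1 \<Longrightarrow> \<bar>X\<bar> \<le> e * C"
  shows "X = 0"
proof (rule ccontr)
  assume "X \<noteq> 0"
  then have X: "\<bar>X\<bar> > 0" by simp
  then have C: "C > 0" using assms[of 1] by simp
  define e where "e = min 1 (\<bar>X\<bar> / (2 * C))"
  have "\<bar>X\<bar> \<le> e * C" using X C by (intro assms) (auto simp: e_def)
  also have "\<dots> \<le> \<bar>X\<bar> / (2 * C) * C" using C by (intro mult_right_mono) (auto simp: e_def)
  also have "\<dots> < \<bar>X\<bar>" using X C by (simp add: field_simps)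
  finally show False by simp
qed

text \<open>
  Both sides of the integration by parts formula are continuous in \<^const>\<open>L2\<close>, so the formula
  passes from the approximating test functions to the limit.
\<close>

lemma has_weak_gradient_L2_limit:
  assumes \<Omega>: "\<Omega> \<in> sets lebesgue" and v: "v \<in> L2 \<Omega>" and G: "G \<in> L2 \<Omega>"
    and approx: "\<And>e. e > 0 \<Longrightarrow> \<exists>\<phi>\<in>test_functions \<Omega>.
        l2_norm \<Omega> (\<lambda>x. v x - \<phi> x) < e \<and> l2_norm \<Omega> (\<lambda>x. G x - grad \<phi> x) < e"
  shows "has_weak_gradient \<Omega> v G"
  unfolding has_weak_gradient_iff
proof (intro conjI ballI)
  show "v locally_integrable_on \<Omega>" "G locally_integrable_on \<Omega>"
    using v G \<Omega> by (auto intro: L2_imp_locally_integrable)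
  fix \<psi> and i :: 'a assume \<psi>: "\<psi> \<in> test_functions \<Omega>" and i: "i \<in> Basis"
  define g where "g x = grad \<psi> x \<bullet> i" for x
  define p where "p x = \<psi> x *\<^sub>R i" for x
  have L2: "g \<in> L2 \<Omega>" "p \<in> L2 \<Omega>"
    unfolding g_def[abs_def] p_def[abs_def] using test_function_L2[OF \<psi> \<Omega>] by auto
  have "l2_inner \<Omega> g v + l2_inner \<Omega> p G = 0"
  proof (rule eq_0_if_le_all_multiples)
    fix e :: real assume e: "0 < e"
    obtain \<phi> where \<phi>: "\<phi> \<in> test_functions \<Omega>"
        and le: "l2_norm \<Omega> (\<lambda>x. v x - \<phi> x) < e" "l2_norm \<Omega> (\<lambda>x. G x - grad \<phi> x) < e"
      using approx[OF e] by auto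
    note \<phi>L2 = test_function_L2[OF \<phi> \<Omega>]
    have "has_weak_gradient \<Omega> \<phi> (grad \<phi>)"
      using \<phi> \<Omega> by (intro has_weak_gradient_smooth) (auto simp: test_functions_iff)
    then have "l2_inner \<Omega> g \<phi> + l2_inner \<Omega> p (grad \<phi>) = 0"
      using \<psi> i by (simp add: has_weak_gradient_iff l2_inner_def g_def p_def inner_commute)
    then have "l2_inner \<Omega> g v + l2_inner \<Omega> p G =
        l2_inner \<Omega> g (\<lambda>x. v x - \<phi> x) + l2_inner \<Omega> p (\<lambda>x. G x - grad \<phi> x)"
      using v G L2 \<phi>L2 by (simp add: l2_inner_diff_right)
    also have "\<bar>\<dots>\<bar> \<le> \<bar>l2_inner \<Omega> g (\<lambda>x. v x - \<phi> x)\<bar> + \<bar>l2_inner \<Omega> p (\<lambda>x. G x - grad \<phi> x)\<bar>"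
      by (rule abs_triangle_ineq)
    also have "\<dots> \<le> l2_norm \<Omega> g * l2_norm \<Omega> (\<lambda>x. v x - \<phi> x) + l2_norm \<Omega> p * l2_norm \<Omega> (\<lambda>x. G x - grad \<phi> x)"
      using v G L2 \<phi>L2 by (intro add_mono l2_Cauchy_Schwarz L2_diff) auto
    also have "\<dots> \<le> l2_norm \<Omega> g * e + l2_norm \<Omega> p * e"
      using le by (intro add_mono mult_left_mono) auto
    finally show "\<bar>l2_inner \<Omega> g v + l2_inner \<Omega> p G\<bar> \<le> e * (l2_norm \<Omega> g + l2_norm \<Omega> p)"
      by (simp add: algebra_simps)
  qed
  then show "(\<integral>x. (grad \<psi> x \<bullet> i) * v x \<partial>lebesgue_on \<Omega>) = - (\<integral>x. \<psi> x * (G x \<bullet> i) \<partial>lebesgue_on \<Omega>)"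
    by (simp add: l2_inner_def g_def p_def inner_commute)
qed

lemma h1_norm_diff_test_function:
  assumes \<Omega>: "open \<Omega>" and v: "has_weak_gradient \<Omega> v G" "G \<in> L2 \<Omega>" and \<phi>: "\<phi> \<in> test_functions \<Omega>"
  shows "h1_norm \<Omega> (\<lambda>x. v x - \<phi> x) =
    sqrt ((l2_norm \<Omega> (\<lambda>x. v x - \<phi> x))\<^sup>2 + (l2_norm \<Omega> (\<lambda>x. G x - grad \<phi> x))\<^sup>2)"
proof -
  have \<Omega>': "\<Omega> \<in> sets lebesgue" using \<Omega> by simp
  have "has_weak_gradient \<Omega> \<phi> (grad \<phi>)"
    using \<phi> \<Omega>' by (intro has_weak_gradient_smooth) (auto simp: test_functions_iff)
  from has_weak_gradient_lincomb[OF \<Omega>' v(1) this, of "-1"]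
  have "has_weak_gradient \<Omega> (\<lambda>x. v x - \<phi> x) (\<lambda>x. G x - grad \<phi> x)" by simp
  then have "AE x in lebesgue_on \<Omega>. G x - grad \<phi> x = wgrad \<Omega> (\<lambda>x. v x - \<phi> x) x"
    using wgrad_AE_eq[OF \<Omega>] by (fastforce elim: eventually_mono)
  from l2_norm_AE_cong[OF _ this \<Omega>'] show ?thesis
    using L2_diff[OF v(2) test_function_L2(2)[OF \<phi> \<Omega>']] by (simp add: h1_norm_def)
qed

lemma H10I:
  assumes \<Omega>: "open \<Omega>" and v: "v \<in> L2 \<Omega>" and G: "G \<in> L2 \<Omega>"
    and approx: "\<And>e. e > 0 \<Longrightarrow> \<exists>\<phi>\<in>test_functions \<Omega>.
        l2_norm \<Omega> (\<lambda>x. v x - \<phi> x) < e \<and> l2_norm \<Omega> (\<lambda>x. G x - grad \<phi> x) < e"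
  shows "v \<in> H10 \<Omega>"
proof -
  have wg: "has_weak_gradient \<Omega> v G"
    using \<Omega> by (intro has_weak_gradient_L2_limit v G approx) auto
  show ?thesis unfolding H10_def
  proof safe
    show "v \<in> H1 \<Omega>" using v G wg by (auto simp: H1_def)
    fix e :: real assume "e > 0"
    then obtain \<phi> where \<phi>: "\<phi> \<in> test_functions \<Omega>"
        and le: "l2_norm \<Omega> (\<lambda>x. v x - \<phi> x) < e / 2" "l2_norm \<Omega> (\<lambda>x. G x - grad \<phi> x) < e / 2"
      using approx[of "e / 2"] by auto
    have "h1_norm \<Omega> (\<lambda>x. v x - \<phi> x) \<le> l2_norm \<Omega> (\<lambda>x. v x - \<phi> x) + l2_norm \<Omega> (\<lambda>x. G x - grad \<phi> x)"
      unfolding h1_norm_diff_test_function[OF \<Omega> wg G \<phi>] by (rule sqrt_sum_squares_le_sum) auto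
    then have "h1_norm \<Omega> (\<lambda>x. v x - \<phi> x) < e" using le by linarith
    then show "\<exists>\<phi>\<in>test_functions \<Omega>. h1_norm \<Omega> (\<lambda>x. v x - \<phi> x) < e" using \<phi> by blast
  qed
qed

lemma H10_approx:
  assumes \<Omega>: "open \<Omega>" and v: "v \<in> H10 \<Omega>" and e: "e > 0"
  obtains \<phi> where "\<phi> \<in> test_functions \<Omega>"
    "l2_norm \<Omega> (\<lambda>x. v x - \<phi> x) < e" "l2_norm \<Omega> (\<lambda>x. wgrad \<Omega> v x - grad \<phi> x) < e"
proof -
  note w = H1_wgrad[OF \<Omega> H10_imp_H1[OF v]]
  obtain \<phi> where \<phi>: "\<phi> \<in> test_functions \<Omega>" and le: "h1_norm \<Omega> (\<lambda>x. v x - \<phi> x) < e"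
    using v e by (auto simp: H10_def)
  show thesis
    using le unfolding h1_norm_diff_test_function[OF \<Omega> w(2,3) \<phi>]
    by (intro that[OF \<phi>]) (auto intro: le_less_trans[OF real_sqrt_sum_squares_ge1]
        le_less_trans[OF real_sqrt_sum_squares_ge2])
qed

lemma H10_lincomb:
  assumes \<Omega>: "open \<Omega>" and v: "v \<in> H10 \<Omega>" and w: "w \<in> H10 \<Omega>"
  shows "(\<lambda>x. v x + c * w x) \<in> H10 \<Omega>"
proof (rule H10I[OF \<Omega>])
  have \<Omega>': "\<Omega> \<in> sets lebesgue" using \<Omega> by simp
  note v' = H1_wgrad[OF \<Omega> H10_imp_H1[OF v]] and w' = H1_wgrad[OF \<Omega> H10_imp_H1[OF w]]
  show "(\<lambda>x. v x + c * w x) \<in> L2 \<Omega>" using v' w' by (intro L2_lincomb_real) auto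
  show "(\<lambda>x. wgrad \<Omega> v x + c *\<^sub>R wgrad \<Omega> w x) \<in> L2 \<Omega>" using v' w' by (intro L2_lincomb) auto
  fix e :: real assume "e > 0"
  then have e': "e / (1 + \<bar>c\<bar>) > 0" by (simp add: divide_pos_pos add_pos_nonneg)
  obtain \<phi> where \<phi>: "\<phi> \<in> test_functions \<Omega>" "l2_norm \<Omega> (\<lambda>x. v x - \<phi> x) < e / (1 + \<bar>c\<bar>)"
      "l2_norm \<Omega> (\<lambda>x. wgrad \<Omega> v x - grad \<phi> x) < e / (1 + \<bar>c\<bar>)"
    using H10_approx[OF \<Omega> v e'] .
  obtain \<psi> where \<psi>: "\<psi> \<in> test_functions \<Omega>" "l2_norm \<Omega> (\<lambda>x. w x - \<psi> x) < e / (1 + \<bar>c\<bar>)"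
      "l2_norm \<Omega> (\<lambda>x. wgrad \<Omega> w x - grad \<psi> x) < e / (1 + \<bar>c\<bar>)"
    using H10_approx[OF \<Omega> w e'] .
  note L2 = test_function_L2[OF \<phi>(1) \<Omega>'] test_function_L2[OF \<psi>(1) \<Omega>']
  have lt: "a + \<bar>c\<bar> * b < e" if "a < e / (1 + \<bar>c\<bar>)" "b < e / (1 + \<bar>c\<bar>)" for a b
  proof -
    have "a + \<bar>c\<bar> * b < e / (1 + \<bar>c\<bar>) + \<bar>c\<bar> * (e / (1 + \<bar>c\<bar>))"
      using that by (intro add_less_le_mono mult_left_mono) auto
    also have "\<dots> = e" by (simp add: add_divide_distrib[symmetric] field_simps)
    finally show ?thesis .
  qed
  show "\<exists>\<phi>\<in>test_functions \<Omega>. l2_norm \<Omega> (\<lambda>x. v x + c * w x - \<phi> x) < e \<and>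
      l2_norm \<Omega> (\<lambda>x. wgrad \<Omega> v x + c *\<^sub>R wgrad \<Omega> w x - grad \<phi> x) < e"
  proof (intro bexI conjI)
    show "(\<lambda>x. \<phi> x + c * \<psi> x) \<in> test_functions \<Omega>" using \<phi>(1) \<psi>(1) by (rule test_function_lincomb)
    have "l2_norm \<Omega> (\<lambda>x. (v x - \<phi> x) + c *\<^sub>R (w x - \<psi> x)) < e"
      using v' w' L2 \<phi> \<psi> by (intro le_less_trans[OF l2_norm_triangle] L2_diff lt)
    then show "l2_norm \<Omega> (\<lambda>x. v x + c * w x - (\<phi> x + c * \<psi> x)) < e" by (simp add: algebra_simps)
    have "l2_norm \<Omega> (\<lambda>x. (wgrad \<Omega> v x - grad \<phi> x) + c *\<^sub>R (wgrad \<Omega> w x - grad \<psi> x)) < e"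
      using v' w' L2 \<phi> \<psi> by (intro le_less_trans[OF l2_norm_triangle] L2_diff lt)
    then show "l2_norm \<Omega> (\<lambda>x. wgrad \<Omega> v x + c *\<^sub>R wgrad \<Omega> w x - grad (\<lambda>x. \<phi> x + c * \<psi> x) x) < e"
      using \<phi>(1) \<psi>(1) by (simp add: grad_lincomb test_functions_iff algebra_simps)
  qed
qed

lemma H10_AE_cong:
  assumes \<Omega>: "open \<Omega>" and v: "v \<in> H10 \<Omega>" and vw: "AE x in lebesgue_on \<Omega>. v x = w x"
  shows "w \<in> H10 \<Omega>"
proof (rule H10I[OF \<Omega>])
  have \<Omega>': "\<Omega> \<in> sets lebesgue" using \<Omega> by simp
  note v' = H1_wgrad[OF \<Omega> H10_imp_H1[OF v]]
  show "w \<in> L2 \<Omega>" using v'(1) vw \<Omega>' by (rule L2_AE_cong)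
  show "wgrad \<Omega> v \<in> L2 \<Omega>" by fact
  fix e :: real assume e: "e > 0"
  obtain \<phi> where \<phi>: "\<phi> \<in> test_functions \<Omega>" "l2_norm \<Omega> (\<lambda>x. v x - \<phi> x) < e"
      "l2_norm \<Omega> (\<lambda>x. wgrad \<Omega> v x - grad \<phi> x) < e"
    using H10_approx[OF \<Omega> v e] .
  have "l2_norm \<Omega> (\<lambda>x. v x - \<phi> x) = l2_norm \<Omega> (\<lambda>x. w x - \<phi> x)"
    using vw by (intro l2_norm_AE_cong L2_diff v'(1) test_function_L2 \<phi> \<Omega>') (auto elim: eventually_mono)
  with \<phi> show "\<exists>\<phi>\<in>test_functions \<Omega>. l2_norm \<Omega> (\<lambda>x. w x - \<phi> x) < e \<and>
      l2_norm \<Omega> (\<lambda>x. wgrad \<Omega> v x - grad \<phi> x) < e" by metis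
qed

lemma H10_zero: "open \<Omega> \<Longrightarrow> (\<lambda>x. 0) \<in> H10 \<Omega>"
proof (rule H10I[where G = "\<lambda>x. 0"])
  have "grad (\<lambda>x. 0) x = 0" for x :: 'a
    by (rule grad_eqI) simp
  then show "\<exists>\<phi>\<in>test_functions \<Omega>. l2_norm \<Omega> (\<lambda>x. 0 - \<phi> x) < e \<and> l2_norm \<Omega> (\<lambda>x. 0 - grad \<phi> x) < e"
    if "e > 0" for e
    using that by (intro bexI[of _ "\<lambda>x. 0"])
      (auto simp: test_functions_iff Ck_const l2_norm_def l2_inner_def)
qed (auto simp: L2_def)

lemma H10_sum:
  assumes "open \<Omega>" "finite I" "\<And>i. i \<in> I \<Longrightarrow> f i \<in> H10 \<Omega>"
  shows "(\<lambda>x. \<Sum>i\<in>I. c i * f i x) \<in> H10 \<Omega>"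
  using assms(2,3)
proof (induction I rule: finite_induct)
  case (insert i I)
  then show ?case
    using H10_lincomb[OF assms(1), of "\<lambda>x. \<Sum>i\<in>I. c i * f i x" "f i" "c i"] by (simp add: add.commute)
qed (simp add: H10_zero assms(1))

lemma L2_const:
  assumes "open \<Omega>" "bounded \<Omega>"
  shows "(\<lambda>x. c) \<in> L2 \<Omega>"
proof -
  have "\<Omega> \<in> lmeasurable" using assms by (simp add: lmeasurable_open)
  then interpret finite_measure "lebesgue_on \<Omega>" by (rule finite_measure_lebesgue_on)
  show ?thesis by (simp add: L2_def)
qed

text \<open>
  The mean value of the gradient of a test function vanishes, and on a bounded set the mean value is
  continuous in \<^const>\<open>L2\<close>.
\<close>

lemma H10_wgrad_orthogonal_const:
  assumes \<Omega>: "open \<Omega>" "bounded \<Omega>" and v: "v \<in> H10 \<Omega>"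
  shows "l2_inner \<Omega> (wgrad \<Omega> v) (\<lambda>x. b) = 0"
proof (rule eq_0_if_le_all_multiples)
  have \<Omega>': "\<Omega> \<in> sets lebesgue" using \<Omega> by simp
  note v' = H1_wgrad[OF \<Omega>(1) H10_imp_H1[OF v]] and c = L2_const[OF \<Omega>, of b]
  fix e :: real assume e: "e > 0"
  obtain \<phi> where \<phi>: "\<phi> \<in> test_functions \<Omega>" and le: "l2_norm \<Omega> (\<lambda>x. wgrad \<Omega> v x - grad \<phi> x) < e"
    using H10_approx[OF \<Omega>(1) v e] .
  note \<phi>2 = test_function_L2[OF \<phi> \<Omega>']
  have "l2_inner \<Omega> (grad \<phi>) (\<lambda>x. b) = (\<integral>x. (\<Sum>i\<in>Basis. (b \<bullet> i) * (grad \<phi> x \<bullet> i)) \<partial>lebesgue_on \<Omega>)"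
    unfolding l2_inner_def by (subst euclidean_inner) (simp add: mult.commute)
  also have "\<dots> = (\<Sum>i\<in>Basis. (b \<bullet> i) * (\<integral>x. grad \<phi> x \<bullet> i \<partial>lebesgue_on \<Omega>))"
  proof (subst Bochner_Integration.integral_sum)
    have "integrable (lebesgue_on \<Omega>) (\<lambda>x. grad \<phi> x \<bullet> i)" for i
      using L2_integrable_inner[OF \<phi>2(2) L2_const[OF \<Omega>, of i]] .
    then show "integrable (lebesgue_on \<Omega>) (\<lambda>x. (b \<bullet> i) * (grad \<phi> x \<bullet> i))" for i
      by simp
  qed simp
  also have "\<dots> = 0"
    using integral_grad_test_function[OF \<phi> \<Omega>'] by simp
  finally have "l2_inner \<Omega> (wgrad \<Omega> v) (\<lambda>x. b) = l2_inner \<Omega> (\<lambda>x. wgrad \<Omega> v x - grad \<phi> x) (\<lambda>x. b)"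
    using v' \<phi>2 c by (simp add: l2_inner_diff_left)
  also have "\<bar>\<dots>\<bar> \<le> l2_norm \<Omega> (\<lambda>x. wgrad \<Omega> v x - grad \<phi> x) * l2_norm \<Omega> (\<lambda>x. b)"
    using v' \<phi>2 c by (intro l2_Cauchy_Schwarz L2_diff)
  also have "\<dots> \<le> e * l2_norm \<Omega> (\<lambda>x. b)"
    using le by (intro mult_right_mono) auto
  finally show "\<bar>l2_inner \<Omega> (wgrad \<Omega> v) (\<lambda>x. b)\<bar> \<le> e * l2_norm \<Omega> (\<lambda>x. b)" .
qed

section \<open>Skew symmetry of the convective term\<close>

text \<open>
  For a test function \<open>\<phi>\<close> the convective term is half the integral of \<open>\<beta> \<bullet> grad (\<phi>\<^sup>2)\<close>, and
  \<open>\<phi>\<^sup>2\<close> is a test function, so the derivatives can be moved to the divergence-free field.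
\<close>

lemma convection_test_function:
  assumes \<Omega>: "open \<Omega>" and \<beta>: "\<And>i. i \<in> Basis \<Longrightarrow> has_weak_gradient \<Omega> (\<lambda>y. \<beta> y \<bullet> i) (wgrad \<Omega> (\<lambda>y. \<beta> y \<bullet> i))"
    and div: "AE x in lebesgue_on \<Omega>. weak_div \<Omega> \<beta> x = 0" and \<phi>: "\<phi> \<in> test_functions \<Omega>"
  shows "l2_inner \<Omega> (\<lambda>x. \<beta> x \<bullet> grad \<phi> x) \<phi> = 0"
proof -
  have \<Omega>': "\<Omega> \<in> sets lebesgue" using \<Omega> by simp
  have s: "\<forall>k. Ck k \<phi>" using \<phi> by (simp add: test_functions_iff)
  have \<phi>2: "(\<lambda>x. \<phi> x * \<phi> x) \<in> test_functions \<Omega>" using \<phi> s by (rule test_function_mult)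
  define G where "G i = wgrad \<Omega> (\<lambda>y. \<beta> y \<bullet> i)" for i
  have li: "(\<lambda>y. \<beta> y \<bullet> i) locally_integrable_on \<Omega>" "G i locally_integrable_on \<Omega>" if "i \<in> Basis" for i
    using \<beta>[OF that] by (auto simp: has_weak_gradient_def G_def)
  have int1: "integrable (lebesgue_on \<Omega>) (\<lambda>x. (grad (\<lambda>x. \<phi> x * \<phi> x) x \<bullet> i) * (\<beta> x \<bullet> i))" if "i \<in> Basis" for i
    using integrable_test_function_times(2)[OF li(1)[OF that] \<Omega>' \<phi>2, of i] by simp
  have int2: "integrable (lebesgue_on \<Omega>) (\<lambda>x. \<phi> x * \<phi> x * (G i x \<bullet> i))" if "i \<in> Basis" for i
    using integrable_test_function_times(1)[OF locally_integrable_on_inner[OF li(2)[OF that], of i] \<Omega>' \<phi>2]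
    by simp
  have "2 * l2_inner \<Omega> (\<lambda>x. \<beta> x \<bullet> grad \<phi> x) \<phi> =
      (\<integral>x. 2 * ((\<beta> x \<bullet> grad \<phi> x) * \<phi> x) \<partial>lebesgue_on \<Omega>)"
    by (simp add: l2_inner_def)
  also have "\<dots> = (\<integral>x. (\<Sum>i\<in>Basis. (grad (\<lambda>x. \<phi> x * \<phi> x) x \<bullet> i) * (\<beta> x \<bullet> i)) \<partial>lebesgue_on \<Omega>)"
  proof (intro Bochner_Integration.integral_cong refl)
    fix x
    have "(\<Sum>i\<in>Basis. (grad (\<lambda>x. \<phi> x * \<phi> x) x \<bullet> i) * (\<beta> x \<bullet> i)) = grad (\<lambda>x. \<phi> x * \<phi> x) x \<bullet> \<beta> x"
      by (rule euclidean_inner[symmetric])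
    also have "\<dots> = 2 * ((\<beta> x \<bullet> grad \<phi> x) * \<phi> x)"
      by (simp add: grad_mult[OF s s] inner_add_left inner_add_right inner_commute[of "\<beta> x"])
    finally show "2 * ((\<beta> x \<bullet> grad \<phi> x) * \<phi> x) = (\<Sum>i\<in>Basis. (grad (\<lambda>x. \<phi> x * \<phi> x) x \<bullet> i) * (\<beta> x \<bullet> i))" ..
  qed
  also have "\<dots> = (\<Sum>i\<in>Basis. \<integral>x. (grad (\<lambda>x. \<phi> x * \<phi> x) x \<bullet> i) * (\<beta> x \<bullet> i) \<partial>lebesgue_on \<Omega>)"
    by (rule Bochner_Integration.integral_sum[OF int1])
  also have "\<dots> = (\<Sum>i\<in>Basis. - (\<integral>x. \<phi> x * \<phi> x * (G i x \<bullet> i) \<partial>lebesgue_on \<Omega>))"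
    using \<beta> \<phi>2 by (intro sum.cong refl) (simp add: has_weak_gradient_iff G_def)
  also have "\<dots> = - (\<Sum>i\<in>Basis. \<integral>x. \<phi> x * \<phi> x * (G i x \<bullet> i) \<partial>lebesgue_on \<Omega>)"
    by (rule sum_negf)
  also have "(\<Sum>i\<in>Basis. \<integral>x. \<phi> x * \<phi> x * (G i x \<bullet> i) \<partial>lebesgue_on \<Omega>)
      = (\<integral>x. (\<Sum>i\<in>Basis. \<phi> x * \<phi> x * (G i x \<bullet> i)) \<partial>lebesgue_on \<Omega>)"
    by (rule Bochner_Integration.integral_sum[OF int2, symmetric])
  also have "\<dots> = 0"
  proof (rule integral_eq_zero_AE)
    show "AE x in lebesgue_on \<Omega>. (\<Sum>i\<in>Basis. \<phi> x * \<phi> x * (G i x \<bullet> i)) = 0"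
      using div by eventually_elim (simp add: weak_div_def G_def sum_distrib_left[symmetric])
  qed
  finally show ?thesis by simp
qed

lemma bounded_field_inner_L2:
  assumes \<beta>: "\<beta> \<in> borel_measurable (lebesgue_on S)" "AE x in lebesgue_on S. norm (\<beta> x) \<le> M" "M \<ge> 0"
    and g: "g \<in> L2 S"
  shows "(\<lambda>x. \<beta> x \<bullet> g x) \<in> L2 S" "l2_norm S (\<lambda>x. \<beta> x \<bullet> g x) \<le> M * l2_norm S g"
proof -
  have "(\<lambda>x. \<beta> x \<bullet> g x) \<in> borel_measurable (lebesgue_on S)"
    using \<beta>(1) L2_measurable[OF g] by (rule borel_measurable_inner)
  moreover have "AE x in lebesgue_on S. norm (\<beta> x \<bullet> g x) \<le> M * norm (g x)"
    using \<beta>(2)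
  proof eventually_elim
    case (elim x)
    have "norm (\<beta> x \<bullet> g x) \<le> norm (\<beta> x) * norm (g x)" using Cauchy_Schwarz_ineq2 by auto
    also have "\<dots> \<le> M * norm (g x)" using elim by (rule mult_right_mono) simp
    finally show ?case .
  qed
  ultimately show "(\<lambda>x. \<beta> x \<bullet> g x) \<in> L2 S" "l2_norm S (\<lambda>x. \<beta> x \<bullet> g x) \<le> M * l2_norm S g"
    using l2_norm_mono[OF _ g \<beta>(3)] by blast+
qed

text \<open>
  For bounded \<open>\<beta>\<close> the convective form is continuous with respect to the norm of
  \<^const>\<open>H1\<close>, so the identity for test functions extends to their closure.
\<close>

lemma convection_eq_0:
  assumes \<Omega>: "open \<Omega>" and \<beta>: "\<And>i. i \<in> Basis \<Longrightarrow> has_weak_gradient \<Omega> (\<lambda>y. \<beta> y \<bullet> i) (wgrad \<Omega> (\<lambda>y. \<beta> y \<bullet> i))"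
    and \<beta>': "\<beta> \<in> borel_measurable (lebesgue_on \<Omega>)" "AE x in lebesgue_on \<Omega>. norm (\<beta> x) \<le> M" "M \<ge> 0"
    and div: "AE x in lebesgue_on \<Omega>. weak_div \<Omega> \<beta> x = 0" and v: "v \<in> H10 \<Omega>"
  shows "l2_inner \<Omega> (\<lambda>x. \<beta> x \<bullet> wgrad \<Omega> v x) v = 0"
proof (rule eq_0_if_le_all_multiples)
  have \<Omega>': "\<Omega> \<in> sets lebesgue" using \<Omega> by simp
  note v' = H1_wgrad[OF \<Omega> H10_imp_H1[OF v]] and B = bounded_field_inner_L2[OF \<beta>']
  fix e :: real assume e: "e > 0" "e \<le> 1"
  obtain \<phi> where \<phi>: "\<phi> \<in> test_functions \<Omega>" and le: "l2_norm \<Omega> (\<lambda>x. v x - \<phi> x) < e"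
      "l2_norm \<Omega> (\<lambda>x. wgrad \<Omega> v x - grad \<phi> x) < e"
    using H10_approx[OF \<Omega> v e(1)] .
  note \<phi>2 = test_function_L2[OF \<phi> \<Omega>']
  let ?d = "\<lambda>x. v x - \<phi> x" and ?D = "\<lambda>x. wgrad \<Omega> v x - grad \<phi> x"
  have d: "?d \<in> L2 \<Omega>" "?D \<in> L2 \<Omega>" using v' \<phi>2 by (auto intro: L2_diff)
  have "l2_inner \<Omega> (\<lambda>x. \<beta> x \<bullet> wgrad \<Omega> v x) v - l2_inner \<Omega> (\<lambda>x. \<beta> x \<bullet> grad \<phi> x) \<phi>
      = l2_inner \<Omega> (\<lambda>x. \<beta> x \<bullet> wgrad \<Omega> v x - \<beta> x \<bullet> grad \<phi> x) v
      + l2_inner \<Omega> (\<lambda>x. \<beta> x \<bullet> grad \<phi> x) ?d"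
    using v' \<phi>2 by (simp add: l2_inner_diff_left l2_inner_diff_right B)
  then have "l2_inner \<Omega> (\<lambda>x. \<beta> x \<bullet> wgrad \<Omega> v x) v =
      l2_inner \<Omega> (\<lambda>x. \<beta> x \<bullet> ?D x) v + l2_inner \<Omega> (\<lambda>x. \<beta> x \<bullet> grad \<phi> x) ?d"
    using convection_test_function[OF \<Omega> \<beta> div \<phi>] by (simp add: inner_diff_right)
  then have "\<bar>l2_inner \<Omega> (\<lambda>x. \<beta> x \<bullet> wgrad \<Omega> v x) v\<bar> \<le>
      \<bar>l2_inner \<Omega> (\<lambda>x. \<beta> x \<bullet> ?D x) v\<bar> + \<bar>l2_inner \<Omega> (\<lambda>x. \<beta> x \<bullet> grad \<phi> x) ?d\<bar>"
    using abs_triangle_ineq by metis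
  also have "\<dots> \<le> l2_norm \<Omega> (\<lambda>x. \<beta> x \<bullet> ?D x) * l2_norm \<Omega> v + l2_norm \<Omega> (\<lambda>x. \<beta> x \<bullet> grad \<phi> x) * l2_norm \<Omega> ?d"
    using v' d \<phi>2 by (intro add_mono l2_Cauchy_Schwarz B)
  also have "\<dots> \<le> (M * e) * l2_norm \<Omega> v + (M * (l2_norm \<Omega> (wgrad \<Omega> v) + 1)) * e"
  proof (intro add_mono mult_right_mono mult_mono)
    show "l2_norm \<Omega> (\<lambda>x. \<beta> x \<bullet> ?D x) \<le> M * e"
      using B(2)[OF d(2)] mult_left_mono[OF less_imp_le[OF le(2)] \<beta>'(3)] by linarith
    have "l2_norm \<Omega> (grad \<phi>) \<le> l2_norm \<Omega> (wgrad \<Omega> v) + 1"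
      using l2_norm_diff_le[OF v'(3) \<phi>2(2)] le(2) e(2) by linarith
    then show "l2_norm \<Omega> (\<lambda>x. \<beta> x \<bullet> grad \<phi> x) \<le> M * (l2_norm \<Omega> (wgrad \<Omega> v) + 1)"
      using B(2)[OF \<phi>2(2)] mult_left_mono[OF _ \<beta>'(3)] by (metis order_trans)
  qed (use le \<beta>'(3) in \<open>auto intro!: mult_nonneg_nonneg add_nonneg_nonneg\<close>)
  finally show "\<bar>l2_inner \<Omega> (\<lambda>x. \<beta> x \<bullet> wgrad \<Omega> v x) v\<bar>
      \<le> e * (M * l2_norm \<Omega> v + M * (l2_norm \<Omega> (wgrad \<Omega> v) + 1))"
    by (simp add: algebra_simps)
qed

section \<open>Bounded pointwise limits of test functions\<close>

text \<open>
  On a bounded set, dominated convergence turns a bounded pointwise limit into a limit in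
  \<^const>\<open>L2\<close>.
\<close>

lemma l2_norm_bounded_limit:
  fixes f :: "nat \<Rightarrow> 'a::euclidean_space \<Rightarrow> 'b::euclidean_space"
  assumes \<Omega>: "open \<Omega>" "bounded \<Omega>" and f: "\<And>n. f n \<in> L2 \<Omega>"
    and lim: "\<And>x. x \<in> \<Omega> \<Longrightarrow> (\<lambda>n. f n x) \<longlonglongrightarrow> g x" and bd: "\<And>n x. x \<in> \<Omega> \<Longrightarrow> norm (f n x) \<le> M"
  shows "g \<in> L2 \<Omega>" "(\<lambda>n. l2_norm \<Omega> (\<lambda>x. g x - f n x)) \<longlonglongrightarrow> 0"
proof -
  have m: "g \<in> borel_measurable (lebesgue_on \<Omega>)"
    by (rule borel_measurable_LIMSEQ_metric[OF L2_measurable[OF f]]) (use lim in auto)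
  have bdg: "norm (g x) \<le> M" if "x \<in> \<Omega>" for x
    using LIMSEQ_le_const2[OF tendsto_norm[OF lim[OF that]]] bd[OF that] by blast
  have c: "integrable (lebesgue_on \<Omega>) (\<lambda>x. c)" for c :: real
    using L2_integrable_inner[OF L2_const[OF \<Omega>, of c] L2_const[OF \<Omega>, of "1::real"]] by simp
  show g: "g \<in> L2 \<Omega>"
    by (rule L2_bound[OF m c[of "M\<^sup>2"]]) (use bdg in \<open>auto intro!: power_mono\<close>)
  note d = L2_diff[OF g f]
  have "(\<lambda>n. \<integral>x. (norm (g x - f n x))\<^sup>2 \<partial>lebesgue_on \<Omega>) \<longlonglongrightarrow> (\<integral>x. 0 \<partial>lebesgue_on \<Omega>)"
  proof (rule integral_dominated_convergence[OF _ _ c[of "(2 * M)\<^sup>2"]])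
    show "(\<lambda>x. (norm (g x - f n x))\<^sup>2) \<in> borel_measurable (lebesgue_on \<Omega>)" for n
      using d[of n] by (auto simp: L2_def)
    show "AE x in lebesgue_on \<Omega>. (\<lambda>n. (norm (g x - f n x))\<^sup>2) \<longlonglongrightarrow> 0"
    proof (rule AE_I2)
      fix x assume "x \<in> space (lebesgue_on \<Omega>)"
      then have "(\<lambda>n. (norm (g x - f n x))\<^sup>2) \<longlonglongrightarrow> (norm (g x - g x))\<^sup>2"
        using lim[of x] by (intro tendsto_intros) auto
      then show "(\<lambda>n. (norm (g x - f n x))\<^sup>2) \<longlonglongrightarrow> 0" by simp
    qed
    show "AE x in lebesgue_on \<Omega>. norm ((norm (g x - f n x))\<^sup>2) \<le> (2 * M)\<^sup>2" for n
    proof (rule AE_I2)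
      fix x assume "x \<in> space (lebesgue_on \<Omega>)"
      then have "norm (g x - f n x) \<le> 2 * M"
        using norm_triangle_ineq4[of "g x" "f n x"] bd[of x n] bdg[of x] by auto
      then have "(norm (g x - f n x))\<^sup>2 \<le> (2 * M)\<^sup>2" by (rule power_mono) simp
      then show "norm ((norm (g x - f n x))\<^sup>2) \<le> (2 * M)\<^sup>2" by simp
    qed
  qed simp
  then have "(\<lambda>n. sqrt (\<integral>x. (norm (g x - f n x))\<^sup>2 \<partial>lebesgue_on \<Omega>)) \<longlonglongrightarrow> sqrt 0"
    by (intro tendsto_real_sqrt) simp
  then show "(\<lambda>n. l2_norm \<Omega> (\<lambda>x. g x - f n x)) \<longlonglongrightarrow> 0"
    by (simp add: l2_norm_def l2_inner_def power2_norm_eq_inner)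
qed

lemma H10_bounded_limit:
  assumes \<Omega>: "open \<Omega>" "bounded \<Omega>" and \<phi>: "\<And>n. \<phi> n \<in> test_functions \<Omega>"
    and lim: "\<And>x. x \<in> \<Omega> \<Longrightarrow> (\<lambda>n. \<phi> n x) \<longlonglongrightarrow> v x" "\<And>x. x \<in> \<Omega> \<Longrightarrow> (\<lambda>n. grad (\<phi> n) x) \<longlonglongrightarrow> G x"
    and bd: "\<And>n x. x \<in> \<Omega> \<Longrightarrow> \<bar>\<phi> n x\<bar> \<le> M" "\<And>n x. x \<in> \<Omega> \<Longrightarrow> norm (grad (\<phi> n) x) \<le> M'"
  shows "v \<in> H10 \<Omega>" "has_weak_gradient \<Omega> v G"
proof -
  have \<Omega>': "\<Omega> \<in> sets lebesgue" using \<Omega> by simp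
  note v = l2_norm_bounded_limit[OF \<Omega> test_function_L2(1)[OF \<phi> \<Omega>'] lim(1), of M]
  note G = l2_norm_bounded_limit[OF \<Omega> test_function_L2(2)[OF \<phi> \<Omega>'] lim(2) bd(2)]
  have v1: "v \<in> L2 \<Omega>" and v2: "(\<lambda>n. l2_norm \<Omega> (\<lambda>x. v x - \<phi> n x)) \<longlonglongrightarrow> 0"
    using v bd(1) by auto
  have approx: "\<exists>\<psi>\<in>test_functions \<Omega>. l2_norm \<Omega> (\<lambda>x. v x - \<psi> x) < e \<and> l2_norm \<Omega> (\<lambda>x. G x - grad \<psi> x) < e"
    if e: "e > 0" for e
  proof -
    have "\<forall>\<^sub>F n in sequentially. l2_norm \<Omega> (\<lambda>x. v x - \<phi> n x) < e \<and> l2_norm \<Omega> (\<lambda>x. G x - grad (\<phi> n) x) < e"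
      using order_tendstoD(2)[OF v2 e] order_tendstoD(2)[OF G(2) e] by (rule eventually_conj)
    then obtain n where "l2_norm \<Omega> (\<lambda>x. v x - \<phi> n x) < e" "l2_norm \<Omega> (\<lambda>x. G x - grad (\<phi> n) x) < e"
      using eventually_happens'[OF sequentially_bot] by blast
    then show ?thesis using \<phi>[of n] by blast
  qed
  show "v \<in> H10 \<Omega>" by (rule H10I[OF \<Omega>(1) v1 G(1) approx])
  show "has_weak_gradient \<Omega> v G" by (rule has_weak_gradient_L2_limit[OF \<Omega>' v1 G(1) approx])
qed

section \<open>Bubble functions\<close>

lemma affine_sum_combination:
  fixes b :: "'a::euclidean_space"
  assumes "sum u C = 1"
  shows "a + b \<bullet> (\<Sum>q\<in>C. u q *\<^sub>R q) = (\<Sum>q\<in>C. u q * (a + b \<bullet> q))"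
proof -
  have "(\<Sum>q\<in>C. u q * (a + b \<bullet> q)) = (\<Sum>q\<in>C. u q) * a + (\<Sum>q\<in>C. u q * (b \<bullet> q))"
    by (simp add: distrib_left sum.distrib sum_distrib_right)
  then show ?thesis using assms by (simp add: inner_sum_right)
qed

text \<open>
  Each barycentric coordinate is an affine function that vanishes on the hyperplane spanned by the
  opposite face and is normalised at the remaining vertex.
\<close>

lemma barycentric_functions:
  fixes C :: "'a::euclidean_space set"
  assumes C: "\<not> affine_dependent C" "int (card C) = int DIM('a) + 1"
  obtains a :: "'a \<Rightarrow> real" and b :: "'a \<Rightarrow> 'a"
  where "\<And>x u p. sum u C = 1 \<Longrightarrow> (\<Sum>q\<in>C. u q *\<^sub>R q) = x \<Longrightarrow> p \<in> C \<Longrightarrow> a p + b p \<bullet> x = u p"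
    and "\<And>x. (\<Sum>p\<in>C. a p + b p \<bullet> x) = 1" "\<And>x. (\<Sum>p\<in>C. (a p + b p \<bullet> x) *\<^sub>R p) = x"
proof -
  have fin: "finite C" using C(1) by (rule aff_independent_finite)
  have dim: "aff_dim C = int DIM('a)"
    using aff_dim_affine_independent[OF C(1)] C(2) by simp
  have "\<exists>ab. \<forall>q\<in>C. fst ab + snd ab \<bullet> q = (if q = p then 1 else (0::real))" if p: "p \<in> C" for p
  proof -
    have "aff_dim (C - {p}) \<le> int (card (C - {p})) - 1"
      using fin by (intro aff_dim_le_card) auto
    then have "aff_dim (C - {p}) < int DIM('a)"
      using C(2) p fin card_gt_0_iff[of C] by (auto simp: card_Diff_singleton of_nat_diff)
    then obtain c d where c: "c \<noteq> 0" "C - {p} \<subseteq> {x. c \<bullet> x = d}"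
      using aff_lowdim_subset_hyperplane by metis
    have np: "c \<bullet> p \<noteq> d"
    proof
      assume "c \<bullet> p = d"
      then have "C \<subseteq> {x. c \<bullet> x = d}" using c(2) by auto
      then have "aff_dim C \<le> aff_dim {x. c \<bullet> x = d}" by (rule aff_dim_subset)
      then show False using dim c(1) by simp
    qed
    have "- d / (c \<bullet> p - d) + (c /\<^sub>R (c \<bullet> p - d)) \<bullet> q = (if q = p then 1 else 0)" if "q \<in> C" for q
    proof -
      have "c \<bullet> q = d" if "q \<noteq> p" using that \<open>q \<in> C\<close> c(2) by auto
      moreover have "- d / (c \<bullet> p - d) + (c /\<^sub>R (c \<bullet> p - d)) \<bullet> q = (c \<bullet> q - d) / (c \<bullet> p - d)"
        by (simp add: divide_inverse algebra_simps)
      ultimately show ?thesis using np by auto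
    qed
    then show ?thesis by (intro exI[of _ "(- d / (c \<bullet> p - d), c /\<^sub>R (c \<bullet> p - d))"]) simp
  qed
  then obtain ab where ab: "\<And>p q. p \<in> C \<Longrightarrow> q \<in> C \<Longrightarrow> fst (ab p) + snd (ab p) \<bullet> q = (if q = p then 1 else (0::real))"
    by metis
  define a where "a p = fst (ab p)" for p
  define b where "b p = snd (ab p)" for p
  have uniq: "a p + b p \<bullet> x = u p" if "sum u C = 1" "(\<Sum>q\<in>C. u q *\<^sub>R q) = x" "p \<in> C" for x u p
  proof -
    have "a p + b p \<bullet> x = (\<Sum>q\<in>C. u q * (a p + b p \<bullet> q))"
      using affine_sum_combination[OF that(1)] that(2) by metis
    also have "\<dots> = (\<Sum>q\<in>C. if q = p then u q else 0)"
      using ab[OF that(3)] by (intro sum.cong refl) (auto simp: a_def b_def)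
    also have "\<dots> = u p" using fin that(3) by simp
    finally show ?thesis .
  qed
  have "(\<Sum>p\<in>C. a p + b p \<bullet> x) = 1 \<and> (\<Sum>p\<in>C. (a p + b p \<bullet> x) *\<^sub>R p) = x" for x
  proof -
    have "x \<in> affine hull C" using dim aff_dim_eq_full by blast
    then obtain u where u: "sum u C = 1" "(\<Sum>q\<in>C. u q *\<^sub>R q) = x"
      unfolding affine_hull_finite[OF fin] by blast
    have "(\<Sum>p\<in>C. a p + b p \<bullet> x) = sum u C"
      using uniq[OF u] by (intro sum.cong refl)
    moreover have "(\<Sum>p\<in>C. (a p + b p \<bullet> x) *\<^sub>R p) = (\<Sum>p\<in>C. u p *\<^sub>R p)"
      using uniq[OF u] by (intro sum.cong refl) simp
    ultimately show ?thesis using u by simp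
  qed
  then show thesis using that[of a b] uniq by blast
qed

text \<open>
  A negative barycentric coordinate marks the points outside the simplex, so cutting off the
  coordinates at zero makes the product vanish there, as the extension by zero requires.
\<close>

lemma bubble_eq_prod:
  fixes T :: "'a::euclidean_space set"
  assumes T: "int DIM('a) simplex T"
  obtains C :: "'a set" and a :: "'a \<Rightarrow> real" and b :: "'a \<Rightarrow> 'a"
  where "finite C" "T = {x. \<forall>p\<in>C. 0 \<le> a p + b p \<bullet> x}"
    and "bubble T = (\<lambda>x. \<Prod>p\<in>C. max 0 (a p + b p \<bullet> x))"
proof -
  obtain C where C: "\<not> affine_dependent C" "int (card C) = int DIM('a) + 1" "T = convex hull C"
    using T by (auto simp: simplex_def)
  have fin: "finite C" using C(1) by (rule aff_independent_finite)
  obtain a b where ab: "\<And>x u p. sum u C = 1 \<Longrightarrow> (\<Sum>q\<in>C. u q *\<^sub>R q) = x \<Longrightarrow> p \<in> C \<Longrightarrow> a p + b p \<bullet> x = u p"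
      "\<And>x. (\<Sum>p\<in>C. a p + b p \<bullet> x) = 1" "\<And>x. (\<Sum>p\<in>C. (a p + b p \<bullet> x) *\<^sub>R p) = x"
    using barycentric_functions[OF C(1,2)] by blast
  have T_iff: "x \<in> T \<longleftrightarrow> (\<forall>p\<in>C. 0 \<le> a p + b p \<bullet> x)" for x
  proof
    assume "x \<in> T"
    then obtain u where u: "\<forall>p\<in>C. 0 \<le> u p" "sum u C = 1" "(\<Sum>q\<in>C. u q *\<^sub>R q) = x"
      unfolding C(3) convex_hull_finite[OF fin] by blast
    then show "\<forall>p\<in>C. 0 \<le> a p + b p \<bullet> x" using ab(1)[OF u(2,3)] by simp
  next
    assume "\<forall>p\<in>C. 0 \<le> a p + b p \<bullet> x"
    then show "x \<in> T"
      unfolding C(3) convex_hull_finite[OF fin] using ab(2,3)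
      by (intro CollectI exI[of _ "\<lambda>p. a p + b p \<bullet> x"]) auto
  qed
  have ext: "{p. p extreme_point_of T} = C"
    using extreme_point_of_convex_hull_affine_independent[OF C(1)] C(3) by auto
  have bary: "barycentric T x = (\<lambda>p. if p \<in> C then a p + b p \<bullet> x else 0)" for x
    unfolding barycentric_def ext
  proof (rule the_equality)
    show "(\<forall>p. \<not> p extreme_point_of T \<longrightarrow> (if p \<in> C then a p + b p \<bullet> x else 0) = 0) \<and>
        (\<Sum>p\<in>C. if p \<in> C then a p + b p \<bullet> x else 0) = 1 \<and>
        (\<Sum>p\<in>C. (if p \<in> C then a p + b p \<bullet> x else 0) *\<^sub>R p) = x"
      using ab(2,3) ext by (auto cong: sum.cong)
    fix l assume l: "(\<forall>p. \<not> p extreme_point_of T \<longrightarrow> l p = 0) \<and> sum l C = 1 \<and> (\<Sum>p\<in>C. l p *\<^sub>R p) = x"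
    then have "a p + b p \<bullet> x = l p" if "p \<in> C" for p using ab(1)[of l x p] that by blast
    then show "l = (\<lambda>p. if p \<in> C then a p + b p \<bullet> x else 0)" using l ext by auto
  qed
  have "bubble T x = (\<Prod>p\<in>C. max 0 (a p + b p \<bullet> x))" for x
  proof (cases "x \<in> T")
    case True
    then have "(\<Prod>p\<in>C. barycentric T x p) = (\<Prod>p\<in>C. max 0 (a p + b p \<bullet> x))"
      unfolding bary T_iff by (intro prod.cong refl) auto
    then show ?thesis using True by (simp add: bubble_def ext)
  next
    case False
    then obtain p where p: "p \<in> C" "a p + b p \<bullet> x < 0" by (auto simp: T_iff not_le)
    have "(\<Prod>p\<in>C. max 0 (a p + b p \<bullet> x)) = 0"
      using fin p by (intro prod_zero bexI[of _ p]) auto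
    then show ?thesis using False by (simp add: bubble_def)
  qed
  then have "bubble T = (\<lambda>x. \<Prod>p\<in>C. max 0 (a p + b p \<bullet> x))" by auto
  then show thesis using that[OF fin, of a b] T_iff by blast
qed

text \<open>
  A smooth substitute for the positive part: it vanishes for \<open>t \<le> 1 / (n + 1)\<close>, so that products of
  it in the barycentric coordinates are compactly supported in the interior of the simplex, and its
  slope stays between 0 and 1, which is what dominated convergence needs.
\<close>

definition clip :: "nat \<Rightarrow> real \<Rightarrow> real" where
  "clip n t = (real (Suc n) * t - 1) * flat 0 (real (Suc n) * t - 1) / real (Suc n)"

definition clip_deriv :: "nat \<Rightarrow> real \<Rightarrow> real" where
  "clip_deriv n t = flat 0 (real (Suc n) * t - 1) + flat 1 (real (Suc n) * t - 1)"

lemma clip_has_derivative: "(clip n has_field_derivative clip_deriv n t) (at t)"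
proof -
  have s: "s * flat 2 s = flat 1 s" for s
    by (simp add: flat_def power2_eq_square)
  have "((\<lambda>s. s * flat 0 s) has_field_derivative (flat 0 s + flat 1 s)) (at s)" for s
    using DERIV_mult'[OF DERIV_ident flat_deriv[of 0 s]] s[of s] by (simp add: add.commute numeral_2_eq_2)
  then have "((\<lambda>t. (\<lambda>s. s * flat 0 s) (real (Suc n) * t - 1)) has_field_derivative
      (flat 0 (real (Suc n) * t - 1) + flat 1 (real (Suc n) * t - 1)) * real (Suc n)) (at t)"
    by (rule DERIV_chain2) (auto intro!: derivative_eq_intros)
  from DERIV_cdivide[OF this, of "real (Suc n)"] show ?thesis
    by (simp add: clip_def[abs_def] clip_deriv_def del: of_nat_Suc)
qed

lemma clip_nonneg: "0 \<le> clip n t"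
  by (cases "real (Suc n) * t - 1 \<le> 0") (auto simp: clip_def flat_nonneg)

lemma clip_le: "clip n t \<le> max 0 t"
proof (cases "real (Suc n) * t - 1 \<le> 0")
  case True
  then show ?thesis by (simp add: clip_def)
next
  case False
  then have "(real (Suc n) * t - 1) * flat 0 (real (Suc n) * t - 1) \<le> (real (Suc n) * t - 1) * 1"
    using flat_0_le_1 by (intro mult_left_mono) auto
  also have "\<dots> \<le> real (Suc n) * t" by simp
  finally have "clip n t \<le> t" by (simp add: clip_def divide_le_eq mult.commute)
  then show ?thesis by simp
qed

lemma clip_pos_imp: "clip n t \<noteq> 0 \<Longrightarrow> 1 / real (Suc n) \<le> t"
  by (cases "real (Suc n) * t - 1 \<le> 0") (auto simp: clip_def field_simps)

lemma clip_deriv_bounds: "0 \<le> clip_deriv n t" "clip_deriv n t \<le> 1"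
proof -
  show "0 \<le> clip_deriv n t" by (simp add: clip_deriv_def flat_nonneg)
  have "flat 0 s + flat 1 s \<le> 1" for s
  proof (cases "s > 0")
    case True
    have "(1 + inverse s) * exp (- inverse s) \<le> exp (inverse s) * exp (- inverse s)"
      by (intro mult_right_mono exp_ge_add_one_self) simp
    then show ?thesis using True by (simp add: flat_def algebra_simps exp_minus_inverse)
  qed simp
  then show "clip_deriv n t \<le> 1" by (simp add: clip_deriv_def)
qed

lemma flat_at_top: "(flat 0 \<longlongrightarrow> 1) at_top" "(flat 1 \<longlongrightarrow> 0) at_top"
proof -
  have ev: "\<forall>\<^sub>F t in at_top. exp (- inverse t) * inverse t ^ m = flat m t" for m
    using eventually_gt_at_top[of 0] by eventually_elim (simp add: flat_def)
  have lim: "((\<lambda>t::real. exp (- inverse t) * inverse t ^ 0) \<longlongrightarrow> 1) at_top"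
      "((\<lambda>t::real. exp (- inverse t) * inverse t ^ 1) \<longlongrightarrow> 0) at_top"
    by real_asymp+
  show "(flat 0 \<longlongrightarrow> 1) at_top" "(flat 1 \<longlongrightarrow> 0) at_top"
    by (rule Lim_transform_eventually[OF lim(1) ev], rule Lim_transform_eventually[OF lim(2) ev])
qed

lemma clip_tendsto: "(\<lambda>n. clip n t) \<longlonglongrightarrow> max 0 t"
  and clip_deriv_tendsto: "(\<lambda>n. clip_deriv n t) \<longlonglongrightarrow> (if t > 0 then 1 else 0)"
proof -
  have "(\<lambda>n. clip n t) \<longlonglongrightarrow> max 0 t \<and> (\<lambda>n. clip_deriv n t) \<longlonglongrightarrow> (if t > 0 then 1 else 0)"
  proof (cases "t > 0")
    case True
    have "filterlim (\<lambda>n. real (Suc n) * t - 1) at_top sequentially"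
      using True by real_asymp
    note fl = flat_at_top[THEN filterlim_compose, OF this]
    have "(\<lambda>n. (t - 1 / real (Suc n)) * flat 0 (real (Suc n) * t - 1)) \<longlonglongrightarrow> t * 1"
    proof (rule tendsto_mult[OF _ fl(1)])
      show "(\<lambda>n. t - 1 / real (Suc n)) \<longlonglongrightarrow> t" by real_asymp
    qed
    moreover have "(t - 1 / real (Suc n)) * flat 0 (real (Suc n) * t - 1) = clip n t" for n
      by (simp add: clip_def field_simps del: of_nat_Suc)
    moreover have "(\<lambda>n. clip_deriv n t) \<longlonglongrightarrow> 1 + 0"
      unfolding clip_deriv_def by (intro tendsto_add fl)
    ultimately show ?thesis using True by simp
  next
    case False
    then have "real (Suc n) * t - 1 \<le> 0" for n
      using mult_nonneg_nonpos[of "real (Suc n)" t] by linarith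
    then have "clip n t = 0" "clip_deriv n t = 0" for n
      by (simp_all add: clip_def clip_deriv_def del: of_nat_Suc)
    then show ?thesis using False by simp
  qed
  then show "(\<lambda>n. clip n t) \<longlonglongrightarrow> max 0 t" "(\<lambda>n. clip_deriv n t) \<longlonglongrightarrow> (if t > 0 then 1 else 0)"
    by auto
qed

lemma Ck_clip_affine: "Ck k (\<lambda>x. clip n (a + b \<bullet> x))"
proof -
  have "clip n (a + b \<bullet> x) = (((real (Suc n) * a - 1) + (real (Suc n) *\<^sub>R b) \<bullet> x) *
      flat 0 ((real (Suc n) * a - 1) + (real (Suc n) *\<^sub>R b) \<bullet> x)) * inverse (real (Suc n))" for x
    by (simp add: clip_def divide_inverse distrib_left add_diff_eq diff_add_eq del: of_nat_Suc)
  then show ?thesis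
    by (simp only:) (intro Ck_mult Ck_affine Ck_flat_affine Ck_const)
qed

lemma grad_prod_clip:
  assumes "finite C"
  shows "grad (\<lambda>x. \<Prod>p\<in>C. clip n (a p + b p \<bullet> x)) x =
    (\<Sum>p\<in>C. (clip_deriv n (a p + b p \<bullet> x) * (\<Prod>q\<in>C - {p}. clip n (a q + b q \<bullet> x))) *\<^sub>R b p)"
proof (rule grad_eqI)
  have "((\<lambda>x. clip n (a p + b p \<bullet> x)) has_derivative
      (\<lambda>h. clip_deriv n (a p + b p \<bullet> x) * (b p \<bullet> h))) (at x)" for p
    by (rule has_derivative_compose[OF _ clip_has_derivative[unfolded has_field_derivative_def],
          THEN has_derivative_eq_rhs])
      (auto intro!: derivative_eq_intros)
  then have "((\<lambda>x. \<Prod>p\<in>C. clip n (a p + b p \<bullet> x)) has_derivative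
      (\<lambda>h. \<Sum>p\<in>C. clip_deriv n (a p + b p \<bullet> x) * (b p \<bullet> h) *
        (\<Prod>q\<in>C - {p}. clip n (a q + b q \<bullet> x)))) (at x)"
    by (rule has_derivative_prod)
  then show "((\<lambda>x. \<Prod>p\<in>C. clip n (a p + b p \<bullet> x)) has_derivative
      (\<lambda>h. (\<Sum>p\<in>C. (clip_deriv n (a p + b p \<bullet> x) * (\<Prod>q\<in>C - {p}. clip n (a q + b q \<bullet> x))) *\<^sub>R b p) \<bullet> h)) (at x)"
    by (rule has_derivative_eq_rhs) (simp add: inner_sum_left ac_simps)
qed

text \<open>
  The products of \<^const>\<open>clip\<close> in the barycentric coordinates are test functions that converge,
  with their gradients, pointwise and boundedly. In every term of the limit gradient a negative
  coordinate produces a factor zero, either as a positive part or as its slope.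
\<close>

lemma bubble_H10:
  fixes T :: "'a::euclidean_space set"
  assumes \<Omega>: "open \<Omega>" "bounded \<Omega>" and T: "int DIM('a) simplex T" "interior T \<subseteq> \<Omega>"
  shows "bubble T \<in> H10 \<Omega>"
    and "AE x in lebesgue_on \<Omega>. x \<notin> T \<longrightarrow> wgrad \<Omega> (bubble T) x = 0"
proof -
  obtain C :: "'a set" and a b where fin: "finite C" and T_eq: "T = {x. \<forall>p\<in>C. 0 \<le> a p + b p \<bullet> x}"
    and bub: "bubble T = (\<lambda>x. \<Prod>p\<in>C. max 0 (a p + b p \<bullet> x))"
    using bubble_eq_prod[OF T(1)] .
  define l where "l p x = a p + b p \<bullet> x" for p x
  define \<phi> where "\<phi> n x = (\<Prod>p\<in>C. clip n (l p x))" for n x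
  define G where "G x = (\<Sum>p\<in>C. ((if l p x > 0 then 1 else 0) * (\<Prod>q\<in>C - {p}. max 0 (l q x))) *\<^sub>R b p)" for x
  have cont: "continuous_on UNIV (l p)" for p
    unfolding l_def[abs_def] by (intro continuous_intros)
  have test: "\<phi> n \<in> test_functions \<Omega>" for n
    unfolding test_functions_iff
  proof (intro conjI allI exI)
    show "Ck k (\<phi> n)" for k
      unfolding \<phi>_def[abs_def] l_def by (intro Ck_prod fin Ck_clip_affine)
    let ?K = "T \<inter> (\<Inter>p\<in>C. {x. 1 / real (Suc n) \<le> l p x})"
    have "closed (\<Inter>p\<in>C. {x. 1 / real (Suc n) \<le> l p x})"
      by (intro closed_INT ballI closed_Collect_le continuous_on_const cont)
    then show "compact ?K"
      using compact_simplex[OF T(1)] by (rule compact_Int_closed[rotated])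
    have "open (\<Inter>p\<in>C. {x. 0 < l p x})"
      by (intro open_INT fin ballI open_Collect_less continuous_on_const cont)
    moreover have "(\<Inter>p\<in>C. {x. 0 < l p x}) \<subseteq> T" by (auto simp: T_eq l_def less_imp_le)
    ultimately have "(\<Inter>p\<in>C. {x. 0 < l p x}) \<subseteq> interior T" by (rule interior_maximal[rotated])
    moreover have "0 < l p x" if "1 / real (Suc n) \<le> l p x" for p x
      using that by (rule less_le_trans[rotated]) simp
    ultimately show "?K \<subseteq> \<Omega>" using T(2) by blast
    show "x \<notin> ?K \<longrightarrow> \<phi> n x = 0" for x
    proof
      assume "x \<notin> ?K"
      then obtain p where p: "p \<in> C" "l p x < 0 \<or> \<not> 1 / real (Suc n) \<le> l p x"
        by (auto simp: T_eq l_def not_le)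
      moreover have "0 \<le> 1 / real (Suc n)" by simp
      ultimately have "\<not> 1 / real (Suc n) \<le> l p x" by linarith
      then have "clip n (l p x) = 0" using clip_pos_imp by blast
      then show "\<phi> n x = 0" unfolding \<phi>_def using fin p by (intro prod_zero) auto
    qed
  qed
  obtain R where R: "\<And>x. x \<in> \<Omega> \<Longrightarrow> norm x \<le> R" using \<Omega>(2) bounded_iff by metis
  \<comment> \<open>a bound for the positive part of the barycentric coordinates on \<open>\<Omega>\<close>\<close>
  define L where "L p = \<bar>a p\<bar> + norm (b p) * \<bar>R\<bar>" for p
  have l_le: "max 0 (l p x) \<le> L p" if "x \<in> \<Omega>" for p x
  proof -
    have "\<bar>b p \<bullet> x\<bar> \<le> norm (b p) * norm x" by (rule Cauchy_Schwarz_ineq2)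
    also have "\<dots> \<le> norm (b p) * \<bar>R\<bar>" using R[OF that] by (intro mult_left_mono) auto
    finally show ?thesis by (auto simp: L_def l_def)
  qed
  have prod_le: "(\<Prod>q\<in>D. clip n (l q x)) \<le> (\<Prod>q\<in>D. L q)" if "x \<in> \<Omega>" for D n x
    by (intro prod_mono conjI clip_nonneg order_trans[OF clip_le l_le[OF that]])
  have prod_nonneg: "0 \<le> (\<Prod>q\<in>D. clip n (l q x))" for D n x
    by (intro prod_nonneg clip_nonneg)
  have grad: "grad (\<phi> n) x = (\<Sum>p\<in>C. (clip_deriv n (l p x) * (\<Prod>q\<in>C - {p}. clip n (l q x))) *\<^sub>R b p)" for n x
    unfolding \<phi>_def[abs_def] l_def by (rule grad_prod_clip[OF fin])
  have "bubble T \<in> H10 \<Omega> \<and> has_weak_gradient \<Omega> (bubble T) G"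
  proof (intro conjI H10_bounded_limit[OF \<Omega> test])
    show "(\<lambda>n. \<phi> n x) \<longlonglongrightarrow> bubble T x" "(\<lambda>n. \<phi> n x) \<longlonglongrightarrow> bubble T x" for x
      unfolding bub \<phi>_def l_def by (intro tendsto_prod clip_tendsto)+
    show "(\<lambda>n. grad (\<phi> n) x) \<longlonglongrightarrow> G x" "(\<lambda>n. grad (\<phi> n) x) \<longlonglongrightarrow> G x" for x
      unfolding grad G_def
      by (intro tendsto_sum tendsto_scaleR tendsto_mult tendsto_prod tendsto_const
          clip_tendsto clip_deriv_tendsto)+
    show "\<bar>\<phi> n x\<bar> \<le> (\<Prod>p\<in>C. L p)" "\<bar>\<phi> n x\<bar> \<le> (\<Prod>p\<in>C. L p)" if "x \<in> \<Omega>" for n x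
      using prod_le[OF that] prod_nonneg by (simp_all add: \<phi>_def abs_of_nonneg)
    show "norm (grad (\<phi> n) x) \<le> (\<Sum>p\<in>C. (1 * (\<Prod>q\<in>C - {p}. L q)) * norm (b p))"
      "norm (grad (\<phi> n) x) \<le> (\<Sum>p\<in>C. (1 * (\<Prod>q\<in>C - {p}. L q)) * norm (b p))" if "x \<in> \<Omega>" for n x
    proof -
      have "norm ((clip_deriv n (l p x) * (\<Prod>q\<in>C - {p}. clip n (l q x))) *\<^sub>R b p)
          \<le> (1 * (\<Prod>q\<in>C - {p}. L q)) * norm (b p)" for p
        unfolding norm_scaleR abs_mult
        using prod_le[OF that] prod_nonneg clip_deriv_bounds
        by (intro mult_right_mono mult_mono) (auto simp: abs_of_nonneg)
      then show "norm (grad (\<phi> n) x) \<le> (\<Sum>p\<in>C. (1 * (\<Prod>q\<in>C - {p}. L q)) * norm (b p))"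
        unfolding grad by (intro sum_norm_le)
      then show "norm (grad (\<phi> n) x) \<le> (\<Sum>p\<in>C. (1 * (\<Prod>q\<in>C - {p}. L q)) * norm (b p))" .
    qed
  qed
  then have bub': "bubble T \<in> H10 \<Omega>" "has_weak_gradient \<Omega> (bubble T) G" by auto
  show "bubble T \<in> H10 \<Omega>" by fact
  have G0: "G x = 0" if xT: "x \<notin> T" for x
  proof -
    obtain r where r: "r \<in> C" "l r x < 0" using xT by (auto simp: T_eq l_def not_le)
    have "(if l p x > 0 then 1 else 0) * (\<Prod>q\<in>C - {p}. max 0 (l q x)) = 0" if "p \<in> C" for p
    proof (cases "p = r")
      case False
      then have "(\<Prod>q\<in>C - {p}. max 0 (l q x)) = 0"
        using fin r by (intro prod_zero bexI[of _ r]) auto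
      then show ?thesis by simp
    qed (use r in simp)
    then show ?thesis unfolding G_def by (intro sum.neutral) auto
  qed
  have "AE x in lebesgue_on \<Omega>. wgrad \<Omega> (bubble T) x = G x"
    by (rule wgrad_AE_eq[OF \<Omega>(1) bub'(2)])
  then show "AE x in lebesgue_on \<Omega>. x \<notin> T \<longrightarrow> wgrad \<Omega> (bubble T) x = 0"
    by eventually_elim (use G0 in auto)
qed

section \<open>Meshes\<close>

text \<open>
  At a boundary point \<open>p\<close> with graph direction \<open>e\<close>, the points \<open>p - t e\<close> lie strictly below the
  graph, hence outside the closure of \<open>\<Omega>\<close>: a Lipschitz domain has no slits.
\<close>

lemma interior_closure_lipschitz_domain:
  assumes \<Omega>: "open \<Omega>" and lip: "lipschitz_boundary \<Omega>"
  shows "interior (closure \<Omega>) \<subseteq> \<Omega>"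
proof
  fix p assume p: "p \<in> interior (closure \<Omega>)"
  show "p \<in> \<Omega>"
  proof (rule ccontr)
    assume np: "p \<notin> \<Omega>"
    then have "p \<in> frontier \<Omega>"
      using p interior_subset[of "closure \<Omega>"] \<Omega> by (auto simp: frontier_def interior_open)
    then obtain e r L and g :: "'a \<Rightarrow> real" where e: "norm e = 1" and r: "r > 0"
      and g: "L-lipschitz_on UNIV g"
      and iff: "\<And>x. x \<in> ball p r \<Longrightarrow> x \<in> \<Omega> \<longleftrightarrow> g (x - (x \<bullet> e) *\<^sub>R e) < x \<bullet> e"
      using lip unfolding lipschitz_boundary_def by blast
    obtain s where s: "s > 0" "ball p s \<subseteq> closure \<Omega>"
      using p mem_interior by blast
    define t where "t = min r s / 2"
    have t: "t > 0" "t < r" "t < s" using r s by (auto simp: t_def min_def)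
    define y where "y = p - t *\<^sub>R e"
    have y: "y \<in> ball p r" "y \<in> ball p s" using t e by (auto simp: y_def dist_norm)
    have ee: "e \<bullet> e = 1" using e by (simp add: norm_eq_1)
    have "y - (y \<bullet> e) *\<^sub>R e = p - (p \<bullet> e) *\<^sub>R e"
      by (simp add: y_def inner_diff_left ee algebra_simps)
    moreover have "\<not> g (p - (p \<bullet> e) *\<^sub>R e) < p \<bullet> e" using iff[of p] np r by simp
    ultimately have "p \<bullet> e \<le> g (y - (y \<bullet> e) *\<^sub>R e)" by simp
    moreover have "y \<bullet> e = p \<bullet> e - t" by (simp add: y_def inner_diff_left ee)
    ultimately have below: "y \<bullet> e < g (y - (y \<bullet> e) *\<^sub>R e)" using t by linarith
    define U where "U = ball p r \<inter> {x. x \<bullet> e < g (x - (x \<bullet> e) *\<^sub>R e)}"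
    have "continuous_on UNIV g" using g by (rule lipschitz_on_continuous_on)
    then have "continuous_on UNIV (\<lambda>x. g (x - (x \<bullet> e) *\<^sub>R e))"
      by (rule continuous_on_compose2) (auto intro!: continuous_intros)
    then have "open U"
      unfolding U_def by (intro open_Int open_ball open_Collect_less continuous_intros)
    moreover have "U \<inter> \<Omega> = {}" using iff by (fastforce simp: U_def)
    ultimately have "U \<inter> closure \<Omega> = {}" using open_Int_closure_eq_empty by blast
    moreover have "y \<in> U" using y below by (simp add: U_def)
    ultimately show False using y(2) s(2) by blast
  qed
qed

lemma mesh_element_interior:
  assumes "bounded_polyhedral_lipschitz_domain \<Omega>" "conforming_mesh \<Omega> \<T>" "T \<in> \<T>"
  shows "interior T \<subseteq> \<Omega>"
proof -
  have "T \<subseteq> closure \<Omega>" using assms by (auto simp: conforming_mesh_def)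
  then have "interior T \<subseteq> interior (closure \<Omega>)" by (rule interior_mono)
  then show ?thesis
    using interior_closure_lipschitz_domain assms(1)
    by (auto simp: bounded_polyhedral_lipschitz_domain_def)
qed

lemma negligible_convex_diff_interior:
  fixes T :: "'a::euclidean_space set"
  shows "convex T \<Longrightarrow> negligible (T - interior T)"
  by (rule negligible_subset[OF negligible_convex_frontier]) (auto simp: frontier_def closure_def)

text \<open>
  The common face of two distinct elements is a proper face of one of them and misses its interior.
\<close>

lemma mesh_elements_overlap_negligible:
  fixes \<T> :: "'a::euclidean_space set set"
  assumes m: "conforming_mesh \<Omega> \<T>" and T: "T \<in> \<T>" "T' \<in> \<T>" "T \<noteq> T'"
  shows "negligible (T \<inter> T')"
proof -
  have empty: "interior (S \<inter> S') = {}" if S: "S \<in> \<T>" "S' \<in> \<T>" "S \<inter> S' \<noteq> S" for S S'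
  proof -
    have "(S \<inter> S') face_of S" using m S by (auto simp: conforming_mesh_def triangulation_def)
    then have "(S \<inter> S') \<inter> interior S = {}" using S(3) by (rule face_of_disjoint_interior)
    then show ?thesis using interior_subset[of "S \<inter> S'"] by auto
  qed
  have "interior (T \<inter> T') = {}"
    using empty[OF T(1,2)] empty[OF T(2,1)] T(3) by (metis inf.commute)
  moreover have "convex S" if "S \<in> \<T>" for S
    using m that convex_simplex[of "int DIM('a)" S] by (simp add: conforming_mesh_def)
  then have "convex (T \<inter> T')" using T by (intro convex_Int)
  ultimately show ?thesis by (simp add: negligible_convex_interior)
qed

text \<open>
  Elements are closed simplices, so they are contained in the open domain only up to null sets.
\<close>

definition essentially_within :: "'a::euclidean_space set \<Rightarrow> 'a set \<Rightarrow> bool" where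
  "essentially_within T \<Omega> \<longleftrightarrow> T \<in> sets lebesgue \<and> \<Omega> \<in> sets lebesgue \<and> negligible (T - \<Omega>)"

lemma AE_lebesgue_on_iff: "S \<in> sets lebesgue \<Longrightarrow> (AE x in lebesgue_on S. P x) \<longleftrightarrow> (AE x in lebesgue. x \<in> S \<longrightarrow> P x)"
  by (subst AE_restrict_space_iff) auto

lemma negligible_imp_AE: "negligible N \<Longrightarrow> AE x in lebesgue. x \<notin> N"
  using AE_not_in negligible_iff_null_sets by blast

lemma AE_essentially_within:
  assumes "essentially_within T \<Omega>" "AE x in lebesgue_on \<Omega>. P x"
  shows "AE x in lebesgue_on T. P x"
proof -
  have "AE x in lebesgue. x \<in> \<Omega> \<longrightarrow> P x"
    using assms by (simp add: essentially_within_def AE_lebesgue_on_iff)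
  moreover have "AE x in lebesgue. x \<notin> T - \<Omega>"
    using assms(1) by (intro negligible_imp_AE) (simp add: essentially_within_def)
  ultimately have "AE x in lebesgue. x \<in> T \<longrightarrow> P x" by eventually_elim auto
  then show ?thesis using assms by (simp add: essentially_within_def AE_lebesgue_on_iff)
qed

lemma measurable_essentially_within:
  fixes g :: "'a::euclidean_space \<Rightarrow> 'b::euclidean_space"
  assumes w: "essentially_within T \<Omega>" and g: "g \<in> borel_measurable (lebesgue_on \<Omega>)"
  shows "g \<in> borel_measurable (lebesgue_on T)"
proof -
  have "(\<lambda>x. if x \<in> \<Omega> then g x else 0) \<in> borel_measurable lebesgue"
    using g w by (simp add: borel_measurable_if essentially_within_def)
  then have "(\<lambda>x. if x \<in> \<Omega> then g x else 0) \<in> borel_measurable (lebesgue_on T)"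
    by (rule measurable_restrict_space1)
  moreover have "AE x in lebesgue_on T. (if x \<in> \<Omega> then g x else 0) = g x"
    by (rule AE_essentially_within[OF w], rule AE_I2) simp
  moreover have "T \<in> sets lebesgue" using w by (simp add: essentially_within_def)
  ultimately show ?thesis by (rule borel_measurable_lebesgue_on_AE)
qed

lemma integrable_essentially_within:
  fixes F :: "'a::euclidean_space \<Rightarrow> real"
  assumes w: "essentially_within T \<Omega>" and F: "integrable (lebesgue_on \<Omega>) F"
  shows "integrable (lebesgue_on T) F"
    and "integral\<^sup>L (lebesgue_on T) F = (\<integral>x. indicator T x * F x \<partial>lebesgue_on \<Omega>)"
    and "integrable (lebesgue_on \<Omega>) (\<lambda>x. indicator T x * F x)"
proof -
  have s: "T \<in> sets lebesgue" "\<Omega> \<in> sets lebesgue" and n: "negligible (T - \<Omega>)"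
    using w by (auto simp: essentially_within_def)
  have F': "integrable lebesgue (\<lambda>x. indicator \<Omega> x *\<^sub>R F x)"
    using F s by (simp only: integrable_lebesgue_on)
  have T\<Omega>: "integrable lebesgue (\<lambda>x. indicator T x *\<^sub>R (indicator \<Omega> x *\<^sub>R F x))"
    using integrable_mult_indicator[OF s(1) F'] .
  have m: "F \<in> borel_measurable (lebesgue_on T)"
    using measurable_essentially_within[OF w borel_measurable_integrable[OF F]] .
  have "(\<lambda>x. if x \<in> T then F x else 0) \<in> borel_measurable lebesgue"
    using m s by (simp add: borel_measurable_if)
  moreover have "(\<lambda>x. if x \<in> T then F x else 0) = (\<lambda>x. indicator T x *\<^sub>R F x)" by auto
  ultimately have m': "(\<lambda>x. indicator T x *\<^sub>R F x) \<in> borel_measurable lebesgue" by metis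
  have ae: "AE x in lebesgue. indicator T x *\<^sub>R (indicator \<Omega> x *\<^sub>R F x) = indicator T x *\<^sub>R F x"
    using negligible_imp_AE[OF n] by eventually_elim (auto simp: indicator_def)
  have "integrable lebesgue (\<lambda>x. indicator T x *\<^sub>R F x)"
    by (rule integrable_cong_AE_imp[OF T\<Omega> m' ae])
  then show "integrable (lebesgue_on T) F" using s by (simp only: integrable_lebesgue_on)
  have comm: "indicator T x *\<^sub>R (indicator \<Omega> x *\<^sub>R F x) = indicator \<Omega> x *\<^sub>R (indicator T x * F x)" for x
    by simp
  show "integrable (lebesgue_on \<Omega>) (\<lambda>x. indicator T x * F x)"
    using T\<Omega> unfolding comm using s by (simp only: integrable_lebesgue_on)
  have "(\<integral>x. indicator T x *\<^sub>R (indicator \<Omega> x *\<^sub>R F x) \<partial>lebesgue) = (\<integral>x. indicator T x *\<^sub>R F x \<partial>lebesgue)"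
    by (rule integral_cong_AE[OF borel_measurable_integrable[OF T\<Omega>] m' ae])
  then show "integral\<^sup>L (lebesgue_on T) F = (\<integral>x. indicator T x * F x \<partial>lebesgue_on \<Omega>)"
    unfolding comm using s by (simp only: integral_lebesgue_on)
qed

lemma L2_essentially_within:
  fixes g :: "'a::euclidean_space \<Rightarrow> 'b::euclidean_space"
  assumes "essentially_within T \<Omega>" "g \<in> L2 \<Omega>"
  shows "g \<in> L2 T"
proof -
  have "integrable (lebesgue_on \<Omega>) (\<lambda>x. (norm (g x))\<^sup>2)" using assms(2) by (simp add: L2_def)
  then show ?thesis
    using measurable_essentially_within[OF assms(1) L2_measurable[OF assms(2)]]
      integrable_essentially_within(1)[OF assms(1)] by (simp add: L2_def)
qed

lemma l2_norm_essentially_within_le: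
  fixes g :: "'a::euclidean_space \<Rightarrow> 'b::euclidean_space"
  assumes w: "essentially_within T \<Omega>" and g: "g \<in> L2 \<Omega>"
  shows "l2_norm T g \<le> l2_norm \<Omega> g"
proof -
  have i: "integrable (lebesgue_on \<Omega>) (\<lambda>x. g x \<bullet> g x)" by (rule L2_integrable_inner[OF g g])
  have "l2_inner T g g \<le> l2_inner \<Omega> g g"
    unfolding l2_inner_def integrable_essentially_within(2)[OF w i]
    by (intro integral_mono integrable_essentially_within(3)[OF w i] i) (simp add: indicator_def)
  then show ?thesis by (simp add: l2_norm_def)
qed

text \<open>Almost every point lies in at most one element.\<close>

lemma sum_mesh_integrals_le:
  fixes F :: "'a::euclidean_space \<Rightarrow> real"
  assumes fin: "finite \<T>" and w: "\<And>T. T \<in> \<T> \<Longrightarrow> essentially_within T \<Omega>"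
    and disj: "\<And>T T'. T \<in> \<T> \<Longrightarrow> T' \<in> \<T> \<Longrightarrow> T \<noteq> T' \<Longrightarrow> negligible (T \<inter> T')"
    and F: "integrable (lebesgue_on \<Omega>) F" "\<And>x. F x \<ge> 0" and \<Omega>: "\<Omega> \<in> sets lebesgue"
  shows "(\<Sum>T\<in>\<T>. integral\<^sup>L (lebesgue_on T) F) \<le> integral\<^sup>L (lebesgue_on \<Omega>) F"
proof -
  define N where "N = (\<Union>T\<in>\<T>. \<Union>T'\<in>\<T> - {T}. T \<inter> T')"
  have "negligible (\<Union>T'\<in>\<T> - {T}. T \<inter> T')" if "T \<in> \<T>" for T
    by (rule negligible_Union) (use fin disj that in auto)
  then have "negligible N"
    unfolding N_def by (intro negligible_Union) (use fin in auto)
  from negligible_imp_AE[OF this] have "AE x in lebesgue_on \<Omega>. x \<notin> N"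
    using \<Omega> by (subst AE_lebesgue_on_iff) (auto elim: eventually_mono)
  then have ae: "AE x in lebesgue_on \<Omega>. (\<Sum>T\<in>\<T>. indicator T x * F x) \<le> F x"
  proof eventually_elim
    case (elim x)
    show ?case
    proof (cases "\<exists>T\<in>\<T>. x \<in> T")
      case True
      then obtain T where T: "T \<in> \<T>" "x \<in> T" by blast
      have "indicator T' x * F x = 0" if "T' \<in> \<T> - {T}" for T'
        using elim T that by (auto simp: N_def indicator_def)
      then have "(\<Sum>T'\<in>\<T> - {T}. indicator T' x * F x) = 0" by (rule sum.neutral[OF ballI])
      then have "(\<Sum>T\<in>\<T>. indicator T x * F x) = indicator T x * F x"
        by (simp only: sum.remove[OF fin T(1)] add_0_right)
      then show ?thesis using F(2)[of x] by (simp add: indicator_def)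
    next
      case False
      then have "(\<Sum>T\<in>\<T>. indicator T x * F x) = 0" by (intro sum.neutral) auto
      then show ?thesis using F(2)[of x] by simp
    qed
  qed
  have "(\<Sum>T\<in>\<T>. integral\<^sup>L (lebesgue_on T) F) = (\<Sum>T\<in>\<T>. \<integral>x. indicator T x * F x \<partial>lebesgue_on \<Omega>)"
    using w F(1) by (intro sum.cong refl integrable_essentially_within(2))
  also have "\<dots> = (\<integral>x. (\<Sum>T\<in>\<T>. indicator T x * F x) \<partial>lebesgue_on \<Omega>)"
    using w F(1) by (intro Bochner_Integration.integral_sum[symmetric] integrable_essentially_within(3))
  also have "\<dots> \<le> integral\<^sup>L (lebesgue_on \<Omega>) F"
    using w F(1) by (intro integral_mono_AE Bochner_Integration.integrable_sum
        integrable_essentially_within(3) ae)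
  finally show ?thesis .
qed

section \<open>The discrete spaces\<close>

lemma Vh0_H10: "v \<in> Vh0 \<Omega> \<T> \<Longrightarrow> v \<in> H10 \<Omega>"
  by (simp add: Vh0_def)

lemma Vh0_lincomb:
  assumes "open \<Omega>" "v \<in> Vh0 \<Omega> \<T>" "w \<in> Vh0 \<Omega> \<T>"
  shows "(\<lambda>x. v x + c * w x) \<in> Vh0 \<Omega> \<T>"
  unfolding Vh0_def
proof (intro CollectI conjI ballI)
  show "(\<lambda>x. v x + c * w x) \<in> H10 \<Omega>" using assms by (intro H10_lincomb Vh0_H10)
  fix T assume "T \<in> \<T>"
  then obtain a b a' b' where "AE x in lebesgue_on T. v x = a + b \<bullet> x" "AE x in lebesgue_on T. w x = a' + b' \<bullet> x"
    using assms unfolding Vh0_def by blast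
  then have "AE x in lebesgue_on T. v x + c * w x = (a + c * a') + (b + c *\<^sub>R b') \<bullet> x"
    by eventually_elim (simp add: inner_add_left algebra_simps)
  then show "\<exists>a b. AE x in lebesgue_on T. v x + c * w x = a + b \<bullet> x" by blast
qed

lemma Vb_lincomb:
  assumes "v \<in> Vb \<Omega> \<T>" "w \<in> Vb \<Omega> \<T>"
  shows "(\<lambda>x. v x + r * w x) \<in> Vb \<Omega> \<T>"
proof -
  obtain c d where "AE x in lebesgue_on \<Omega>. v x = (\<Sum>T\<in>\<T>. c T * bubble T x)"
      "AE x in lebesgue_on \<Omega>. w x = (\<Sum>T\<in>\<T>. d T * bubble T x)"
    using assms unfolding Vb_def by blast
  then have "AE x in lebesgue_on \<Omega>. v x + r * w x = (\<Sum>T\<in>\<T>. (c T + r * d T) * bubble T x)"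
    by eventually_elim (simp add: distrib_right sum.distrib sum_distrib_left mult.assoc)
  then show ?thesis unfolding Vb_def by (intro CollectI exI)
qed

lemma Vhb0_diff:
  assumes "open \<Omega>" "v \<in> Vhb0 \<Omega> \<T>" "w \<in> Vhb0 \<Omega> \<T>"
  shows "(\<lambda>x. v x - w x) \<in> Vhb0 \<Omega> \<T>"
proof -
  obtain a b a' b' where "a \<in> Vh0 \<Omega> \<T>" "b \<in> Vb \<Omega> \<T>" "v = (\<lambda>x. a x + b x)"
      "a' \<in> Vh0 \<Omega> \<T>" "b' \<in> Vb \<Omega> \<T>" "w = (\<lambda>x. a' x + b' x)"
    using assms unfolding Vhb0_def by blast
  then have "(\<lambda>x. a x - a' x) \<in> Vh0 \<Omega> \<T>" "(\<lambda>x. b x - b' x) \<in> Vb \<Omega> \<T>"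
      "(\<lambda>x. v x - w x) = (\<lambda>x. (a x - a' x) + (b x - b' x))"
    using Vh0_lincomb[OF assms(1), of a \<T> a' "-1"] Vb_lincomb[of b \<Omega> \<T> b' "-1"] by auto
  then show ?thesis
    unfolding Vhb0_def
    by (intro CollectI exI[of _ "\<lambda>x. a x - a' x"] exI[of _ "\<lambda>x. b x - b' x"] conjI)
qed

text \<open>
  The decomposition is determined only up to null sets; these properties hold for every choice of
  representatives.
\<close>

lemma kappa_decomposition:
  assumes "w \<in> Vhb0 \<Omega> \<T>"
  shows "kappa \<Omega> \<T> w \<in> Vh0 \<Omega> \<T>" "(\<lambda>x. w x - kappa \<Omega> \<T> w x) \<in> Vb \<Omega> \<T>"
proof -
  have "\<exists>v. v \<in> Vh0 \<Omega> \<T> \<and> (\<exists>b\<in>Vb \<Omega> \<T>. w = (\<lambda>x. v x + b x))"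
    using assms unfolding Vhb0_def by blast
  from someI_ex[OF this] have k: "kappa \<Omega> \<T> w \<in> Vh0 \<Omega> \<T>"
      "\<exists>b\<in>Vb \<Omega> \<T>. w = (\<lambda>x. kappa \<Omega> \<T> w x + b x)"
    unfolding kappa_def by blast+
  from k(2) obtain b where b: "b \<in> Vb \<Omega> \<T>" "w = (\<lambda>x. kappa \<Omega> \<T> w x + b x)" by blast
  have "w x - kappa \<Omega> \<T> w x = b x" for x using fun_cong[OF b(2), of x] by simp
  then show "(\<lambda>x. w x - kappa \<Omega> \<T> w x) \<in> Vb \<Omega> \<T>" using b(1) by simp
  show "kappa \<Omega> \<T> w \<in> Vh0 \<Omega> \<T>" by (rule k)
qed

locale fem_mesh =
  fixes \<Omega> :: "'a::euclidean_space set" and \<T> :: "'a set set"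
  assumes dom: "bounded_polyhedral_lipschitz_domain \<Omega>" and mesh: "conforming_mesh \<Omega> \<T>"
begin

lemma open_domain: "open \<Omega>" and bounded_domain: "bounded \<Omega>" and lebesgue_domain: "\<Omega> \<in> sets lebesgue"
  using dom by (auto simp: bounded_polyhedral_lipschitz_domain_def)

lemma finite_mesh: "finite \<T>"
  using mesh by (simp add: conforming_mesh_def triangulation_def)

lemma mesh_nonempty: "\<T> \<noteq> {}"
proof
  assume "\<T> = {}"
  then have "closure \<Omega> = {}" using mesh by (auto simp: conforming_mesh_def)
  then show False using dom by (simp add: bounded_polyhedral_lipschitz_domain_def)
qed

lemma simplex_element: "T \<in> \<T> \<Longrightarrow> int DIM('a) simplex T"
  using mesh by (simp add: conforming_mesh_def)

lemma interior_element: "T \<in> \<T> \<Longrightarrow> interior T \<subseteq> \<Omega>"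
  using mesh_element_interior[OF dom mesh] .

lemma lebesgue_element: "T \<in> \<T> \<Longrightarrow> T \<in> sets lebesgue"
  using compact_simplex[OF simplex_element] by (simp add: borel_compact)

lemma element_within_interior: "T \<in> \<T> \<Longrightarrow> essentially_within T (interior T)"
  using negligible_convex_diff_interior[OF convex_simplex[OF simplex_element]] lebesgue_element
  by (simp add: essentially_within_def)

lemma element_within: "T \<in> \<T> \<Longrightarrow> essentially_within T \<Omega>"
  using element_within_interior[of T] interior_element[of T] lebesgue_domain
    negligible_subset[of "T - interior T" "T - \<Omega>"]
  by (auto simp: essentially_within_def)

lemma overlap: "T \<in> \<T> \<Longrightarrow> T' \<in> \<T> \<Longrightarrow> T \<noteq> T' \<Longrightarrow> negligible (T \<inter> T')"
  using mesh_elements_overlap_negligible[OF mesh] .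

text \<open>
  In the interior of an element the function is affine, and weak gradients are local and unique.
\<close>

lemma wgrad_Vh0_const:
  assumes v: "v \<in> Vh0 \<Omega> \<T>" and T: "T \<in> \<T>"
  shows "\<exists>b. AE x in lebesgue_on T. wgrad \<Omega> v x = b"
proof -
  obtain a b where ab: "AE x in lebesgue_on T. v x = a + b \<bullet> x"
    using v T unfolding Vh0_def by blast
  have "has_weak_gradient (interior T) v (wgrad \<Omega> v)"
    by (rule has_weak_gradient_subset[OF H1_wgrad(2)[OF open_domain H10_imp_H1[OF Vh0_H10[OF v]]]
          interior_element[OF T]]) (auto simp: lebesgue_domain)
  moreover have "has_weak_gradient (interior T) (\<lambda>x. a + b \<bullet> x) (\<lambda>x. b)"
    by (rule has_weak_gradient_affine) simp
  moreover have "essentially_within (interior T) T"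
    using interior_subset[of T] lebesgue_element[OF T] by (simp add: essentially_within_def Diff_eq_empty_iff[THEN iffD2])
  then have "AE x in lebesgue_on (interior T). v x = a + b \<bullet> x"
    using ab by (rule AE_essentially_within)
  ultimately have "AE x in lebesgue_on (interior T). wgrad \<Omega> v x = b"
    by (rule has_weak_gradient_unique[OF open_interior])
  then show ?thesis
    using AE_essentially_within[OF element_within_interior[OF T]] by blast
qed

text \<open>
  The bubbles of the other elements do not contribute on \<open>T\<close>: their gradients vanish outside their
  own elements, which meet \<open>T\<close> in null sets.
\<close>

lemma Vb_bubble_gradient:
  assumes w: "w \<in> Vb \<Omega> \<T>"
  shows "w \<in> H10 \<Omega>"
    and "T \<in> \<T> \<Longrightarrow> \<exists>c. AE x in lebesgue_on T. wgrad \<Omega> w x = c *\<^sub>R wgrad \<Omega> (bubble T) x"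
proof -
  obtain c where c: "AE x in lebesgue_on \<Omega>. w x = (\<Sum>T\<in>\<T>. c T * bubble T x)"
    using w unfolding Vb_def by blast
  have bub: "bubble T \<in> H10 \<Omega>" "AE x in lebesgue_on \<Omega>. x \<notin> T \<longrightarrow> wgrad \<Omega> (bubble T) x = 0" if "T \<in> \<T>" for T
    using bubble_H10[OF open_domain bounded_domain simplex_element[OF that] interior_element[OF that]] .
  have ws: "AE x in lebesgue_on \<Omega>. (\<Sum>T\<in>\<T>. c T * bubble T x) = w x"
    using c by eventually_elim simp
  show w': "w \<in> H10 \<Omega>"
    by (rule H10_AE_cong[OF open_domain H10_sum[OF open_domain finite_mesh bub(1)] ws])
  have wg: "has_weak_gradient \<Omega> (bubble T) (wgrad \<Omega> (bubble T))" if "T \<in> \<T>" for T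
    using H1_wgrad(2)[OF open_domain H10_imp_H1[OF bub(1)[OF that]]] .
  have "has_weak_gradient \<Omega> (\<lambda>x. \<Sum>T\<in>S. c T * bubble T x) (\<lambda>x. \<Sum>T\<in>S. c T *\<^sub>R wgrad \<Omega> (bubble T) x)"
    if "finite S" "S \<subseteq> \<T>" for S
    using that
  proof (induction S rule: finite_induct)
    case empty
    show ?case using has_weak_gradient_affine[OF lebesgue_domain, of 0 0] by simp
  next
    case (insert T S)
    have S: "has_weak_gradient \<Omega> (\<lambda>x. \<Sum>T\<in>S. c T * bubble T x) (\<lambda>x. \<Sum>T\<in>S. c T *\<^sub>R wgrad \<Omega> (bubble T) x)"
      using insert by simp
    show ?case
      using has_weak_gradient_lincomb[OF lebesgue_domain S wg[of T], of "c T"] insert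
      by (simp add: add.commute)
  qed
  from has_weak_gradient_AE_cong[OF lebesgue_domain this[OF finite_mesh order_refl] ws]
  have G: "AE x in lebesgue_on \<Omega>. wgrad \<Omega> w x = (\<Sum>T\<in>\<T>. c T *\<^sub>R wgrad \<Omega> (bubble T) x)"
    by (rule wgrad_AE_eq[OF open_domain])
  assume T: "T \<in> \<T>"
  have "AE x in lebesgue_on \<Omega>. \<forall>T\<in>\<T>. x \<notin> T \<longrightarrow> wgrad \<Omega> (bubble T) x = 0"
    unfolding AE_ball_countable[OF countable_finite[OF finite_mesh]] using bub(2) by blast
  note ae = AE_essentially_within[OF element_within[OF T] G] AE_essentially_within[OF element_within[OF T] this]
  have "negligible (\<Union>T'\<in>\<T> - {T}. T \<inter> T')"
    by (rule negligible_Union) (use finite_mesh overlap T in auto)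
  from negligible_imp_AE[OF this] have "AE x in lebesgue_on T. x \<notin> (\<Union>T'\<in>\<T> - {T}. T \<inter> T')"
    using lebesgue_element[OF T] by (subst AE_lebesgue_on_iff) (auto elim: eventually_mono)
  with ae AE_space have "AE x in lebesgue_on T. wgrad \<Omega> w x = c T *\<^sub>R wgrad \<Omega> (bubble T) x"
  proof eventually_elim
    case (elim x)
    have "(\<Sum>T'\<in>\<T> - {T}. c T' *\<^sub>R wgrad \<Omega> (bubble T') x) = 0"
      using elim by (intro sum.neutral) auto
    then show ?case using elim(1) finite_mesh T by (simp add: sum.remove[of \<T> T])
  qed
  then show "\<exists>c. AE x in lebesgue_on T. wgrad \<Omega> w x = c *\<^sub>R wgrad \<Omega> (bubble T) x" by blast
qed

lemma Vhb0_H10: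
  assumes "w \<in> Vhb0 \<Omega> \<T>"
  shows "w \<in> H10 \<Omega>"
proof -
  have "(\<lambda>x. kappa \<Omega> \<T> w x + 1 * (w x - kappa \<Omega> \<T> w x)) \<in> H10 \<Omega>"
    using kappa_decomposition[OF assms] by (intro H10_lincomb open_domain Vh0_H10 Vb_bubble_gradient(1))
  then show ?thesis by simp
qed

lemma wgrad_L2: "v \<in> H10 \<Omega> \<Longrightarrow> wgrad \<Omega> v \<in> L2 \<Omega>"
  by (rule H1_wgrad(3)[OF open_domain H10_imp_H1])

text \<open>
  On an element the gradient of a bubble has mean value zero, whereas the gradient of a piecewise
  affine function is constant. The two parts of a function are therefore orthogonal there.
\<close>

lemma l2_inner_wgrad_Vh0_Vb:
  assumes v: "v \<in> Vh0 \<Omega> \<T>" and w: "w \<in> Vb \<Omega> \<T>" and T: "T \<in> \<T>"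
  shows "l2_inner T (wgrad \<Omega> v) (wgrad \<Omega> w) = 0"
proof -
  note win = element_within[OF T]
  obtain b where b: "AE x in lebesgue_on T. wgrad \<Omega> v x = b" using wgrad_Vh0_const[OF v T] by blast
  obtain c where c: "AE x in lebesgue_on T. wgrad \<Omega> w x = c *\<^sub>R wgrad \<Omega> (bubble T) x"
    using Vb_bubble_gradient(2)[OF w T] by blast
  have bub: "bubble T \<in> H10 \<Omega>" "AE x in lebesgue_on \<Omega>. x \<notin> T \<longrightarrow> wgrad \<Omega> (bubble T) x = 0"
    using bubble_H10[OF open_domain bounded_domain simplex_element[OF T] interior_element[OF T]] .
  have g: "wgrad \<Omega> (bubble T) \<in> L2 \<Omega>" and bL2: "(\<lambda>x. b) \<in> L2 \<Omega>"
    using wgrad_L2[OF bub(1)] L2_const[OF open_domain bounded_domain] .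
  have F: "integrable (lebesgue_on \<Omega>) (\<lambda>x. b \<bullet> wgrad \<Omega> (bubble T) x)"
    using L2_integrable_inner[OF bL2 g] .
  have "l2_inner T (wgrad \<Omega> v) (wgrad \<Omega> w) = l2_inner T (\<lambda>x. b) (\<lambda>x. c *\<^sub>R wgrad \<Omega> (bubble T) x)"
    using b c v w by (intro l2_inner_AE_cong L2_essentially_within[OF win] wgrad_L2 Vh0_H10
        Vb_bubble_gradient(1) lebesgue_element T)
  also have "\<dots> = c * (\<integral>x. b \<bullet> wgrad \<Omega> (bubble T) x \<partial>lebesgue_on T)"
    by (simp add: l2_inner_def)
  also have "(\<integral>x. b \<bullet> wgrad \<Omega> (bubble T) x \<partial>lebesgue_on T) = (\<integral>x. indicator T x * (b \<bullet> wgrad \<Omega> (bubble T) x) \<partial>lebesgue_on \<Omega>)"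
    by (rule integrable_essentially_within(2)[OF win F])
  also have "\<dots> = (\<integral>x. b \<bullet> wgrad \<Omega> (bubble T) x \<partial>lebesgue_on \<Omega>)"
  proof (rule integral_cong_AE)
    show "AE x in lebesgue_on \<Omega>. indicator T x * (b \<bullet> wgrad \<Omega> (bubble T) x) = b \<bullet> wgrad \<Omega> (bubble T) x"
      using bub(2) by eventually_elim (auto simp: indicator_def)
  qed (use integrable_essentially_within(3)[OF win F] F in auto)
  also have "\<dots> = 0"
    using H10_wgrad_orthogonal_const[OF open_domain bounded_domain bub(1), of b]
    by (simp add: l2_inner_def inner_commute)
  finally show ?thesis by simp
qed

text \<open>
  By orthogonality on \<open>T\<close>, this is the theorem of Pythagoras.
\<close>

lemma l2_norm_wgrad_Vh0_le:
  assumes v: "v \<in> Vh0 \<Omega> \<T>" and w: "(\<lambda>x. u x - v x) \<in> Vb \<Omega> \<T>" and T: "T \<in> \<T>"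
  shows "l2_norm T (wgrad \<Omega> v) \<le> l2_norm T (wgrad \<Omega> u)"
proof (rule power2_le_imp_le)
  let ?w = "\<lambda>x. u x - v x"
  note win = element_within[OF T]
  have H: "v \<in> H10 \<Omega>" "?w \<in> H10 \<Omega>" using v w by (auto intro: Vh0_H10 Vb_bubble_gradient(1))
  note L2 = H[THEN wgrad_L2, THEN L2_essentially_within[OF win]]
  have "AE x in lebesgue_on \<Omega>. wgrad \<Omega> u x = wgrad \<Omega> v x + 1 *\<^sub>R wgrad \<Omega> ?w x"
    using wgrad_lincomb[OF open_domain H10_imp_H1[OF H(1)] H10_imp_H1[OF H(2)], of 1] by simp
  from AE_essentially_within[OF win this]
  have eq: "AE x in lebesgue_on T. wgrad \<Omega> v x + 1 *\<^sub>R wgrad \<Omega> ?w x = wgrad \<Omega> u x"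
    by eventually_elim simp
  have "(l2_norm T (wgrad \<Omega> u))\<^sup>2 = (l2_norm T (\<lambda>x. wgrad \<Omega> v x + 1 *\<^sub>R wgrad \<Omega> ?w x))\<^sup>2"
    using l2_norm_AE_cong[OF L2_lincomb[OF L2] eq lebesgue_element[OF T]] by simp
  also have "\<dots> = (l2_norm T (wgrad \<Omega> v))\<^sup>2 + (l2_norm T (wgrad \<Omega> ?w))\<^sup>2"
    unfolding l2_norm_square l2_inner_lincomb_self[OF L2] l2_inner_wgrad_Vh0_Vb[OF v w T] by simp
  finally show "(l2_norm T (wgrad \<Omega> v))\<^sup>2 \<le> (l2_norm T (wgrad \<Omega> u))\<^sup>2" by simp
qed simp

lemma sum_l2_norm_le:
  fixes g :: "'a \<Rightarrow> 'b::euclidean_space"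
  assumes "g \<in> L2 \<Omega>"
  shows "(\<Sum>T\<in>\<T>. (l2_norm T g)\<^sup>2) \<le> (l2_norm \<Omega> g)\<^sup>2"
  unfolding l2_norm_square l2_inner_def
  by (rule sum_mesh_integrals_le[OF finite_mesh element_within overlap L2_integrable_inner[OF assms assms] _ lebesgue_domain])
    auto

end

section \<open>The Dynamic Diffusion problem\<close>

lemma Linf_bounded:
  assumes "f \<in> Linf S"
  obtains M where "M \<ge> 0" "AE x in lebesgue_on S. norm (f x) \<le> M"
proof -
  let ?e = "esssup (lebesgue_on S) (\<lambda>x. ereal (norm (f x)))"
  have "?e < \<infinity>" using assms by (simp add: Linf_def)
  then obtain M :: real where M: "M \<ge> 0" "?e \<le> ereal M"
  proof (cases ?e)
    case (real r)
    then show thesis by (intro that[of "max 0 r"]) auto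
  qed (auto intro: that[of 0])
  have "AE x in lebesgue_on S. norm (f x) \<le> M"
    using esssup_AE[of "\<lambda>x. ereal (norm (f x))" "lebesgue_on S"]
  proof eventually_elim
    case (elim x)
    then have "ereal (norm (f x)) \<le> ereal M" using M(2) by (rule order_trans)
    then show ?case by simp
  qed
  with M(1) show thesis by (rule that)
qed

text \<open>
  On a set of positive measure the essential supremum of the norm of a bounded function is a
  nonnegative real number, so its conversion from the extended reals loses nothing.
\<close>

lemma linf_norm_bound:
  fixes f :: "'a::euclidean_space \<Rightarrow> 'b::euclidean_space"
  assumes f: "f \<in> borel_measurable (lebesgue_on T)" and bd: "AE x in lebesgue_on T. norm (f x) \<le> M"
    and T: "T \<in> sets lebesgue" "\<not> negligible T"
  shows "AE x in lebesgue_on T. norm (f x) \<le> linf_norm T f" "linf_norm T f \<ge> 0"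
proof -
  let ?e = "esssup (lebesgue_on T) (\<lambda>x. ereal (norm (f x)))"
  have "(\<lambda>x. norm (f x)) \<in> borel_measurable (lebesgue_on T)" using f by measurable
  then have m: "(\<lambda>x. ereal (norm (f x))) \<in> borel_measurable (lebesgue_on T)"
    by (rule borel_measurable_ereal)
  have le: "?e \<le> ereal M" by (rule esssup_I[OF m]) (use bd in simp)
  have ae: "AE x in lebesgue_on T. ereal (norm (f x)) \<le> ?e" by (rule esssup_AE)
  have "0 \<le> ?e"
  proof (rule ccontr)
    assume neg: "\<not> 0 \<le> ?e"
    have "AE x in lebesgue_on T. False"
      using ae
    proof eventually_elim
      case (elim x)
      have "0 \<le> ereal (norm (f x))" by simp
      then show ?case using elim neg by (meson order_trans)
    qed
    then have "AE x in lebesgue. x \<notin> T"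
      using T(1) by (subst (asm) AE_lebesgue_on_iff) auto
    then have "T \<in> null_sets lebesgue" using T(1) by (simp add: AE_iff_null_sets)
    then show False using T(2) negligible_iff_null_sets by blast
  qed
  then obtain r where r: "?e = ereal r" "r \<ge> 0" using le by (cases ?e) auto
  then show "linf_norm T f \<ge> 0" by (simp add: linf_norm_def)
  show "AE x in lebesgue_on T. norm (f x) \<le> linf_norm T f"
    using ae by eventually_elim (simp add: r linf_norm_def)
qed

text \<open>
  With \<open>r, s\<close> the residual norms and \<open>a, b\<close> the gradient norms of two functions, this is the source of
  the constant \<^const>\<open>L_T0\<close>. The change of the numerator contributes \<open>B\<close>. The change of the
  denominator is weighted by \<open>s / (b + \<tau>)\<close>, which stays below \<open>B + F / \<tau>\<close> because the residual grows at
  most linearly in the gradient; this is the number \<^const>\<open>q_T\<close>.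
\<close>

lemma quotient_Lipschitz:
  fixes a b r s :: real
  assumes "a \<ge> 0" "b \<ge> 0" "\<tau> > 0" "s \<ge> 0" "B \<ge> 0" "F \<ge> 0"
    and rs: "\<bar>r - s\<bar> \<le> B * d" and ab: "\<bar>a - b\<bar> \<le> d" and s: "s \<le> B * b + F"
  shows "\<bar>r / (a + \<tau>) - s / (b + \<tau>)\<bar> \<le> (B + (B + inverse \<tau> * F)) * d / \<tau>"
proof -
  have pos: "a + \<tau> > 0" "b + \<tau> > 0" using assms by auto
  have d: "d \<ge> 0" using ab by linarith
  have frac: "\<bar>x\<bar> / (a + \<tau>) \<le> y / \<tau>" if "\<bar>x\<bar> \<le> y" for x y
    using that assms by (intro frac_le) auto
  have "s \<le> B * b + F" by fact
  also have "\<dots> \<le> (B + inverse \<tau> * F) * (b + \<tau>)"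
    using assms by (simp add: algebra_simps)
  finally have q: "s / (b + \<tau>) \<le> B + inverse \<tau> * F" using pos by (simp add: divide_le_eq)
  have "r / A - s / B' = (r - s) / A + s / B' * ((B' - A) / A)" if "A > 0" "B' > 0" for A B' :: real
    using that by (simp add: diff_divide_distrib right_diff_distrib)
  from this[OF pos]
  have "r / (a + \<tau>) - s / (b + \<tau>) = (r - s) / (a + \<tau>) + s / (b + \<tau>) * ((b - a) / (a + \<tau>))"
    by simp
  also have "\<bar>\<dots>\<bar> \<le> \<bar>r - s\<bar> / (a + \<tau>) + s / (b + \<tau>) * (\<bar>b - a\<bar> / (a + \<tau>))"
    using pos assms by (intro order_trans[OF abs_triangle_ineq]) (simp add: abs_mult)
  also have "\<dots> \<le> B * d / \<tau> + (B + inverse \<tau> * F) * (d / \<tau>)"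
    using pos assms d q
    by (intro add_mono mult_mono frac) (auto simp: abs_minus_commute)
  also have "\<dots> = (B + (B + inverse \<tau> * F)) * d / \<tau>"
    by (simp add: distrib_right add_divide_distrib)
  finally show ?thesis .
qed

locale dynamic_diffusion = fem_mesh \<Omega> \<T> for \<Omega> :: "'a::euclidean_space set" and \<T> +
  fixes \<epsilon> \<tau> :: real and \<beta> :: "'a \<Rightarrow> 'a" and f :: "'a \<Rightarrow> real" and \<mu> :: "real \<Rightarrow> real"
  assumes \<epsilon>: "\<epsilon> > 0" and \<tau>: "\<tau> > 0"
    and \<beta>_W1inf: "\<And>i. i \<in> Basis \<Longrightarrow> (\<lambda>x. \<beta> x \<bullet> i) \<in> W1inf \<Omega>"
    and div_free: "AE x in lebesgue_on \<Omega>. weak_div \<Omega> \<beta> x = 0"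
    and f: "f \<in> L2 \<Omega>"
    and \<mu>: "\<And>T. T \<in> \<T> \<Longrightarrow> \<mu> (diameter T) > 0"
begin

lemma \<beta>_weak_gradient: "i \<in> Basis \<Longrightarrow> has_weak_gradient \<Omega> (\<lambda>x. \<beta> x \<bullet> i) (wgrad \<Omega> (\<lambda>x. \<beta> x \<bullet> i))"
  using \<beta>_W1inf has_weak_gradient_wgrad unfolding W1inf_def by blast

lemma \<beta>_measurable: "\<beta> \<in> borel_measurable (lebesgue_on \<Omega>)"
  unfolding borel_measurable_euclidean_space[of \<beta>]
  using \<beta>_W1inf by (auto simp: W1inf_def Linf_def)

lemma \<beta>_bounded: "\<exists>M\<ge>0. AE x in lebesgue_on \<Omega>. norm (\<beta> x) \<le> M"
proof -
  have "\<exists>M\<ge>0. AE x in lebesgue_on \<Omega>. norm (\<beta> x \<bullet> i) \<le> M" if "i \<in> Basis" for i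
  proof -
    have "(\<lambda>x. \<beta> x \<bullet> i) \<in> Linf \<Omega>" using \<beta>_W1inf[OF that] by (simp add: W1inf_def)
    then show ?thesis using Linf_bounded by metis
  qed
  then obtain M where M: "\<And>i. i \<in> Basis \<Longrightarrow> M i \<ge> 0 \<and> (AE x in lebesgue_on \<Omega>. norm (\<beta> x \<bullet> i) \<le> M i)"
    by metis
  have "AE x in lebesgue_on \<Omega>. \<forall>i\<in>Basis. norm (\<beta> x \<bullet> i) \<le> M i"
    unfolding AE_ball_countable[OF countable_finite[OF finite_Basis]] using M by blast
  then have "AE x in lebesgue_on \<Omega>. norm (\<beta> x) \<le> (\<Sum>i\<in>Basis. M i)"
  proof eventually_elim
    case (elim x)
    have "norm (\<beta> x) \<le> (\<Sum>i\<in>Basis. \<bar>\<beta> x \<bullet> i\<bar>)" by (rule norm_le_l1)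
    also have "\<dots> \<le> (\<Sum>i\<in>Basis. M i)" using elim by (intro sum_mono) auto
    finally show ?case .
  qed
  moreover have "(\<Sum>i\<in>Basis. M i) \<ge> 0" using M by (intro sum_nonneg) auto
  ultimately show ?thesis by blast
qed

lemma \<beta>_L2: "g \<in> L2 \<Omega> \<Longrightarrow> (\<lambda>x. \<beta> x \<bullet> g x) \<in> L2 \<Omega>"
  using \<beta>_bounded bounded_field_inner_L2(1)[OF \<beta>_measurable] by blast

lemma convection_Vhb0: "v \<in> H10 \<Omega> \<Longrightarrow> l2_inner \<Omega> (\<lambda>x. \<beta> x \<bullet> wgrad \<Omega> v x) v = 0"
  using \<beta>_bounded convection_eq_0[OF open_domain \<beta>_weak_gradient \<beta>_measurable _ _ div_free] by blast

text \<open>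
  An element has full affine dimension, hence interior points.
\<close>

lemma element_not_negligible:
  assumes "T \<in> \<T>"
  shows "\<not> negligible T"
proof -
  have "aff_dim T = int DIM('a)" using aff_dim_simplex[OF simplex_element[OF assms]] .
  then have "rel_interior T = interior T" "T \<noteq> {}"
    using rel_interior_interior[of T] aff_dim_eq_full[of T] by auto
  then have "interior T \<noteq> {}"
    using rel_interior_eq_empty[OF convex_simplex[OF simplex_element[OF assms]]] by simp
  then show ?thesis
    using open_not_negligible[OF open_interior] negligible_subset[OF _ interior_subset] by blast
qed

lemma \<beta>_linf_norm:
  assumes T: "T \<in> \<T>"
  shows "\<beta> \<in> borel_measurable (lebesgue_on T)" "AE x in lebesgue_on T. norm (\<beta> x) \<le> linf_norm T \<beta>"
    and "linf_norm T \<beta> \<ge> 0"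
proof -
  obtain M where M: "AE x in lebesgue_on \<Omega>. norm (\<beta> x) \<le> M" using \<beta>_bounded by blast
  show m: "\<beta> \<in> borel_measurable (lebesgue_on T)"
    by (rule measurable_essentially_within[OF element_within[OF T] \<beta>_measurable])
  show "AE x in lebesgue_on T. norm (\<beta> x) \<le> linf_norm T \<beta>" "linf_norm T \<beta> \<ge> 0"
    using linf_norm_bound[OF m AE_essentially_within[OF element_within[OF T] M]
        lebesgue_element[OF T] element_not_negligible[OF T]] .
qed

lemma xi_nonneg: "T \<in> \<T> \<Longrightarrow> xi \<Omega> \<epsilon> \<beta> f \<mu> \<tau> T v \<ge> 0"
  using \<mu>[of T] \<tau> by (auto simp: xi_def chi_def intro!: mult_nonneg_nonneg divide_nonneg_nonneg add_nonneg_nonneg)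

lemma L_T0_bounds:
  assumes "T \<in> \<T>"
  shows "0 \<le> L_T0 \<epsilon> \<beta> f \<mu> \<tau> T" "L_T0 \<epsilon> \<beta> f \<mu> \<tau> T \<le> L_h0 \<T> \<epsilon> \<beta> f \<mu> \<tau>"
  using \<mu>[OF assms] \<tau> \<beta>_linf_norm(3)[OF assms] finite_mesh assms
  by (auto simp: L_T0_def L_h0_def q_T_def chi_def intro!: mult_nonneg_nonneg add_nonneg_nonneg)

lemma L_h0_nonneg: "0 \<le> L_h0 \<T> \<epsilon> \<beta> f \<mu> \<tau>"
  using mesh_nonempty L_T0_bounds order_trans by blast

lemma wgrad_diff:
  assumes u: "u \<in> H10 \<Omega>" and v: "v \<in> H10 \<Omega>"
  shows "AE x in lebesgue_on \<Omega>. wgrad \<Omega> (\<lambda>x. u x - v x) x = wgrad \<Omega> u x - wgrad \<Omega> v x"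
  using wgrad_lincomb[OF open_domain H10_imp_H1[OF u] H10_imp_H1[OF v], of "-1"] by simp

lemma xi_Lipschitz:
  assumes T: "T \<in> \<T>" and u: "u \<in> H10 \<Omega>" and v: "v \<in> H10 \<Omega>"
  shows "\<bar>xi \<Omega> \<epsilon> \<beta> f \<mu> \<tau> T u - xi \<Omega> \<epsilon> \<beta> f \<mu> \<tau> T v\<bar> \<le>
    L_T0 \<epsilon> \<beta> f \<mu> \<tau> T * l2_norm T (wgrad \<Omega> (\<lambda>x. u x - v x))"
proof -
  let ?B = "linf_norm T \<beta>" and ?F = "l2_norm T f"
  let ?r = "\<lambda>w. l2_norm T (residual \<Omega> \<beta> f w)" and ?a = "\<lambda>w. l2_norm T (wgrad \<Omega> w)"
  let ?d = "\<lambda>x. u x - v x"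
  note win = element_within[OF T]
  have L2: "wgrad \<Omega> w \<in> L2 T" if "w \<in> H10 \<Omega>" for w
    using L2_essentially_within[OF win wgrad_L2[OF that]] .
  have fT: "f \<in> L2 T" using L2_essentially_within[OF win f] .
  note B = bounded_field_inner_L2[OF \<beta>_linf_norm[OF T]]
  have res: "residual \<Omega> \<beta> f w = (\<lambda>x. \<beta> x \<bullet> wgrad \<Omega> w x - f x)" for w
    by (simp add: residual_def fun_eq_iff)
  have resL2: "residual \<Omega> \<beta> f w \<in> L2 T" if "w \<in> H10 \<Omega>" for w
    unfolding res using B(1)[OF L2[OF that]] fT by (rule L2_diff)
  have ae: "AE x in lebesgue_on T. wgrad \<Omega> ?d x = wgrad \<Omega> u x - wgrad \<Omega> v x"
    by (rule AE_essentially_within[OF win wgrad_diff[OF u v]])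
  have dH: "?d \<in> H10 \<Omega>" using H10_lincomb[OF open_domain u v, of "-1"] by simp
  have d: "?a ?d = l2_norm T (\<lambda>x. wgrad \<Omega> u x - wgrad \<Omega> v x)"
    by (rule l2_norm_AE_cong[OF L2[OF dH] ae lebesgue_element[OF T]])
  have "\<bar>?r u - ?r v\<bar> \<le> l2_norm T (\<lambda>x. residual \<Omega> \<beta> f u x - residual \<Omega> \<beta> f v x)"
    using resL2 u v by (intro l2_norm_diff_le)
  also have "(\<lambda>x. residual \<Omega> \<beta> f u x - residual \<Omega> \<beta> f v x) = (\<lambda>x. \<beta> x \<bullet> (wgrad \<Omega> u x - wgrad \<Omega> v x))"
    by (simp add: res inner_diff_right)
  also have "l2_norm T \<dots> \<le> ?B * ?a ?d"
    unfolding d by (rule B(2)[OF L2_diff[OF L2[OF u] L2[OF v]]])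
  finally have 1: "\<bar>?r u - ?r v\<bar> \<le> ?B * ?a ?d" .
  have 2: "\<bar>?a u - ?a v\<bar> \<le> ?a ?d"
    unfolding d by (rule l2_norm_diff_le[OF L2[OF u] L2[OF v]])
  have "?r v \<le> l2_norm T (\<lambda>x. \<beta> x \<bullet> wgrad \<Omega> v x) + ?F"
    using l2_norm_triangle[OF B(1)[OF L2[OF v]] fT, of "-1"] by (simp add: res)
  then have 3: "?r v \<le> ?B * ?a v + ?F" using B(2)[OF L2[OF v]] by linarith
  have "\<bar>?r u / (?a u + \<tau>) - ?r v / (?a v + \<tau>)\<bar> \<le> (?B + (?B + inverse \<tau> * ?F)) * ?a ?d / \<tau>"
    using 1 2 3 \<tau> \<beta>_linf_norm(3)[OF T] by (intro quotient_Lipschitz) auto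
  moreover have c: "chi \<epsilon> \<beta> T * \<mu> (diameter T) \<ge> 0" using \<mu>[OF T] by (simp add: chi_def)
  ultimately have "chi \<epsilon> \<beta> T * \<mu> (diameter T) * \<bar>?r u / (?a u + \<tau>) - ?r v / (?a v + \<tau>)\<bar> \<le>
      chi \<epsilon> \<beta> T * \<mu> (diameter T) * ((?B + (?B + inverse \<tau> * ?F)) * ?a ?d / \<tau>)"
    by (intro mult_left_mono)
  also have "\<dots> = L_T0 \<epsilon> \<beta> f \<mu> \<tau> T * ?a ?d"
    by (simp add: L_T0_def q_T_def)
  also have "chi \<epsilon> \<beta> T * \<mu> (diameter T) * \<bar>?r u / (?a u + \<tau>) - ?r v / (?a v + \<tau>)\<bar> =
      \<bar>xi \<Omega> \<epsilon> \<beta> f \<mu> \<tau> T u - xi \<Omega> \<epsilon> \<beta> f \<mu> \<tau> T v\<bar>"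
    unfolding xi_def right_diff_distrib[symmetric] abs_mult[of "chi \<epsilon> \<beta> T * \<mu> (diameter T)"] abs_of_nonneg[OF c] ..
  finally show ?thesis .
qed

lemma B_form_self:
  assumes "w \<in> H10 \<Omega>"
  shows "B_form \<Omega> \<epsilon> \<beta> 0 w w = \<epsilon> * (l2_norm \<Omega> (wgrad \<Omega> w))\<^sup>2"
  using convection_Vhb0[OF assms] by (simp add: B_form_def l2_norm_square)

text \<open>
  Testing the equation with the solution itself, the convective term vanishes and the artificial
  diffusion is nonnegative.
\<close>

lemma stability:
  assumes w: "DD_solution \<Omega> \<T> \<epsilon> \<beta> 0 f \<mu> \<tau> w" and P: "poincare_constant \<Omega> C"
  shows "\<epsilon> * (l2_norm \<Omega> (wgrad \<Omega> w))\<^sup>2 \<le> l2_norm \<Omega> f * (C * l2_norm \<Omega> (wgrad \<Omega> w))"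
proof -
  have wV: "w \<in> Vhb0 \<Omega> \<T>" and eq: "B_form \<Omega> \<epsilon> \<beta> 0 w w + D_form \<Omega> \<T> \<epsilon> \<beta> f \<mu> \<tau> w w w = l2_inner \<Omega> f w"
    using w by (auto simp: DD_solution_def)
  have wH: "w \<in> H10 \<Omega>" by (rule Vhb0_H10[OF wV])
  have "D_form \<Omega> \<T> \<epsilon> \<beta> f \<mu> \<tau> w w w \<ge> 0"
    unfolding D_form_def by (intro sum_nonneg mult_nonneg_nonneg xi_nonneg l2_inner_self_nonneg)
  then have "\<epsilon> * (l2_norm \<Omega> (wgrad \<Omega> w))\<^sup>2 \<le> l2_inner \<Omega> f w"
    using eq B_form_self[OF wH] by linarith
  also have "\<dots> \<le> l2_norm \<Omega> f * l2_norm \<Omega> w"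
    using l2_Cauchy_Schwarz[OF f H1_wgrad(1)[OF open_domain H10_imp_H1[OF wH]]] by linarith
  also have "\<dots> \<le> l2_norm \<Omega> f * (C * l2_norm \<Omega> (wgrad \<Omega> w))"
    using P wH by (intro mult_left_mono) (auto simp: poincare_constant_def)
  finally show ?thesis .
qed

lemma B_form_diff:
  assumes u: "u \<in> H10 \<Omega>" and v: "v \<in> H10 \<Omega>" and z: "z \<in> H10 \<Omega>"
  shows "B_form \<Omega> \<epsilon> \<beta> 0 (\<lambda>x. u x - v x) z = B_form \<Omega> \<epsilon> \<beta> 0 u z - B_form \<Omega> \<epsilon> \<beta> 0 v z"
proof -
  let ?e = "\<lambda>x. u x - v x"
  have e: "?e \<in> H10 \<Omega>" using H10_lincomb[OF open_domain u v, of "-1"] by simp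
  have zL2: "z \<in> L2 \<Omega>" using H1_wgrad(1)[OF open_domain H10_imp_H1[OF z]] .
  note ge = wgrad_diff[OF u v]
  have "l2_inner \<Omega> (wgrad \<Omega> ?e) (wgrad \<Omega> z) = l2_inner \<Omega> (\<lambda>x. wgrad \<Omega> u x - wgrad \<Omega> v x) (wgrad \<Omega> z)"
    by (rule l2_inner_AE_cong[OF wgrad_L2[OF e] wgrad_L2[OF z] ge AE_I2 lebesgue_domain]) simp
  moreover have "AE x in lebesgue_on \<Omega>. \<beta> x \<bullet> wgrad \<Omega> ?e x = \<beta> x \<bullet> wgrad \<Omega> u x - \<beta> x \<bullet> wgrad \<Omega> v x"
    using ge by eventually_elim (simp add: inner_diff_right)
  then have "l2_inner \<Omega> (\<lambda>x. \<beta> x \<bullet> wgrad \<Omega> ?e x) z =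
      l2_inner \<Omega> (\<lambda>x. \<beta> x \<bullet> wgrad \<Omega> u x - \<beta> x \<bullet> wgrad \<Omega> v x) z"
    by (rule l2_inner_AE_cong[OF \<beta>_L2[OF wgrad_L2[OF e]] zL2 _ AE_I2 lebesgue_domain]) simp
  ultimately show ?thesis
    using wgrad_L2 \<beta>_L2 u v z zL2
    by (simp add: B_form_def l2_inner_diff_left right_diff_distrib)
qed

text \<open>
  Subtracting the two equations and testing with the difference \<open>e\<close> of the solutions leaves, apart
  from a nonnegative diffusion term, only the change of the artificial diffusion.
\<close>

lemma error_estimate:
  assumes u: "DD_solution \<Omega> \<T> \<epsilon> \<beta> 0 f \<mu> \<tau> u" and v: "DD_solution \<Omega> \<T> \<epsilon> \<beta> 0 f \<mu> \<tau> v"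
  shows "\<epsilon> * (l2_norm \<Omega> (wgrad \<Omega> (\<lambda>x. u x - v x)))\<^sup>2 \<le>
    L_h0 \<T> \<epsilon> \<beta> f \<mu> \<tau> * l2_norm \<Omega> (wgrad \<Omega> v) * (l2_norm \<Omega> (wgrad \<Omega> (\<lambda>x. u x - v x)))\<^sup>2"
proof -
  let ?e = "\<lambda>x. u x - v x" and ?ku = "kappa \<Omega> \<T> u" and ?kv = "kappa \<Omega> \<T> v"
  let ?eh = "\<lambda>x. kappa \<Omega> \<T> u x - kappa \<Omega> \<T> v x"
  let ?xu = "\<lambda>T. xi \<Omega> \<epsilon> \<beta> f \<mu> \<tau> T ?ku" and ?xv = "\<lambda>T. xi \<Omega> \<epsilon> \<beta> f \<mu> \<tau> T ?kv"
  let ?L = "L_h0 \<T> \<epsilon> \<beta> f \<mu> \<tau>"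
  have V: "u \<in> Vhb0 \<Omega> \<T>" "v \<in> Vhb0 \<Omega> \<T>" using u v by (auto simp: DD_solution_def)
  then have eV: "?e \<in> Vhb0 \<Omega> \<T>" by (rule Vhb0_diff[OF open_domain])
  have H: "u \<in> H10 \<Omega>" "v \<in> H10 \<Omega>" "?e \<in> H10 \<Omega>" using V eV by (auto intro: Vhb0_H10)
  note ku = kappa_decomposition[OF V(1)] and kv = kappa_decomposition[OF V(2)]
  have eh: "?eh \<in> Vh0 \<Omega> \<T>" using Vh0_lincomb[OF open_domain ku(1) kv(1), of "-1"] by simp
  have "(\<lambda>x. ?e x - ?eh x) = (\<lambda>x. (u x - ?ku x) + (-1) * (v x - ?kv x))" by auto
  then have eb: "(\<lambda>x. ?e x - ?eh x) \<in> Vb \<Omega> \<T>"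
    using Vb_lincomb[OF ku(2) kv(2), of "-1"] by simp
  have "B_form \<Omega> \<epsilon> \<beta> 0 u ?e + D_form \<Omega> \<T> \<epsilon> \<beta> f \<mu> \<tau> u u ?e = l2_inner \<Omega> f ?e"
      "B_form \<Omega> \<epsilon> \<beta> 0 v ?e + D_form \<Omega> \<T> \<epsilon> \<beta> f \<mu> \<tau> v v ?e = l2_inner \<Omega> f ?e"
    using u v eV by (auto simp: DD_solution_def)
  then have "\<epsilon> * (l2_norm \<Omega> (wgrad \<Omega> ?e))\<^sup>2 =
      D_form \<Omega> \<T> \<epsilon> \<beta> f \<mu> \<tau> v v ?e - D_form \<Omega> \<T> \<epsilon> \<beta> f \<mu> \<tau> u u ?e"
    using B_form_diff[OF H] B_form_self[OF H(3)] by linarith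
  also have "\<dots> = (\<Sum>T\<in>\<T>. ?xv T * l2_inner T (wgrad \<Omega> v) (wgrad \<Omega> ?e)
      - ?xu T * l2_inner T (wgrad \<Omega> u) (wgrad \<Omega> ?e))"
    by (simp add: D_form_def sum_subtractf)
  also have "\<dots> \<le> (\<Sum>T\<in>\<T>. ?L * l2_norm \<Omega> (wgrad \<Omega> v) * (l2_norm T (wgrad \<Omega> ?e))\<^sup>2)"
  proof (rule sum_mono)
    fix T assume T: "T \<in> \<T>"
    note win = element_within[OF T]
    have L2: "wgrad \<Omega> w \<in> L2 T" if "w \<in> H10 \<Omega>" for w
      using L2_essentially_within[OF win wgrad_L2[OF that]] .
    have "l2_inner T (wgrad \<Omega> ?e) (wgrad \<Omega> ?e) = l2_inner T (\<lambda>x. wgrad \<Omega> u x - wgrad \<Omega> v x) (wgrad \<Omega> ?e)"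
      using AE_essentially_within[OF win wgrad_diff[OF H(1,2)]]
      by (intro l2_inner_AE_cong L2 H lebesgue_element T) auto
    also have "\<dots> = l2_inner T (wgrad \<Omega> u) (wgrad \<Omega> ?e) - l2_inner T (wgrad \<Omega> v) (wgrad \<Omega> ?e)"
      by (intro l2_inner_diff_left L2 H)
    finally have split: "l2_inner T (wgrad \<Omega> ?e) (wgrad \<Omega> ?e) =
        l2_inner T (wgrad \<Omega> u) (wgrad \<Omega> ?e) - l2_inner T (wgrad \<Omega> v) (wgrad \<Omega> ?e)" .
    have "?xv T * l2_inner T (wgrad \<Omega> v) (wgrad \<Omega> ?e) - ?xu T * l2_inner T (wgrad \<Omega> u) (wgrad \<Omega> ?e)
        = (?xv T - ?xu T) * l2_inner T (wgrad \<Omega> v) (wgrad \<Omega> ?e)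
          - ?xu T * l2_inner T (wgrad \<Omega> ?e) (wgrad \<Omega> ?e)"
      unfolding split by (simp only: left_diff_distrib right_diff_distrib)
    also have "\<dots> \<le> (?xv T - ?xu T) * l2_inner T (wgrad \<Omega> v) (wgrad \<Omega> ?e)"
      using mult_nonneg_nonneg[OF xi_nonneg[OF T] l2_inner_self_nonneg] by simp
    also have "\<dots> \<le> \<bar>?xu T - ?xv T\<bar> * \<bar>l2_inner T (wgrad \<Omega> v) (wgrad \<Omega> ?e)\<bar>"
      unfolding abs_mult[symmetric] abs_minus_commute[of "?xu T"] by (rule abs_ge_self)
    also have "\<dots> \<le> (?L * l2_norm T (wgrad \<Omega> ?e)) * (l2_norm \<Omega> (wgrad \<Omega> v) * l2_norm T (wgrad \<Omega> ?e))"
    proof (rule mult_mono)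
      have "\<bar>?xu T - ?xv T\<bar> \<le> L_T0 \<epsilon> \<beta> f \<mu> \<tau> T * l2_norm T (wgrad \<Omega> ?eh)"
        by (rule xi_Lipschitz[OF T Vh0_H10[OF ku(1)] Vh0_H10[OF kv(1)]])
      also have "\<dots> \<le> ?L * l2_norm T (wgrad \<Omega> ?e)"
        using L_T0_bounds[OF T] l2_norm_wgrad_Vh0_le[OF eh eb T] by (intro mult_mono) auto
      finally show "\<bar>?xu T - ?xv T\<bar> \<le> ?L * l2_norm T (wgrad \<Omega> ?e)" .
      have "\<bar>l2_inner T (wgrad \<Omega> v) (wgrad \<Omega> ?e)\<bar> \<le> l2_norm T (wgrad \<Omega> v) * l2_norm T (wgrad \<Omega> ?e)"
        by (rule l2_Cauchy_Schwarz[OF L2[OF H(2)] L2[OF H(3)]])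
      also have "\<dots> \<le> l2_norm \<Omega> (wgrad \<Omega> v) * l2_norm T (wgrad \<Omega> ?e)"
        by (intro mult_right_mono l2_norm_essentially_within_le[OF win] wgrad_L2 H) simp
      finally show "\<bar>l2_inner T (wgrad \<Omega> v) (wgrad \<Omega> ?e)\<bar> \<le> l2_norm \<Omega> (wgrad \<Omega> v) * l2_norm T (wgrad \<Omega> ?e)" .
    qed (auto intro: mult_nonneg_nonneg L_h0_nonneg)
    also have "\<dots> = ?L * l2_norm \<Omega> (wgrad \<Omega> v) * (l2_norm T (wgrad \<Omega> ?e))\<^sup>2"
      by (simp add: power2_eq_square)
    finally show "?xv T * l2_inner T (wgrad \<Omega> v) (wgrad \<Omega> ?e) - ?xu T * l2_inner T (wgrad \<Omega> u) (wgrad \<Omega> ?e)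
        \<le> ?L * l2_norm \<Omega> (wgrad \<Omega> v) * (l2_norm T (wgrad \<Omega> ?e))\<^sup>2" .
  qed
  also have "\<dots> = ?L * l2_norm \<Omega> (wgrad \<Omega> v) * (\<Sum>T\<in>\<T>. (l2_norm T (wgrad \<Omega> ?e))\<^sup>2)"
    by (simp add: sum_distrib_left)
  also have "\<dots> \<le> ?L * l2_norm \<Omega> (wgrad \<Omega> v) * (l2_norm \<Omega> (wgrad \<Omega> ?e))\<^sup>2"
    by (intro mult_left_mono sum_l2_norm_le wgrad_L2 H mult_nonneg_nonneg L_h0_nonneg l2_norm_nonneg)
  finally show ?thesis .
qed

lemma uniqueness:
  assumes u: "DD_solution \<Omega> \<T> \<epsilon> \<beta> 0 f \<mu> \<tau> u" and v: "DD_solution \<Omega> \<T> \<epsilon> \<beta> 0 f \<mu> \<tau> v"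
    and P: "poincare_constant \<Omega> C"
    and small: "C * L_h0 \<T> \<epsilon> \<beta> f \<mu> \<tau> * l2_norm \<Omega> f / \<epsilon>\<^sup>2 < 1"
  shows "AE x in lebesgue_on \<Omega>. u x = v x"
proof -
  let ?e = "\<lambda>x. u x - v x" and ?L = "L_h0 \<T> \<epsilon> \<beta> f \<mu> \<tau>"
  let ?E = "l2_norm \<Omega> (wgrad \<Omega> ?e)" and ?V = "l2_norm \<Omega> (wgrad \<Omega> v)"
  have eH: "?e \<in> H10 \<Omega>"
    using u v Vhb0_H10 Vhb0_diff[OF open_domain] by (auto simp: DD_solution_def)
  have "?E = 0"
  proof (rule ccontr)
    assume "?E \<noteq> 0"
    \<comment> \<open>dividing the error estimate by the square of \<open>?E\<close>\<close>
    then have "?E > 0" using l2_norm_nonneg[of \<Omega> "wgrad \<Omega> ?e"] by linarith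
    then have LV: "\<epsilon> \<le> ?L * ?V" using error_estimate[OF u v] by simp
    then have "?V \<noteq> 0" using \<epsilon> by auto
    then have V: "?V > 0" using l2_norm_nonneg[of \<Omega> "wgrad \<Omega> v"] by linarith
    then have "\<epsilon> * ?V \<le> l2_norm \<Omega> f * C"
      using stability[OF v P] by (simp add: power2_eq_square mult.assoc[symmetric])
    then have "?L * (\<epsilon> * ?V) \<le> ?L * (l2_norm \<Omega> f * C)" using L_h0_nonneg by (rule mult_left_mono)
    moreover have "\<epsilon> * \<epsilon> \<le> \<epsilon> * (?L * ?V)" using LV \<epsilon> by (intro mult_left_mono) auto
    ultimately have "\<epsilon>\<^sup>2 \<le> C * ?L * l2_norm \<Omega> f" by (simp add: power2_eq_square mult.commute mult.left_commute)
    then show False using small \<epsilon> by (simp add: field_simps)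
  qed
  moreover have "l2_norm \<Omega> ?e \<le> C * ?E" using P eH by (simp add: poincare_constant_def)
  ultimately have "l2_norm \<Omega> ?e = 0" using l2_norm_nonneg[of \<Omega> ?e] by simp
  then have "l2_inner \<Omega> ?e ?e = 0" using l2_norm_square[of \<Omega> ?e] by simp
  moreover have eL2: "?e \<in> L2 \<Omega>" by (rule H1_wgrad(1)[OF open_domain H10_imp_H1[OF eH]])
  ultimately have "AE x in lebesgue_on \<Omega>. ?e x \<bullet> ?e x = 0"
    using integral_nonneg_eq_0_iff_AE[OF L2_integrable_inner[OF eL2 eL2]] by (simp add: l2_inner_def)
  then show ?thesis by eventually_elim simp
qed

end

theorem theorem4p2:
  fixes \<Omega> :: "'a::euclidean_space set"
    and H :: "real set" and \<T> :: "real \<Rightarrow> 'a set set" and h :: real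
    and \<epsilon> \<sigma> \<tau> C\<^sub>P :: real
    and \<beta> :: "'a \<Rightarrow> 'a" and f :: "'a \<Rightarrow> real" and \<mu> :: "real \<Rightarrow> real"
    and u v :: "'a \<Rightarrow> real"
  assumes "DIM('a) \<in> {2, 3}"
    and "bounded_polyhedral_lipschitz_domain \<Omega>"
    and "shape_regular_mesh_family \<Omega> H \<T>" and "h \<in> H"
    and "\<epsilon> > 0"
    and "\<forall>i\<in>Basis. (\<lambda>x. \<beta> x \<bullet> i) \<in> W1inf \<Omega>"
    and "AE x in lebesgue_on \<Omega>. weak_div \<Omega> \<beta> x = 0"
    and "\<sigma> = 0"
    and "f \<in> L2 \<Omega>"
    and "\<tau> > 0"
    and "\<forall>k\<in>H. \<forall>T\<in>\<T> k. \<mu> (diameter T) > 0"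
    and "\<exists>C\<^sub>\<mu>. \<forall>k\<in>H. \<forall>T\<in>\<T> k. \<mu> (diameter T) \<le> C\<^sub>\<mu> * diameter T"
    and "poincare_constant \<Omega> C\<^sub>P"
    and "DD_solution \<Omega> (\<T> h) \<epsilon> \<beta> \<sigma> f \<mu> \<tau> u"
    and "DD_solution \<Omega> (\<T> h) \<epsilon> \<beta> \<sigma> f \<mu> \<tau> v"
    and "C\<^sub>P * L_h0 (\<T> h) \<epsilon> \<beta> f \<mu> \<tau> * l2_norm \<Omega> f / \<epsilon>\<^sup>2 < 1"
  shows "AE x in lebesgue_on \<Omega>. u x = v x"
proof -
  interpret dynamic_diffusion \<Omega> "\<T> h" \<epsilon> \<tau> \<beta> f \<mu>
    using assms by unfold_locales (auto simp: shape_regular_mesh_family_def)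
  show ?thesis
    using assms by (intro uniqueness) auto
qed

end
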